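(* Let $p$ be a prime and let $G$ be a $p$-group of maximal class of order $p^n$ with $n\ge 4$. Then the Bogomolov multiplier $\mathrm{B}_0(G)$ is trivial if and only if $[P_1,P_1]=[P_1,P_{n-2}]$.
   Context: A $p$-group of maximal class is a group of order $p^n$ and nilpotency class $n-1$. For such $G$ with $n\ge 4$, set $P_i=\gamma_i(G)$ (the $i$-th term of the lower central series) for $i\ge 2$, and $P_1=C_G(P_2/P_4)$; also $P_i=1$ for $i\ge n$. Commutators are $[x,y]=x^{-1}y^{-1}xy$ and $x^y=y^{-1}xy$. The curly exterior square $G\curlywedge G$ is the group generated by symbols $x\curlywedge y$ ($x,y\in G$) subject to the relations $xy\curlywedge z=(x^y\curlywedge z^y)(y\curlywedge z)$, $x\curlywedge yz=(x\curlywedge z)(x^z\curlywedge y^z)$ for all $x,y,z\in G$, and $a\curlywedge b=1$ whenever $[a,b]=1$. There is a canonical epimorphism $G\curlywedge G\to[G,G]$, $x\curlywedge y\mapsto [x,y]$; the Bogomolov multiplier $\mathrm{B}_0(G)$ is (isomorphic to) its kernel. *)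

theory Defs
  imports "HOL-Algebra.Algebra"
begin

definition comm :: "('a, 'b) monoid_scheme \<Rightarrow> 'a \<Rightarrow> 'a \<Rightarrow> 'a" where
  "comm G x y = inv\<^bsub>G\<^esub> x \<otimes>\<^bsub>G\<^esub> inv\<^bsub>G\<^esub> y \<otimes>\<^bsub>G\<^esub> x \<otimes>\<^bsub>G\<^esub> y"

definition conjg :: "('a, 'b) monoid_scheme \<Rightarrow> 'a \<Rightarrow> 'a \<Rightarrow> 'a" where
  "conjg G x y = inv\<^bsub>G\<^esub> y \<otimes>\<^bsub>G\<^esub> x \<otimes>\<^bsub>G\<^esub> y"

definition comm_subgroup :: "('a, 'b) monoid_scheme \<Rightarrow> 'a set \<Rightarrow> 'a set \<Rightarrow> 'a set" where
  "comm_subgroup G H K = generate G {comm G h k | h k. h \<in> H \<and> k \<in> K}"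

fun lcs :: "('a, 'b) monoid_scheme \<Rightarrow> nat \<Rightarrow> 'a set" where
  "lcs G 0 = carrier G"
| "lcs G (Suc 0) = carrier G"
| "lcs G (Suc (Suc i)) = comm_subgroup G (lcs G (Suc i)) (carrier G)"

definition nilpotent_class :: "('a, 'b) monoid_scheme \<Rightarrow> nat \<Rightarrow> bool" where
  "nilpotent_class G c \<longleftrightarrow> lcs G (Suc c) = {\<one>\<^bsub>G\<^esub>} \<and> (\<forall>d<c. lcs G (Suc d) \<noteq> {\<one>\<^bsub>G\<^esub>})"

definition maximal_class_pgroup :: "('a, 'b) monoid_scheme \<Rightarrow> nat \<Rightarrow> nat \<Rightarrow> bool" where
  "maximal_class_pgroup G p n \<longleftrightarrow> group G \<and> finite (carrier G) \<and> Factorial_Ring.prime p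
      \<and> order G = p ^ n \<and> nilpotent_class G (n - 1)"

text \<open>The subgroups P_i (for n >= 4): P_1 = C_G(P_2/P_4), P_i = gamma_i for i >= 2
  (note gamma_i = 1 for i >= n automatically when G has class n-1).\<close>
definition P1 :: "('a, 'b) monoid_scheme \<Rightarrow> 'a set" where
  "P1 G = {g \<in> carrier G. \<forall>x \<in> lcs G 2. comm G g x \<in> lcs G 4}"

definition Pser :: "('a, 'b) monoid_scheme \<Rightarrow> nat \<Rightarrow> 'a set" where
  "Pser G i = (if i \<le> 1 then P1 G else lcs G i)"

text \<open>Words in the generators x \<curlywedge> y: a letter (x, y, True) stands for x \<curlywedge> y,
  (x, y, False) for its inverse.  The group G \<curlywedge> G is the set of words over
  carrier elements modulo the congruence generated by free cancellation and the
  defining relations.\<close>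

type_synonym 'a cword = "('a \<times> 'a \<times> bool) list"

definition cwords :: "('a, 'b) monoid_scheme \<Rightarrow> 'a cword set" where
  "cwords G = {w. \<forall>(x, y, b) \<in> set w. x \<in> carrier G \<and> y \<in> carrier G}"

inductive curly_eq :: "('a, 'b) monoid_scheme \<Rightarrow> 'a cword \<Rightarrow> 'a cword \<Rightarrow> bool"
  for G where
  refl: "w \<in> cwords G \<Longrightarrow> curly_eq G w w"
| sym: "curly_eq G u v \<Longrightarrow> curly_eq G v u"
| trans: "curly_eq G u v \<Longrightarrow> curly_eq G v w \<Longrightarrow> curly_eq G u w"
| ctxt: "curly_eq G u v \<Longrightarrow> a \<in> cwords G \<Longrightarrow> c \<in> cwords G \<Longrightarrow> curly_eq G (a @ u @ c) (a @ v @ c)"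
| cancel: "x \<in> carrier G \<Longrightarrow> y \<in> carrier G \<Longrightarrow> curly_eq G [(x, y, b), (x, y, \<not> b)] []"
| rel_left: "x \<in> carrier G \<Longrightarrow> y \<in> carrier G \<Longrightarrow> z \<in> carrier G \<Longrightarrow>
    curly_eq G [(x \<otimes>\<^bsub>G\<^esub> y, z, True)] [(conjg G x y, conjg G z y, True), (y, z, True)]"
| rel_right: "x \<in> carrier G \<Longrightarrow> y \<in> carrier G \<Longrightarrow> z \<in> carrier G \<Longrightarrow>
    curly_eq G [(x, y \<otimes>\<^bsub>G\<^esub> z, True)] [(x, z, True), (conjg G x z, conjg G y z, True)]"
| rel_comm: "a \<in> carrier G \<Longrightarrow> b \<in> carrier G \<Longrightarrow> comm G a b = \<one>\<^bsub>G\<^esub> \<Longrightarrow>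
    curly_eq G [(a, b, True)] []"

text \<open>The canonical epimorphism G \<curlywedge> G \<rightarrow> [G,G], x \<curlywedge> y \<mapsto> [x,y], on words.\<close>
fun curly_eval :: "('a, 'b) monoid_scheme \<Rightarrow> 'a cword \<Rightarrow> 'a" where
  "curly_eval G [] = \<one>\<^bsub>G\<^esub>"
| "curly_eval G ((x, y, b) # w) =
     (if b then comm G x y else inv\<^bsub>G\<^esub> (comm G x y)) \<otimes>\<^bsub>G\<^esub> curly_eval G w"

text \<open>B_0(G) is the kernel of that epimorphism; it is trivial iff every word
  mapping to 1 is equal to the empty word (the identity) in G \<curlywedge> G.\<close>
definition B0_trivial :: "('a, 'b) monoid_scheme \<Rightarrow> bool" where
  "B0_trivial G \<longleftrightarrow> (\<forall>w \<in> cwords G. curly_eval G w = \<one>\<^bsub>G\<^esub> \<longrightarrow> curly_eq G w [])"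

end

(* Write t(x, y) for a generator of the curly exterior square; it depends only on x and [x, y].

   If [P_1, P_1] = [P_1, P_{n-2}], choose s outside P_1 which, unless P_1 is abelian, does not centralize some
   t in P_{n-2} either. Every t(u, v) with u, v in P_1 can be moved to some t(a, s) with a in P_{n-2}, and these
   elements are central. Consequently every element of the square has the form t(u, s) with u in P_1, and it is
   in the kernel only if u and s commute, that is, if it is trivial.

   Otherwise let m be maximal with [P_1, P_1] <= P_m, and let b be the alternating form on P_1 with values in
   P_m / P_{m+1} (identified with the p-th roots of unity) induced by the commutator. A fragment of Blackburn's theory
   shows that P_{m-1} lies in the radical of b and that p is odd. The projection f of G onto P_1 along powers
   of s is a crossed homomorphism modulo the radical, so b(f(x)^y, f(y)) is a 2-cocycle. In the resulting central
   extension, commuting pairs of G lift to commuting pairs, whereas the kernel element obtained by dividing t(x, y),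
   where b(x, y) is nontrivial, by a product of letters with one entry in P_{m-1} evaluates to b(x, y)^2, which is
   not 1. *)
theory Submission
  imports Defs Complex_Main
begin

section \<open>Commutators\<close>

text \<open>That a kernel element is nontrivial has to be seen by a homomorphism out of the curly
  square, that is, by a pairing satisfying the defining relations. The commutator pairing of a
  central extension is one as soon as commuting pairs of G lift to commuting pairs. The obstacle is
  that s^p need not be 1, so the projection f is not a crossed homomorphism on the nose. The error
  is a power of s inside P_1, hence an element of P_1 centralizing s. If P_1 centralizes P_k /
  P_(k+2) for all k < m, such elements lie in P_m, which b ignores. For k = m - 1 this condition
  says precisely that P_(m-1) lies in the radical, which is why the radical has to be controlled at
  all. Blackburn's theory supplies it for m < n - 1. For m = n - 1 it comes from the failing
  equation itself, since P_(n-1) has order p; in this direction the index n - 2 enters only there.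
  The square b(x, y)^2 is the quotient of b(x, y) by b(y, x), and for p = 2 it would carry no
  information.\<close>

context group
begin

lemma mult_inv_cancel [simp]:
  assumes "x \<in> carrier G" "y \<in> carrier G"
  shows "x \<otimes> (inv x \<otimes> y) = y" and "inv x \<otimes> (x \<otimes> y) = y"
  using assms by (simp_all add: m_assoc [symmetric])

lemma comm_closed [simp, intro]: "x \<in> carrier G \<Longrightarrow> y \<in> carrier G \<Longrightarrow> comm G x y \<in> carrier G"
  by (simp add: comm_def)

lemma conjg_closed [simp, intro]: "x \<in> carrier G \<Longrightarrow> y \<in> carrier G \<Longrightarrow> conjg G x y \<in> carrier G"
  by (simp add: conjg_def)

lemmas comm_calc = comm_def conjg_def m_assoc inv_mult_group

lemma conjg_one [simp]: "x \<in> carrier G \<Longrightarrow> conjg G x \<one> = x"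
  and one_conjg [simp]: "x \<in> carrier G \<Longrightarrow> conjg G \<one> x = \<one>"
  and conjg_self [simp]: "x \<in> carrier G \<Longrightarrow> conjg G x x = x"
  by (simp_all add: comm_calc)

lemma comm_self [simp]: "x \<in> carrier G \<Longrightarrow> comm G x x = \<one>"
  and comm_one_left [simp]: "x \<in> carrier G \<Longrightarrow> comm G \<one> x = \<one>"
  and comm_one_right [simp]: "x \<in> carrier G \<Longrightarrow> comm G x \<one> = \<one>"
  by (simp_all add: comm_calc)

lemma conjg_mult_left:
  assumes "x \<in> carrier G" "y \<in> carrier G" "g \<in> carrier G"
  shows "conjg G (x \<otimes> y) g = conjg G x g \<otimes> conjg G y g"
  using assms by (simp add: comm_calc)

lemma conjg_conjg:
  assumes "x \<in> carrier G" "g \<in> carrier G" "h \<in> carrier G"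
  shows "conjg G (conjg G x g) h = conjg G x (g \<otimes> h)"
  using assms by (simp add: comm_calc)

lemma conjg_inv_conjg [simp]:
  assumes "x \<in> carrier G" "g \<in> carrier G"
  shows "conjg G (conjg G x (inv g)) g = x" "conjg G (conjg G x g) (inv g) = x"
  using assms by (simp_all add: comm_calc)

lemma conjg_eq_comm:
  assumes "x \<in> carrier G" "g \<in> carrier G"
  shows "conjg G x g = x \<otimes> comm G x g"
  using assms by (simp add: comm_calc)

lemma inv_comm_eq:
  assumes "x \<in> carrier G" "y \<in> carrier G"
  shows "inv (comm G x y) = comm G y x"
  using assms by (simp add: comm_calc)

lemma conjg_comm:
  assumes "x \<in> carrier G" "y \<in> carrier G" "g \<in> carrier G"
  shows "conjg G (comm G x y) g = comm G (conjg G x g) (conjg G y g)"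
  using assms by (simp add: comm_calc)

lemma comm_mult_left:
  assumes "x \<in> carrier G" "y \<in> carrier G" "z \<in> carrier G"
  shows "comm G (x \<otimes> y) z = conjg G (comm G x z) y \<otimes> comm G y z"
  using assms by (simp add: comm_calc)

lemma comm_mult_right:
  assumes "x \<in> carrier G" "y \<in> carrier G" "z \<in> carrier G"
  shows "comm G x (y \<otimes> z) = comm G x z \<otimes> conjg G (comm G x y) z"
  using assms by (simp add: comm_calc)

lemma mult_swap_comm:
  assumes "x \<in> carrier G" "y \<in> carrier G"
  shows "x \<otimes> y = y \<otimes> x \<otimes> comm G x y"
  using assms by (simp add: comm_calc)

lemma comm_eq_one_iff:
  assumes "x \<in> carrier G" "y \<in> carrier G"
  shows "comm G x y = \<one> \<longleftrightarrow> x \<otimes> y = y \<otimes> x"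
  using mult_swap_comm[OF assms] r_cancel_one[of "comm G x y" "y \<otimes> x"] assms by simp

lemma comm_eq_one_sym:
  assumes "x \<in> carrier G" "y \<in> carrier G" "comm G x y = \<one>"
  shows "comm G y x = \<one>"
  using assms comm_eq_one_iff by metis

lemma comm_unique:
  assumes "x \<in> carrier G" "y \<in> carrier G" "c \<in> carrier G" "x \<otimes> y = y \<otimes> x \<otimes> c"
  shows "comm G x y = c"
proof -
  have "comm G x y = inv (y \<otimes> x) \<otimes> (x \<otimes> y)"
    using assms by (simp add: comm_calc)
  then show ?thesis
    using assms(1-3) by (simp add: assms(4) m_assoc inv_mult_group)
qed

lemma conjg_mem:
  assumes "N \<lhd> G" "x \<in> N" "g \<in> carrier G"
  shows "conjg G x g \<in> N"
  using assms normal.inv_op_closed1 by (auto simp: conjg_def)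

lemma comm_mem_left:
  assumes "N \<lhd> G" "x \<in> N" "g \<in> carrier G"
  shows "comm G x g \<in> N"
proof -
  interpret N: normal N G by fact
  have "comm G x g = inv x \<otimes> conjg G x g"
    using assms by (simp add: comm_calc)
  then show ?thesis using assms conjg_mem by simp
qed

lemma comm_mem_swap:
  assumes "subgroup N G" "x \<in> carrier G" "y \<in> carrier G" "comm G x y \<in> N"
  shows "comm G y x \<in> N"
  using assms by (metis inv_comm_eq subgroup.m_inv_closed)

text \<open>For normal \<open>N\<close> this is the preimage of a centralizer in the quotient by
  \<open>N\<close>. Congruences modulo a term of a series are stated as memberships throughout, so
  that all computations stay inside \<open>G\<close>.\<close>

definition centralizer_mod :: "'a set \<Rightarrow> 'a set \<Rightarrow> 'a set" where
  "centralizer_mod N A = {g \<in> carrier G. \<forall>a\<in>A. comm G a g \<in> N}"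

lemma subgroup_centralizer_mod:
  assumes "N \<lhd> G" "A \<subseteq> carrier G"
  shows "subgroup (centralizer_mod N A) G"
proof -
  interpret N: normal N G by fact
  show ?thesis
  proof (rule subgroupI)
    show "centralizer_mod N A \<noteq> {}"
      using assms by (auto simp: centralizer_mod_def subset_eq intro!: exI[of _ \<one>])
  next
    fix g assume g: "g \<in> centralizer_mod N A"
    have "comm G a (inv g) = conjg G (inv (comm G a g)) (inv g)" if "a \<in> A" for a
      using that g assms(2) by (auto simp: centralizer_mod_def comm_calc subset_eq)
    then show "inv g \<in> centralizer_mod N A"
      using g assms by (auto simp: centralizer_mod_def intro!: conjg_mem)
  next
    fix g h assume "g \<in> centralizer_mod N A" "h \<in> centralizer_mod N A"
    then show "g \<otimes> h \<in> centralizer_mod N A"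
      using assms by (auto simp: centralizer_mod_def comm_mult_right subset_eq intro!: conjg_mem)
  qed (auto simp: centralizer_mod_def)
qed

text \<open>The elements centralizing \<open>g\<close> modulo \<open>N\<close> form a subgroup
  containing \<open>P\<close> and \<open>x\<close>, hence also the coset of \<open>P\<close> in
  which \<open>y\<close> lies. The condition on \<open>y\<close> is the form in which the later
  generation lemmas express that a quotient is cyclic.\<close>

lemma comm_mem_cosets:
  assumes N: "N \<lhd> G" and g: "g \<in> carrier G" and P: "subgroup P G"
    and x: "x \<in> carrier G" "comm G x g \<in> N" and Pg: "\<And>v. v \<in> P \<Longrightarrow> comm G v g \<in> N"
    and y: "y \<otimes> inv (x [^] (j::nat)) \<in> P" "y \<in> carrier G"
  shows "comm G y g \<in> N"
proof -
  interpret N: normal N G by fact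
  have S: "subgroup (centralizer_mod N {g}) G"
    using subgroup_centralizer_mod N g by simp
  have PS: "v \<in> centralizer_mod N {g}" if "v \<in> P" for v
    using that P Pg g subgroup.mem_carrier[OF P] comm_mem_swap[OF N.subgroup_axioms]
    by (auto simp: centralizer_mod_def)
  have xS: "x \<in> centralizer_mod N {g}"
    using x g comm_mem_swap[OF N.subgroup_axioms] by (auto simp: centralizer_mod_def)
  have "y = (y \<otimes> inv (x [^] j)) \<otimes> x [^] j"
    using x y by (simp add: m_assoc)
  moreover have "x [^] j \<in> centralizer_mod N {g}"
    using xS by (induction j) (auto intro: subgroup.one_closed[OF S] subgroup.m_closed[OF S])
  ultimately have "y \<in> centralizer_mod N {g}"
    using PS[OF y(1)] subgroup.m_closed[OF S] by metis
  then show ?thesis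
    using g comm_mem_swap[OF N.subgroup_axioms] by (auto simp: centralizer_mod_def)
qed

text \<open>The familiar fact that a group which is cyclic modulo a central subgroup is abelian,
  read in G / N.\<close>

lemma comm_mem_cyclic_quotient:
  assumes N: "N \<lhd> G" and P: "subgroup P G"
    and PN: "\<And>v g. v \<in> P \<Longrightarrow> g \<in> carrier G \<Longrightarrow> comm G v g \<in> N"
    and x: "x \<in> carrier G"
    and gen: "\<And>y. y \<in> carrier G \<Longrightarrow> \<exists>j::nat. y \<otimes> inv (x [^] j) \<in> P"
    and y: "y \<in> carrier G" and z: "z \<in> carrier G"
  shows "comm G y z \<in> N"
proof -
  interpret N: normal N G by fact
  have 1: "comm G y x \<in> N" if "y \<in> carrier G" for y
    using gen[OF that] comm_mem_cosets[OF N x P x] PN x that by auto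
  show ?thesis
    using gen[OF y] comm_mem_cosets[OF N z P x] PN y z
      comm_mem_swap[OF N.subgroup_axioms _ _ 1[OF z]] x by blast
qed

lemma comm_subgroup_normal:
  assumes "H \<lhd> G" "K \<lhd> G"
  shows "comm_subgroup G H K \<lhd> G"
proof -
  interpret H: normal H G by fact
  interpret K: normal K G by fact
  show ?thesis unfolding comm_subgroup_def
  proof (rule normal_generateI)
    show "{comm G h k |h k. h \<in> H \<and> k \<in> K} \<subseteq> carrier G" by auto
  next
    fix c g assume c: "c \<in> {comm G h k |h k. h \<in> H \<and> k \<in> K}" and g: "g \<in> carrier G"
    then obtain h k where hk: "h \<in> H" "k \<in> K" "c = comm G h k" by blast
    have "g \<otimes> c \<otimes> inv g = conjg G c (inv g)"
      using g hk by (simp add: conjg_def)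
    also have "\<dots> = comm G (conjg G h (inv g)) (conjg G k (inv g))"
      using hk g by (simp add: conjg_comm)
    finally show "g \<otimes> c \<otimes> inv g \<in> {comm G h k |h k. h \<in> H \<and> k \<in> K}"
      using conjg_mem[OF assms(1) hk(1)] conjg_mem[OF assms(2) hk(2)] g by blast
  qed
qed

lemma comm_subgroup_incl:
  assumes "subgroup N G" "\<And>h k. h \<in> H \<Longrightarrow> k \<in> K \<Longrightarrow> comm G h k \<in> N"
  shows "comm_subgroup G H K \<subseteq> N"
  unfolding comm_subgroup_def using assms by (intro generate_subgroup_incl) auto

lemma comm_in_comm_subgroup: "h \<in> H \<Longrightarrow> k \<in> K \<Longrightarrow> comm G h k \<in> comm_subgroup G H K"
  unfolding comm_subgroup_def by (auto intro: generate.incl)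

text \<open>Supplies an \<open>s\<close> that lies outside P_1 and at the same time does not
  centralize a given element.\<close>

lemma not_union_of_subgroups:
  assumes "subgroup A G" "subgroup B G" "A \<noteq> carrier G" "B \<noteq> carrier G"
  shows "\<exists>x \<in> carrier G. x \<notin> A \<and> x \<notin> B"
proof -
  interpret A: subgroup A G by fact
  interpret B: subgroup B G by fact
  obtain a b where ab: "a \<in> carrier G" "a \<notin> A" "b \<in> carrier G" "b \<notin> B"
    using assms A.subset B.subset by blast
  show ?thesis
  proof (rule ccontr)
    assume *: "\<not> ?thesis"
    then have "a \<in> B" "b \<in> A" using ab by auto
    moreover have "a \<otimes> b \<in> A \<or> a \<otimes> b \<in> B" using * ab by auto
    moreover have "a = (a \<otimes> b) \<otimes> inv b" "b = inv a \<otimes> (a \<otimes> b)" using ab by (simp_all add: m_assoc)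
    ultimately show False
      using ab A.m_closed A.m_inv_closed B.m_closed B.m_inv_closed by metis
  qed
qed

end

section \<open>Complex characters with kernel of prime index\<close>

text \<open>A homomorphism from \<open>H\<close> to the p-th roots of unity with kernel
  \<open>K\<close>. It turns calculations modulo \<open>K\<close> into products of complex numbers;
  only the values on \<open>H\<close> are constrained.\<close>

definition is_char :: "('a, 'b) monoid_scheme \<Rightarrow> nat \<Rightarrow> 'a set \<Rightarrow> 'a set \<Rightarrow> ('a \<Rightarrow> complex) \<Rightarrow> bool" where
  "is_char G p H K c \<longleftrightarrow> (\<forall>x\<in>H. \<forall>y\<in>H. c (x \<otimes>\<^bsub>G\<^esub> y) = c x * c y) \<and>
     (\<forall>x\<in>H. c x = 1 \<longleftrightarrow> x \<in> K) \<and> (\<forall>x\<in>H. c x ^ p = 1)"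

lemma root_of_unity_prime:
  assumes "Factorial_Ring.prime p"
  obtains \<omega> :: complex where "\<And>i j. \<omega> ^ i = \<omega> ^ j \<longleftrightarrow> i mod p = j mod p" "\<And>z. z ^ p = 1 \<Longrightarrow> \<exists>i. z = \<omega> ^ i"
proof
  let ?w = "cis (2 * pi / real p)"
  have p0: "p > 0" using assms prime_gt_0_nat by blast
  have wp: "?w ^ p = 1" using p0 by (simp add: DeMoivre)
  have wmod: "?w ^ i = ?w ^ (i mod p)" for i
  proof -
    have "?w ^ i = ?w ^ (p * (i div p) + i mod p)" by simp
    also have "\<dots> = (?w ^ p) ^ (i div p) * ?w ^ (i mod p)" by (simp only: power_add power_mult)
    finally show ?thesis by (simp add: wp)
  qed
  have inj: "inj_on (\<lambda>k. cis (2 * pi * real k / real p)) {..<p}"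
    using bij_betw_roots_unity[OF p0] by (simp add: bij_betw_def)
  have pw: "?w ^ k = cis (2 * pi * real k / real p)" for k
    by (simp add: DeMoivre mult_ac)
  show "?w ^ i = ?w ^ j \<longleftrightarrow> i mod p = j mod p" for i j
    using wmod[of i] wmod[of j] inj_onD[OF inj, of "i mod p" "j mod p"] p0 pw by auto
  show "\<exists>i. z = ?w ^ i" if "z ^ p = 1" for z
    using bij_betw_roots_unity[OF p0] that unfolding bij_betw_def pw by blast
qed

lemma power_eq_one_prime:
  fixes z :: complex
  assumes "Factorial_Ring.prime p" "z ^ p = 1" "z ^ k = 1" "\<not> p dvd k"
  shows "z = 1"
proof -
  obtain w :: complex where w: "\<And>i j. w ^ i = w ^ j \<longleftrightarrow> i mod p = j mod p" "\<And>z. z ^ p = 1 \<Longrightarrow> \<exists>i. z = w ^ i"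
    using root_of_unity_prime assms(1) by metis
  obtain i where i: "z = w ^ i" using w(2) assms(2) by blast
  have "w ^ (i * k) = w ^ 0" using assms(3) i by (simp add: power_mult)
  then have "p dvd i * k" unfolding w(1) by (simp add: dvd_eq_mod_eq_0)
  then have "p dvd i" using assms(1,4) prime_dvd_multD[of p i k] by (simp add: prime_dvd_mult_iff)
  then have "w ^ i = w ^ 0" unfolding w(1) by (simp add: dvd_eq_mod_eq_0)
  then show ?thesis using i by simp
qed

lemma is_charD:
  assumes "is_char G p H K c"
  shows "x \<in> H \<Longrightarrow> y \<in> H \<Longrightarrow> c (x \<otimes>\<^bsub>G\<^esub> y) = c x * c y"
    and "x \<in> H \<Longrightarrow> c x = 1 \<longleftrightarrow> x \<in> K" and "x \<in> H \<Longrightarrow> c x ^ p = 1"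
  using assms by (auto simp: is_char_def)

context group
begin

lemma char_exists_normal:
  assumes N: "N \<lhd> G" and p: "Factorial_Ring.prime p" and fin: "finite (carrier G)"
    and card: "card (carrier G) = p * card N"
  shows "\<exists>c. is_char G p (carrier G) N c"
proof -
  interpret N: normal N G by fact
  interpret Q: group "G Mod N" by (rule N.factorgroup_is_group)
  have cardN: "card N > 0" using fin N.subset N.one_closed card_gt_0_iff finite_subset by blast
  have "order (G Mod N) * card N = order G"
    using lagrange[OF N.subgroup_axioms] by (simp add: order_def FactGroup_def mult.commute)
  then have oQ: "order (G Mod N) = p"
    using card cardN by (simp add: order_def)
  have finQ: "finite (carrier (G Mod N))"
    using oQ prime_gt_0_nat[OF p] by (metis order_def card_ge_0_finite)
  obtain g where g: "g \<in> carrier (G Mod N)" "g \<noteq> \<one>\<^bsub>G Mod N\<^esub>"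
  proof (rule ccontr)
    assume "\<not> thesis"
    then have "carrier (G Mod N) \<subseteq> {\<one>\<^bsub>G Mod N\<^esub>}" using that by blast
    from card_mono[OF _ this] have "order (G Mod N) \<le> 1" by (simp add: order_def)
    then show False using oQ prime_gt_1_nat[OF p] by simp
  qed
  have "Q.ord g dvd p" using Q.ord_dvd_group_order[OF g(1)] oQ by simp
  moreover have "Q.ord g \<noteq> 1" using Q.ord_eq_1[OF g(1)] g(2) by simp
  ultimately have og: "Q.ord g = p" using p by (metis prime_nat_iff)
  have all: "carrier (G Mod N) = {g [^]\<^bsub>G Mod N\<^esub> i |i. i \<in> {0..<p}}"
  proof -
    have "card {g [^]\<^bsub>G Mod N\<^esub> i |i. i \<in> {0..<p}} = p"
    proof -
      have "inj_on (\<lambda>i. g [^]\<^bsub>G Mod N\<^esub> i) {0..p - 1}"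
        using Q.ord_inj[OF g(1)] og by simp
      moreover have "{0..p-1} = {0..<p}" using prime_gt_0_nat[OF p] by auto
      moreover have "{g [^]\<^bsub>G Mod N\<^esub> i |i. i \<in> {0..<p}} = (\<lambda>i. g [^]\<^bsub>G Mod N\<^esub> i) ` {0..<p}"
        by blast
      ultimately show ?thesis by (simp only: card_image card_atLeastLessThan)
    qed
    then show ?thesis
      using finQ oQ g(1) Q.nat_pow_closed unfolding order_def
      by (intro card_subset_eq[symmetric]) auto
  qed
  obtain w :: complex where w: "\<And>i j. w ^ i = w ^ j \<longleftrightarrow> i mod p = j mod p"
    using root_of_unity_prime p by metis
  \<comment> \<open>The exponent is determined only modulo \<open>p\<close>, but \<open>w\<close>
    has order \<open>p\<close>, so \<open>w ^ f x\<close> depends only on the coset of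
    \<open>x\<close>.\<close>
  define f where "f x = (SOME i::nat. N #> x = g [^]\<^bsub>G Mod N\<^esub> i)" for x
  have f: "N #> x = g [^]\<^bsub>G Mod N\<^esub> f x" if "x \<in> carrier G" for x
    unfolding f_def
  proof (rule someI_ex)
    have "N #> x \<in> carrier (G Mod N)" using that by (auto simp: carrier_FactGroup)
    then show "\<exists>i::nat. N #> x = g [^]\<^bsub>G Mod N\<^esub> i" using all by blast
  qed
  have powg: "g [^]\<^bsub>G Mod N\<^esub> i = g [^]\<^bsub>G Mod N\<^esub> j \<longleftrightarrow> w ^ i = w ^ j" for i j :: nat
  proof -
    have "g [^]\<^bsub>G Mod N\<^esub> i = g [^]\<^bsub>G Mod N\<^esub> j \<longleftrightarrow> g [^]\<^bsub>G Mod N\<^esub> int i = g [^]\<^bsub>G Mod N\<^esub> int j"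
      by (simp add: int_pow_int)
    also have "\<dots> \<longleftrightarrow> (int i - int j) mod int p = 0"
      using Q.int_pow_eq[OF g(1)] og by (auto simp: mod_eq_0_iff_dvd dvd_minus_iff[symmetric, of _ "int i - int j"])
    also have "\<dots> \<longleftrightarrow> int i mod int p = int j mod int p"
      by (simp add: mod_eq_dvd_iff mod_eq_0_iff_dvd)
    also have "\<dots> \<longleftrightarrow> i mod p = j mod p" by (metis of_nat_mod of_nat_eq_iff)
    finally show ?thesis using w by simp
  qed
  have "w ^ f (x \<otimes> y) = w ^ f x * w ^ f y" if "x \<in> carrier G" "y \<in> carrier G" for x y
  proof -
    have "g [^]\<^bsub>G Mod N\<^esub> f (x \<otimes> y) = g [^]\<^bsub>G Mod N\<^esub> (f x + f y)"
      using f that N.rcos_sum[OF that] g(1) by (metis Q.nat_pow_mult mult_FactGroup m_closed)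
    then show ?thesis using powg by (simp add: power_add)
  qed
  moreover have "w ^ f x = 1 \<longleftrightarrow> x \<in> N" if "x \<in> carrier G" for x
  proof -
    have "w ^ f x = 1 \<longleftrightarrow> g [^]\<^bsub>G Mod N\<^esub> f x = g [^]\<^bsub>G Mod N\<^esub> (0::nat)"
      using powg[of "f x" 0] by simp
    also have "\<dots> \<longleftrightarrow> N #> x = N" using f[OF that] by simp
    also have "\<dots> \<longleftrightarrow> x \<in> N"
      using that coset_join1 coset_join2 N.subgroup_axioms N.subset by blast
    finally show ?thesis .
  qed
  moreover have "(w ^ f x) ^ p = 1" for x
    using w[of "f x * p" 0] by (simp add: power_mult)
  ultimately show ?thesis unfolding is_char_def by (intro exI[of _ "\<lambda>x. w ^ f x"]) blast
qed

lemma char_exists: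
  assumes H: "subgroup H G" and K: "K \<lhd> G" "K \<subseteq> H" and p: "Factorial_Ring.prime p"
    and fin: "finite (carrier G)" and card: "card H = p * card K"
  shows "\<exists>c. is_char G p H K c"
proof -
  interpret H: subgroup H G by fact
  interpret L: group "G\<lparr>carrier := H\<rparr>" using H by (rule subgroup_imp_group)
  have "K \<lhd> (G\<lparr>carrier := H\<rparr>)" using normal_restrict_supergroup[OF H K] .
  from L.char_exists_normal[OF this p] show ?thesis
    using card fin H.subset finite_subset by (auto simp: is_char_def)
qed

lemma char_one:
  assumes "subgroup H G" "is_char G p H K c" and p: "p > 0"
  shows "c \<one> = 1"
proof -
  interpret H: subgroup H G by fact
  have "c (\<one> \<otimes> \<one>) = c \<one> * c \<one>"
    by (rule is_charD(1)[OF assms(2) H.one_closed H.one_closed])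
  then have "c \<one> = 0 \<or> c \<one> = 1" by simp
  moreover have "c \<one> \<noteq> 0"
    using is_charD(3)[OF assms(2) H.one_closed] p by (auto simp: power_0_left split: if_splits)
  ultimately show ?thesis by simp
qed

end

section \<open>Curly pairings\<close>

text \<open>\<open>Q\<close> is left open because three pairings occur: the letters of the curly
  square, the commutator of \<open>G\<close>, which gives the canonical map, and the commutator of a
  central extension.\<close>

locale curly_pairing = group G + Q: group Q for G (structure) and Q (structure) +
  fixes \<tau>
  assumes pair_closed [simp, intro]: "x \<in> carrier G \<Longrightarrow> y \<in> carrier G \<Longrightarrow> \<tau> x y \<in> carrier Q"
    and pair_left: "x \<in> carrier G \<Longrightarrow> y \<in> carrier G \<Longrightarrow> z \<in> carrier G \<Longrightarrow>
      \<tau> (x \<otimes> y) z = \<tau> (conjg G x y) (conjg G z y) \<otimes>\<^bsub>Q\<^esub> \<tau> y z"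
    and pair_right: "x \<in> carrier G \<Longrightarrow> y \<in> carrier G \<Longrightarrow> z \<in> carrier G \<Longrightarrow>
      \<tau> x (y \<otimes> z) = \<tau> x z \<otimes>\<^bsub>Q\<^esub> \<tau> (conjg G x z) (conjg G y z)"
    and pair_comm: "x \<in> carrier G \<Longrightarrow> y \<in> carrier G \<Longrightarrow> comm G x y = \<one> \<Longrightarrow> \<tau> x y = \<one>\<^bsub>Q\<^esub>"
begin

text \<open>Writing y = k y', equality of the commutators forces \<open>k\<close> to commute with
  \<open>x\<close>; the extra factor then pairs two commuting conjugates and is trivial.\<close>

lemma pair_cong_right:
  assumes "x \<in> carrier G" "y \<in> carrier G" "y' \<in> carrier G" "comm G x y = comm G x y'"
  shows "\<tau> x y = \<tau> x y'"
proof -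
  define k where "k = y \<otimes> inv y'"
  have k: "k \<in> carrier G" "y = k \<otimes> y'" using assms by (simp_all add: k_def m_assoc)
  have "comm G x y' = comm G x y' \<otimes> conjg G (comm G x k) y'"
    using assms k by (metis comm_mult_right)
  then have "conjg G (comm G x k) y' = \<one>" using assms k by simp
  then have "comm G (conjg G x y') (conjg G k y') = \<one>" using assms k by (simp add: conjg_comm)
  then show ?thesis using assms k by (simp add: pair_right pair_comm)
qed

lemma pair_cong_left:
  assumes "x \<in> carrier G" "x' \<in> carrier G" "y \<in> carrier G" "comm G x y = comm G x' y"
  shows "\<tau> x y = \<tau> x' y"
proof -
  define k where "k = x \<otimes> inv x'"
  have k: "k \<in> carrier G" "x = k \<otimes> x'" using assms by (simp_all add: k_def m_assoc)
  have "comm G x' y = conjg G (comm G k y) x' \<otimes> comm G x' y"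
    using assms k by (metis comm_mult_left)
  then have "conjg G (comm G k y) x' = \<one>" using assms k by simp
  then have "comm G (conjg G k x') (conjg G y x') = \<one>" using assms k by (simp add: conjg_comm)
  then show ?thesis using assms k by (simp add: pair_left pair_comm)
qed

text \<open>Both sides arise by expanding \<open>\<tau> (x \<otimes> a) (y \<otimes> b)\<close>, starting with either argument.\<close>
lemma pair_interchange:
  assumes "x \<in> carrier G" "y \<in> carrier G" "a \<in> carrier G" "b \<in> carrier G"
  shows "\<tau> (conjg G x (b \<otimes> a)) (conjg G y (b \<otimes> a)) \<otimes>\<^bsub>Q\<^esub> \<tau> a b
    = \<tau> a b \<otimes>\<^bsub>Q\<^esub> \<tau> (conjg G x (a \<otimes> b)) (conjg G y (a \<otimes> b))"
proof -
  let ?X = "\<tau> (conjg G x a) (conjg G b a)" and ?Y = "\<tau> (conjg G a b) (conjg G y b)"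
  let ?L = "\<tau> (conjg G x (b \<otimes> a)) (conjg G y (b \<otimes> a))"
  let ?R = "\<tau> (conjg G x (a \<otimes> b)) (conjg G y (a \<otimes> b))"
  have ba: "a \<otimes> conjg G b a = b \<otimes> a" "b \<otimes> conjg G a b = a \<otimes> b"
    using assms by (simp_all add: comm_calc)
  have "\<tau> (x \<otimes> a) (y \<otimes> b) = \<tau> (conjg G x a) (conjg G y a \<otimes> conjg G b a) \<otimes>\<^bsub>Q\<^esub> \<tau> a (y \<otimes> b)"
    using assms by (simp add: pair_left conjg_mult_left)
  also have "\<dots> = (?X \<otimes>\<^bsub>Q\<^esub> ?L) \<otimes>\<^bsub>Q\<^esub> (\<tau> a b \<otimes>\<^bsub>Q\<^esub> ?Y)"
    using assms by (simp add: pair_right conjg_conjg ba)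
  finally have 1: "\<tau> (x \<otimes> a) (y \<otimes> b) = (?X \<otimes>\<^bsub>Q\<^esub> ?L) \<otimes>\<^bsub>Q\<^esub> (\<tau> a b \<otimes>\<^bsub>Q\<^esub> ?Y)" .
  have "\<tau> (x \<otimes> a) (y \<otimes> b) = \<tau> (x \<otimes> a) b \<otimes>\<^bsub>Q\<^esub> \<tau> (conjg G x b \<otimes> conjg G a b) (conjg G y b)"
    using assms by (simp add: pair_right conjg_mult_left)
  also have "\<dots> = (?X \<otimes>\<^bsub>Q\<^esub> \<tau> a b) \<otimes>\<^bsub>Q\<^esub> (?R \<otimes>\<^bsub>Q\<^esub> ?Y)"
    using assms by (simp add: pair_left conjg_conjg ba)
  finally have "(?X \<otimes>\<^bsub>Q\<^esub> ?L) \<otimes>\<^bsub>Q\<^esub> (\<tau> a b \<otimes>\<^bsub>Q\<^esub> ?Y) = (?X \<otimes>\<^bsub>Q\<^esub> \<tau> a b) \<otimes>\<^bsub>Q\<^esub> (?R \<otimes>\<^bsub>Q\<^esub> ?Y)"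
    using 1 by simp
  then have "?X \<otimes>\<^bsub>Q\<^esub> ((?L \<otimes>\<^bsub>Q\<^esub> \<tau> a b) \<otimes>\<^bsub>Q\<^esub> ?Y) = ?X \<otimes>\<^bsub>Q\<^esub> ((\<tau> a b \<otimes>\<^bsub>Q\<^esub> ?R) \<otimes>\<^bsub>Q\<^esub> ?Y)"
    using assms by (simp add: Q.m_assoc)
  then show ?thesis using assms by simp
qed

text \<open>Since (b a)^-1 (a b) = [a, b], this is the interchange identity for \<open>x\<close> and
  \<open>y\<close> conjugated by (b a)^-1. In particular, if [a, b] is central, then
  \<open>\<tau> a b\<close> commutes with every pair.\<close>

lemma pair_conj_comm:
  assumes "x \<in> carrier G" "y \<in> carrier G" "a \<in> carrier G" "b \<in> carrier G"
  shows "\<tau> (conjg G x (comm G a b)) (conjg G y (comm G a b)) = inv\<^bsub>Q\<^esub> \<tau> a b \<otimes>\<^bsub>Q\<^esub> \<tau> x y \<otimes>\<^bsub>Q\<^esub> \<tau> a b"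
proof -
  let ?g = "inv (b \<otimes> a)"
  have "\<tau> (conjg G (conjg G x ?g) (b \<otimes> a)) (conjg G (conjg G y ?g) (b \<otimes> a)) \<otimes>\<^bsub>Q\<^esub> \<tau> a b
    = \<tau> a b \<otimes>\<^bsub>Q\<^esub> \<tau> (conjg G (conjg G x ?g) (a \<otimes> b)) (conjg G (conjg G y ?g) (a \<otimes> b))"
    using assms by (intro pair_interchange) auto
  moreover have "?g \<otimes> (a \<otimes> b) = comm G a b" using assms by (simp add: comm_calc)
  ultimately have "\<tau> x y \<otimes>\<^bsub>Q\<^esub> \<tau> a b = \<tau> a b \<otimes>\<^bsub>Q\<^esub> \<tau> (conjg G x (comm G a b)) (conjg G y (comm G a b))"
    using assms by (simp only: conjg_inv_conjg m_closed) (simp add: conjg_conjg)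
  then show ?thesis using assms by (simp add: Q.m_assoc)
qed

lemma pair_inv_left:
  assumes "x \<in> carrier G" "y \<in> carrier G"
  shows "\<tau> (inv x) y = inv\<^bsub>Q\<^esub> \<tau> x (conjg G y (inv x))"
proof -
  let ?y = "conjg G y (inv x)"
  have "\<tau> (inv x \<otimes> x) ?y = \<tau> (conjg G (inv x) x) (conjg G ?y x) \<otimes>\<^bsub>Q\<^esub> \<tau> x ?y"
    using assms by (intro pair_left) auto
  moreover have "conjg G (inv x) x = inv x" using assms by (simp add: comm_calc)
  ultimately have "\<tau> (inv x) y \<otimes>\<^bsub>Q\<^esub> \<tau> x ?y = \<one>\<^bsub>Q\<^esub>"
    using assms by (simp add: pair_comm)
  then show ?thesis using assms by (simp add: Q.inv_equality)
qed

text \<open>The analogue in \<open>Q\<close> of h^k = h [h, k] for h = [x, y]. The pair of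
  \<open>x\<close> with y k is expanded in two ways, the second time with y k written as k^(y^-1) y,
  and [x, y] is split as x^-1 x^y.\<close>

lemma pair_comm_left:
  assumes "x \<in> carrier G" "y \<in> carrier G" "k \<in> carrier G"
  shows "\<tau> (conjg G x k) (conjg G y k) = \<tau> x y \<otimes>\<^bsub>Q\<^esub> \<tau> (comm G x y) k"
proof -
  let ?g = "conjg G x y"
  have 1: "\<tau> (conjg G (inv x) ?g) (conjg G k ?g) = inv\<^bsub>Q\<^esub> (inv\<^bsub>Q\<^esub> \<tau> x y \<otimes>\<^bsub>Q\<^esub> \<tau> x k \<otimes>\<^bsub>Q\<^esub> \<tau> x y)"
  proof -
    have "conjg G (inv x) ?g = inv (conjg G x (comm G x y))"
      using assms by (simp add: comm_calc)
    moreover have "conjg G (conjg G k ?g) (inv (conjg G x (comm G x y))) = conjg G k (comm G x y)"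
      using assms by (simp add: comm_calc)
    ultimately show ?thesis using assms by (simp add: pair_inv_left pair_conj_comm)
  qed
  have "comm G x y = inv x \<otimes> ?g" using assms by (simp add: comm_calc)
  then have "\<tau> (comm G x y) k = inv\<^bsub>Q\<^esub> (inv\<^bsub>Q\<^esub> \<tau> x y \<otimes>\<^bsub>Q\<^esub> \<tau> x k \<otimes>\<^bsub>Q\<^esub> \<tau> x y) \<otimes>\<^bsub>Q\<^esub> \<tau> ?g k"
    using assms 1 by (simp add: pair_left)
  then have 2: "\<tau> x y \<otimes>\<^bsub>Q\<^esub> \<tau> (comm G x y) k = inv\<^bsub>Q\<^esub> \<tau> x k \<otimes>\<^bsub>Q\<^esub> (\<tau> x y \<otimes>\<^bsub>Q\<^esub> \<tau> ?g k)"
    using assms by (simp add: Q.m_assoc Q.inv_mult_group)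
  have "y \<otimes> k = conjg G k (inv y) \<otimes> y" using assms by (simp add: comm_calc)
  then have "\<tau> x (y \<otimes> k) = \<tau> x y \<otimes>\<^bsub>Q\<^esub> \<tau> ?g k"
    using assms by (simp add: pair_right)
  moreover have "\<tau> x (y \<otimes> k) = \<tau> x k \<otimes>\<^bsub>Q\<^esub> \<tau> (conjg G x k) (conjg G y k)"
    using assms by (simp add: pair_right)
  ultimately have "\<tau> x y \<otimes>\<^bsub>Q\<^esub> \<tau> ?g k = \<tau> x k \<otimes>\<^bsub>Q\<^esub> \<tau> (conjg G x k) (conjg G y k)" by simp
  then show ?thesis using assms by (simp add: 2)
qed

text \<open>The pair of v u with itself is trivial; expanding both arguments leaves only the two
  mixed terms.\<close>

lemma pair_antisym:
  assumes "x \<in> carrier G" "y \<in> carrier G"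
  shows "\<tau> y x = inv\<^bsub>Q\<^esub> \<tau> x y"
proof -
  have *: "\<tau> u v \<otimes>\<^bsub>Q\<^esub> \<tau> v u = \<one>\<^bsub>Q\<^esub>" if uv: "u \<in> carrier G" "v \<in> carrier G" for u v
  proof -
    let ?u = "conjg G u (inv v)"
    have u: "?u \<in> carrier G" using uv by simp
    have "\<tau> (?u \<otimes> v) (?u \<otimes> v) = \<tau> u (u \<otimes> v) \<otimes>\<^bsub>Q\<^esub> \<tau> v (?u \<otimes> v)"
      using u uv by (simp add: pair_left conjg_mult_left)
    also have "\<tau> u (u \<otimes> v) = \<tau> u v"
      using u uv by (simp add: pair_right pair_comm)
    also have "\<tau> v (?u \<otimes> v) = \<tau> v u"
      using u uv by (simp add: pair_right pair_comm)
    finally show ?thesis using u uv by (simp add: pair_comm)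
  qed
  show ?thesis using *[of y x] assms by (simp add: Q.inv_equality)
qed

end

text \<open>The subgroup \<open>A\<close> absorbs corrections: by \<open>pairs\<close> every pair
  inside \<open>P\<close> is a pair of an element of \<open>A\<close> with \<open>s\<close>, and
  these commute with all pairs because [a, s] is central. \<open>A\<close> will be trivial if P_1 is
  abelian and P_(n-2) otherwise.\<close>

locale curly_pairing_cyclic = curly_pairing +
  fixes s P A
  assumes s [simp, intro]: "s \<in> carrier G"
    and P: "P \<lhd> G" and A: "subgroup A G" "A \<subseteq> P"
    and comm_central: "a \<in> A \<Longrightarrow> g \<in> carrier G \<Longrightarrow> comm G (comm G a s) g = \<one>"
    and cyclic: "y \<in> carrier G \<Longrightarrow> \<exists>j::nat. y \<otimes> inv (s [^] j) \<in> P"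
    and pairs: "u \<in> P \<Longrightarrow> v \<in> P \<Longrightarrow> \<exists>a\<in>A. \<tau> u v = \<tau> a s"
begin

interpretation P: normal P G by (rule P)
interpretation A: subgroup A G by (rule A(1))

definition S where "S = (\<lambda>u. \<tau> u s) ` P"

lemma pair_A_commute:
  assumes "a \<in> A" "x \<in> carrier G" "y \<in> carrier G"
  shows "\<tau> a s \<otimes>\<^bsub>Q\<^esub> \<tau> x y = \<tau> x y \<otimes>\<^bsub>Q\<^esub> \<tau> a s"
proof -
  have "conjg G g (comm G a s) = g" if "g \<in> carrier G" for g
  proof -
    have "comm G g (comm G a s) = \<one>"
      using comm_central[OF assms(1) that] assms that comm_eq_one_sym by auto
    then show ?thesis using assms that by (simp add: conjg_eq_comm)
  qed
  then have "\<tau> x y = inv\<^bsub>Q\<^esub> \<tau> a s \<otimes>\<^bsub>Q\<^esub> (\<tau> x y \<otimes>\<^bsub>Q\<^esub> \<tau> a s)"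
    using pair_conj_comm[of x y a s] assms by (simp add: Q.m_assoc)
  then have "\<tau> a s \<otimes>\<^bsub>Q\<^esub> \<tau> x y = \<tau> a s \<otimes>\<^bsub>Q\<^esub> (inv\<^bsub>Q\<^esub> \<tau> a s \<otimes>\<^bsub>Q\<^esub> (\<tau> x y \<otimes>\<^bsub>Q\<^esub> \<tau> a s))" by simp
  then show ?thesis using assms by simp
qed

lemma pair_A_mult:
  assumes "a \<in> A" "u \<in> carrier G"
  shows "\<tau> (a \<otimes> u) s = \<tau> a s \<otimes>\<^bsub>Q\<^esub> \<tau> u s"
  using assms by (simp add: pair_left pair_comm_left comm_central pair_comm)

lemma pair_A_inv:
  assumes "a \<in> A"
  shows "inv\<^bsub>Q\<^esub> \<tau> a s = \<tau> (inv a) s"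
proof -
  have "\<tau> (inv a) s \<otimes>\<^bsub>Q\<^esub> \<tau> a s = \<one>\<^bsub>Q\<^esub>"
    using pair_A_mult[of "inv a" a] assms by (simp add: pair_comm)
  then show ?thesis using assms by (simp add: Q.inv_equality)
qed

text \<open>The defect of multiplicativity is \<open>\<tau> (comm G x s) v\<close>. Both entries lie
  in \<open>P\<close>, so it is one of the central pairs coming from \<open>A\<close>.\<close>

lemma pair_P_mult:
  assumes "x \<in> P" "v \<in> P"
  obtains a where "a \<in> A" "\<tau> (x \<otimes> v) s = \<tau> x s \<otimes>\<^bsub>Q\<^esub> \<tau> a s \<otimes>\<^bsub>Q\<^esub> \<tau> v s"
proof -
  have "comm G x s \<in> P" using assms comm_mem_left[OF P] by simp
  then obtain a where "a \<in> A" "\<tau> (comm G x s) v = \<tau> a s" using pairs assms by blast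
  then show thesis using that assms by (simp add: pair_left pair_comm_left)
qed

text \<open>The defect from \<open>pair_P_mult\<close> is moved back into the first argument, which
  becomes a^-1 x v. Thus \<open>S\<close> is closed under products although pairing with
  \<open>s\<close> need not be a homomorphism on \<open>P\<close>.\<close>

lemma S_mult:
  assumes "c \<in> S" "d \<in> S"
  shows "c \<otimes>\<^bsub>Q\<^esub> d \<in> S"
proof -
  obtain x v where xv: "x \<in> P" "v \<in> P" "c = \<tau> x s" "d = \<tau> v s" using assms by (auto simp: S_def)
  obtain a where a: "a \<in> A" "\<tau> (x \<otimes> v) s = \<tau> x s \<otimes>\<^bsub>Q\<^esub> \<tau> a s \<otimes>\<^bsub>Q\<^esub> \<tau> v s"
    using pair_P_mult xv by blast
  have "\<tau> (x \<otimes> v) s = \<tau> a s \<otimes>\<^bsub>Q\<^esub> (c \<otimes>\<^bsub>Q\<^esub> d)"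
    using a xv pair_A_commute[of a x s] by (simp add: Q.m_assoc[symmetric])
  then have "c \<otimes>\<^bsub>Q\<^esub> d = inv\<^bsub>Q\<^esub> \<tau> a s \<otimes>\<^bsub>Q\<^esub> \<tau> (x \<otimes> v) s"
    using a(1) xv by simp
  also have "\<dots> = \<tau> (inv a \<otimes> (x \<otimes> v)) s"
    using a(1) xv by (simp add: pair_A_inv pair_A_mult)
  finally show ?thesis using a(1) xv A(2) unfolding S_def by blast
qed

lemma S_inv:
  assumes "c \<in> S"
  shows "inv\<^bsub>Q\<^esub> c \<in> S"
proof -
  obtain u where u: "u \<in> P" "c = \<tau> u s" using assms by (auto simp: S_def)
  obtain a where a: "a \<in> A" "\<tau> (inv u \<otimes> u) s = \<tau> (inv u) s \<otimes>\<^bsub>Q\<^esub> \<tau> a s \<otimes>\<^bsub>Q\<^esub> \<tau> u s"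
    using pair_P_mult u P.m_inv_closed by blast
  then have "inv\<^bsub>Q\<^esub> c = \<tau> (inv u) s \<otimes>\<^bsub>Q\<^esub> \<tau> a s"
    using u by (simp add: pair_comm Q.inv_equality)
  moreover have "\<tau> (inv u) s \<in> S" "\<tau> a s \<in> S" using u a A(2) by (auto simp: S_def)
  ultimately show ?thesis using S_mult by simp
qed

lemma S_one: "\<one>\<^bsub>Q\<^esub> \<in> S"
  unfolding S_def by (rule image_eqI[of _ _ \<one>]) (simp_all add: pair_comm)

lemma S_pairs: "u \<in> P \<Longrightarrow> v \<in> P \<Longrightarrow> \<tau> u v \<in> S"
  using pairs[of u v] A(2) by (auto simp: S_def)

lemma S_left:
  assumes "u \<in> P" "y \<in> carrier G"
  shows "\<tau> u y \<in> S"
proof -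
  \<comment> \<open>\<open>u\<close> has to vary in the induction: each factor \<open>s\<close>
    split off replaces \<open>u\<close> by its conjugate.\<close>
  have pow: "\<tau> u (s [^] i) \<in> S" if "u \<in> P" for i :: nat and u
    using that
  proof (induction i arbitrary: u)
    case 0
    then show ?case using S_one by (simp add: pair_comm)
  next
    case (Suc i)
    have "s [^] i \<otimes> s = s \<otimes> s [^] i" using nat_pow_Suc2[of s i] by simp
    then have "conjg G (s [^] i) s = s [^] i" by (simp add: conjg_def m_assoc)
    then have "\<tau> u (s [^] Suc i) = \<tau> u s \<otimes>\<^bsub>Q\<^esub> \<tau> (conjg G u s) (s [^] i)"
      using Suc.prems by (simp add: pair_right)
    moreover have "\<tau> (conjg G u s) (s [^] i) \<in> S"
      using conjg_mem[OF P Suc.prems] by (intro Suc.IH) simp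
    moreover have "\<tau> u s \<in> S" using Suc.prems by (simp add: S_def)
    ultimately show ?case by (simp only: S_mult)
  qed
  obtain j :: nat where j: "y \<otimes> inv (s [^] j) \<in> P" using cyclic assms by blast
  let ?w = "y \<otimes> inv (s [^] j)"
  have "\<tau> u y = \<tau> u (?w \<otimes> s [^] j)" using assms by (simp add: m_assoc)
  also have "\<dots> = \<tau> u (s [^] j) \<otimes>\<^bsub>Q\<^esub> \<tau> (conjg G u (s [^] j)) (conjg G ?w (s [^] j))"
    using assms by (simp add: pair_right)
  finally have "\<tau> u y = \<tau> u (s [^] j) \<otimes>\<^bsub>Q\<^esub> \<tau> (conjg G u (s [^] j)) (conjg G ?w (s [^] j))" .
  moreover have "\<tau> (conjg G u (s [^] j)) (conjg G ?w (s [^] j)) \<in> S"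
    using assms j conjg_mem[OF P] by (intro S_pairs) auto
  ultimately show ?thesis
    using pow assms S_mult by auto
qed

lemma pair_in_S:
  assumes "x \<in> carrier G" "y \<in> carrier G"
  shows "\<tau> x y \<in> S"
proof -
  have right: "\<tau> x u \<in> S" if "x \<in> carrier G" "u \<in> P" for x u
    using that S_inv[OF S_left[of u x]] by (simp add: pair_antisym[of u x])
  have pow: "\<tau> (s [^] i) y \<in> S" if y: "y \<in> carrier G" for i :: nat and y
  proof -
    obtain j :: nat where j: "y \<otimes> inv (s [^] j) \<in> P" using cyclic[OF y] by blast
    let ?w = "y \<otimes> inv (s [^] j)"
    have "\<tau> (s [^] i) y = \<tau> (s [^] i) (?w \<otimes> s [^] j)" using y by (simp add: m_assoc)
    also have "\<dots> = \<tau> (s [^] i) (s [^] j) \<otimes>\<^bsub>Q\<^esub> \<tau> (conjg G (s [^] i) (s [^] j)) (conjg G ?w (s [^] j))"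
      using y by (simp add: pair_right)
    also have "\<tau> (s [^] i) (s [^] j) = \<one>\<^bsub>Q\<^esub>"
      by (rule pair_comm) (simp_all add: comm_eq_one_iff nat_pow_mult add.commute)
    finally show ?thesis
      using y j conjg_mem[OF P] right by auto
  qed
  obtain j :: nat where j: "x \<otimes> inv (s [^] j) \<in> P" using cyclic assms by blast
  let ?w = "x \<otimes> inv (s [^] j)"
  have "\<tau> x y = \<tau> (?w \<otimes> s [^] j) y" using assms by (simp add: m_assoc)
  also have "\<dots> = \<tau> (conjg G ?w (s [^] j)) (conjg G y (s [^] j)) \<otimes>\<^bsub>Q\<^esub> \<tau> (s [^] j) y"
    using assms by (simp add: pair_left)
  finally have "\<tau> x y = \<tau> (conjg G ?w (s [^] j)) (conjg G y (s [^] j)) \<otimes>\<^bsub>Q\<^esub> \<tau> (s [^] j) y" .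
  moreover have "\<tau> (conjg G ?w (s [^] j)) (conjg G y (s [^] j)) \<in> S"
    using assms j conjg_mem[OF P] by (intro S_left) auto
  ultimately show ?thesis
    using pow assms S_mult by auto
qed

end

section \<open>The curly exterior square as a group\<close>

lemma cwords_simps [simp]:
  "[] \<in> cwords G"
  "(x, y, b) # w \<in> cwords G \<longleftrightarrow> x \<in> carrier G \<and> y \<in> carrier G \<and> w \<in> cwords G"
  "u @ v \<in> cwords G \<longleftrightarrow> u \<in> cwords G \<and> v \<in> cwords G"
  by (simp_all add: cwords_def ball_Un case_prod_beta)

definition curly_class :: "('a, 'b) monoid_scheme \<Rightarrow> 'a cword \<Rightarrow> 'a cword set" where
  "curly_class G w = {v. curly_eq G w v}"

definition curly_square :: "('a, 'b) monoid_scheme \<Rightarrow> 'a cword set monoid" where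
  "curly_square G = \<lparr>carrier = curly_class G ` cwords G,
     monoid.mult = (\<lambda>A B. {w. \<exists>u\<in>A. \<exists>v\<in>B. curly_eq G (u @ v) w}), one = curly_class G []\<rparr>"

context group
begin

lemma curly_eq_cwords: "curly_eq G u v \<Longrightarrow> u \<in> cwords G \<and> v \<in> cwords G"
  by (induction rule: curly_eq.induct) auto

lemma curly_eq_append:
  assumes "curly_eq G u u'" "curly_eq G v v'"
  shows "curly_eq G (u @ v) (u' @ v')"
proof -
  have "curly_eq G (u @ v) (u' @ v)" "curly_eq G (u' @ v) (u' @ v')"
    using curly_eq.ctxt[OF assms(1), of "[]" v] curly_eq.ctxt[OF assms(2), of u' "[]"]
      curly_eq_cwords[OF assms(1)] curly_eq_cwords[OF assms(2)] by simp_all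
  then show ?thesis by (rule curly_eq.trans)
qed

lemma curly_class_eq_iff:
  assumes "u \<in> cwords G"
  shows "curly_class G u = curly_class G v \<longleftrightarrow> curly_eq G u v"
proof
  assume "curly_class G u = curly_class G v"
  moreover have "u \<in> curly_class G u" using assms curly_eq.refl by (simp add: curly_class_def)
  ultimately show "curly_eq G u v" by (auto simp: curly_class_def intro: curly_eq.sym)
next
  assume "curly_eq G u v"
  then show "curly_class G u = curly_class G v"
    by (auto simp: curly_class_def intro: curly_eq.sym curly_eq.trans)
qed

lemma curly_square_mult:
  assumes "u \<in> cwords G" "v \<in> cwords G"
  shows "curly_class G u \<otimes>\<^bsub>curly_square G\<^esub> curly_class G v = curly_class G (u @ v)"
proof -
  have "curly_eq G (u @ v) w" if "curly_eq G u a" "curly_eq G v b" "curly_eq G (a @ b) w" for a b w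
    using curly_eq_append[OF that(1,2)] that(3) by (rule curly_eq.trans)
  then show ?thesis
    using assms curly_eq.refl by (fastforce simp: curly_square_def curly_class_def)
qed

lemma curly_square_one: "\<one>\<^bsub>curly_square G\<^esub> = curly_class G []"
  by (simp add: curly_square_def)

lemma curly_square_carrier: "carrier (curly_square G) = curly_class G ` cwords G"
  by (simp add: curly_square_def)

lemma curly_cancel:
  assumes "x \<in> carrier G" "y \<in> carrier G"
  shows "curly_class G [(x, y, \<not> b)] \<otimes>\<^bsub>curly_square G\<^esub> curly_class G [(x, y, b)] = \<one>\<^bsub>curly_square G\<^esub>"
  using assms curly_eq.cancel[of x G y "\<not> b"]
  by (simp add: curly_square_mult curly_square_one curly_class_eq_iff)

lemma curly_square_group: "group (curly_square G)"
proof (rule groupI)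
  fix c assume "c \<in> carrier (curly_square G)"
  then obtain w where w: "w \<in> cwords G" "c = curly_class G w" by (auto simp: curly_square_carrier)
  have "\<exists>v\<in>cwords G. curly_class G (v @ w) = curly_class G []"
    using w(1)
  proof (induction w)
    case (Cons l w)
    obtain x y b where l: "l = (x, y, b)" by (cases l)
    obtain v where v: "v \<in> cwords G" "curly_class G (v @ w) = curly_class G []"
      using Cons l by auto
    have "curly_eq G (v @ [(x, y, \<not> b), (x, y, b)] @ w) (v @ [] @ w)"
      using curly_eq.cancel[of x G y "\<not> b"] Cons.prems l v by (intro curly_eq.ctxt) auto
    then have "curly_class G ((v @ [(x, y, \<not> b)]) @ l # w) = curly_class G []"
      using v l Cons.prems curly_class_eq_iff by (subst v(2)[symmetric], subst curly_class_eq_iff) auto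
    then show ?case using v l Cons.prems by (intro bexI[of _ "v @ [(x, y, \<not> b)]"]) auto
  qed (intro bexI[of _ "[]"], auto)
  then show "\<exists>d\<in>carrier (curly_square G). d \<otimes>\<^bsub>curly_square G\<^esub> c = \<one>\<^bsub>curly_square G\<^esub>"
    using w by (auto simp: curly_square_carrier curly_square_one curly_square_mult)
qed (auto simp: curly_square_carrier curly_square_one curly_square_mult)

lemma curly_square_pairing:
  "curly_pairing G (curly_square G) (\<lambda>x y. curly_class G [(x, y, True)])"
proof (intro curly_pairing.intro curly_pairing_axioms.intro)
  show "group G" "group (curly_square G)" by (rule is_group, rule curly_square_group)
next
  fix x y z assume "x \<in> carrier G" "y \<in> carrier G" "z \<in> carrier G"
  then show "curly_class G [(x \<otimes> y, z, True)] = curly_class G [(conjg G x y, conjg G z y, True)]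
      \<otimes>\<^bsub>curly_square G\<^esub> curly_class G [(y, z, True)]"
    and "curly_class G [(x, y \<otimes> z, True)] = curly_class G [(x, z, True)]
      \<otimes>\<^bsub>curly_square G\<^esub> curly_class G [(conjg G x z, conjg G y z, True)]"
    by (simp_all add: curly_square_mult curly_class_eq_iff curly_eq.rel_left curly_eq.rel_right)
next
  fix x y assume "x \<in> carrier G" "y \<in> carrier G"
  then show "curly_class G [(x, y, True)] \<in> carrier (curly_square G)"
    and "comm G x y = \<one> \<Longrightarrow> curly_class G [(x, y, True)] = \<one>\<^bsub>curly_square G\<^esub>"
    by (auto simp: curly_square_carrier curly_square_one curly_class_eq_iff curly_eq.rel_comm)
qed

text \<open>The universal property of the curly square, on words: the axioms of a pairing match the
  defining relations one by one. The fold is a hypothesis on \<open>ev\<close>, so that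
  \<open>curly_eval\<close> and the evaluation in the extension are both instances.\<close>

lemma curly_square_eval_cong:
  assumes E: "group E" and cl: "\<And>x y. x \<in> carrier G \<Longrightarrow> y \<in> carrier G \<Longrightarrow> \<phi> x y \<in> carrier E"
    and ev: "\<And>w. ev w = foldr (\<lambda>(x, y, b) e. (if b then \<phi> x y else inv\<^bsub>E\<^esub> \<phi> x y) \<otimes>\<^bsub>E\<^esub> e) w \<one>\<^bsub>E\<^esub>"
    and pairing: "curly_pairing G E \<phi>"
    and eq: "curly_eq G u v"
  shows "ev u = ev v"
proof -
  interpret E: group E by fact
  interpret curly_pairing G E \<phi> by fact
  have evs: "ev [] = \<one>\<^bsub>E\<^esub>" "ev ((x, y, b) # w) = (if b then \<phi> x y else inv\<^bsub>E\<^esub> \<phi> x y) \<otimes>\<^bsub>E\<^esub> ev w" for x y b w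
    by (simp_all add: ev)
  have closed: "ev w \<in> carrier E" if "w \<in> cwords G" for w
    using that by (induction w) (auto simp: evs)
  have app: "ev (a @ b) = ev a \<otimes>\<^bsub>E\<^esub> ev b" if "a \<in> cwords G" "b \<in> cwords G" for a b
    using that by (induction a) (auto simp: evs closed E.m_assoc)
  show ?thesis using eq
  proof (induction rule: curly_eq.induct)
    case (ctxt u v a c)
    then show ?case using curly_eq_cwords[OF ctxt.hyps(1)] by (simp add: app)
  qed (auto simp: evs pair_left pair_right pair_comm)
qed

lemma curly_eval_eq_comm:
  assumes "curly_eq G u v"
  shows "curly_eval G u = curly_eval G v"
proof (rule curly_square_eval_cong[OF _ _ _ _ assms])
  show "group G" by (rule is_group)
  show "curly_eval G w = foldr (\<lambda>(x, y, b) e. (if b then comm G x y else inv comm G x y) \<otimes> e) w \<one>" for w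
    by (induction w rule: curly_eval.induct) auto
  show "curly_pairing G G (comm G)"
    by (unfold_locales) (auto simp: comm_mult_left comm_mult_right conjg_comm)
qed auto

theorem B0_trivial_if_cyclic_quotient:
  assumes s: "s \<in> carrier G" and P: "P \<lhd> G" and A: "subgroup A G" "A \<subseteq> P"
    and comm_central: "\<And>a g. a \<in> A \<Longrightarrow> g \<in> carrier G \<Longrightarrow> comm G (comm G a s) g = \<one>"
    and cyclic: "\<And>y. y \<in> carrier G \<Longrightarrow> \<exists>j::nat. y \<otimes> inv (s [^] j) \<in> P"
    and pairs: "\<And>u v. u \<in> P \<Longrightarrow> v \<in> P \<Longrightarrow> \<exists>a\<in>A. curly_class G [(u, v, True)] = curly_class G [(a, s, True)]"
  shows "B0_trivial G"
proof -
  interpret curly_pairing G "curly_square G" "\<lambda>x y. curly_class G [(x, y, True)]"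
    by (rule curly_square_pairing)
  interpret C: curly_pairing_cyclic G "curly_square G" "\<lambda>x y. curly_class G [(x, y, True)]" s P A
    by (intro curly_pairing_cyclic.intro curly_pairing_cyclic_axioms.intro)
      (rule curly_square_pairing s P A cyclic pairs comm_central; assumption?)+
  have PG: "P \<subseteq> carrier G" using P normal_imp_subgroup subgroup.subset by blast
  have inv: "curly_class G [(x, y, False)] = inv\<^bsub>curly_square G\<^esub> curly_class G [(x, y, True)]"
    if "x \<in> carrier G" "y \<in> carrier G" for x y
    using curly_cancel[OF that, of True] that by (simp add: Q.inv_equality curly_square_carrier)
  have "curly_class G w \<in> C.S" if "w \<in> cwords G" for w
    using that
  proof (induction w)
    case Nil
    then show ?case using C.S_one by (simp add: curly_square_one)
  next
    case (Cons l w)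
    obtain x y b where l: "l = (x, y, b)" by (cases l)
    have "curly_class G [(x, y, b)] \<in> C.S"
      using Cons.prems l C.pair_in_S[of x y] C.S_inv inv by (cases b) auto
    then have "curly_class G [(x, y, b)] \<otimes>\<^bsub>curly_square G\<^esub> curly_class G w \<in> C.S"
      using Cons l by (intro C.S_mult) auto
    then show ?case using Cons.prems l by (simp add: curly_square_mult)
  qed
  then have ex: "\<exists>u\<in>P. curly_eq G w [(u, s, True)]" if w: "w \<in> cwords G" for w
    using w unfolding C.S_def by (metis (no_types, lifting) curly_class_eq_iff imageE)
  show ?thesis unfolding B0_trivial_def
  proof (intro ballI impI)
    fix w assume w: "w \<in> cwords G" "curly_eval G w = \<one>"
    obtain u where u: "u \<in> P" "curly_eq G w [(u, s, True)]" using ex w by blast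
    have uG: "u \<in> carrier G" using u PG by blast
    have "comm G u s = \<one>" using curly_eval_eq_comm[OF u(2)] w(2) uG s by simp
    then show "curly_eq G w []"
      using curly_eq.trans[OF u(2) curly_eq.rel_comm] uG s by simp
  qed
qed

end

section \<open>The filtration of a group of maximal class\<close>

context group
begin

section \<open>Cosets and orders derived from characters\<close>

lemma char_nat_pow:
  assumes "subgroup H G" "is_char G p H K c" "p > 0" "x \<in> H"
  shows "c (x [^] (j::nat)) = c x ^ j"
proof (induction j)
  case 0
  then show ?case using char_one assms by simp
next
  case (Suc j)
  have "x [^] j \<in> H" for j :: nat
    using assms by (induction j) (auto intro: subgroup.one_closed subgroup.m_closed)
  then show ?case using Suc assms is_charD(1)[OF assms(2)] by simp
qed

lemma char_nonzero:
  assumes "is_char G p H K c" "p > 0" "x \<in> H"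
  shows "c x \<noteq> 0"
  using is_charD(3)[OF assms(1,3)] assms(2) by (auto simp: power_0_left split: if_splits)

lemma char_inv:
  assumes "subgroup H G" "is_char G p H K c" "p > 0" "x \<in> H"
  shows "c (inv x) = inverse (c x)"
proof -
  interpret H: subgroup H G by fact
  have "c (x \<otimes> inv x) = c x * c (inv x)"
    using assms by (intro is_charD(1)) auto
  then have "c x * c (inv x) = 1" using assms by (simp add: char_one)
  then show ?thesis using inverse_unique by metis
qed

text \<open>A nontrivial p-th root of unity generates all of them, so some power of
  \<open>c x\<close> equals \<open>c y\<close>. The exponent is \<open>b\<close> times an inverse of
  \<open>a\<close> modulo \<open>p\<close>.\<close>

lemma char_gen:
  assumes H: "subgroup H G" and c: "is_char G p H K c" and p: "Factorial_Ring.prime p"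
    and x: "x \<in> H" "x \<notin> K" and y: "y \<in> H"
  shows "\<exists>j::nat. y \<otimes> inv (x [^] j) \<in> K"
proof -
  interpret H: subgroup H G by fact
  have p0: "p > 0" using p by (rule prime_gt_0_nat)
  obtain w :: complex where w: "\<And>i j. w ^ i = w ^ j \<longleftrightarrow> i mod p = j mod p" "\<And>z. z ^ p = 1 \<Longrightarrow> \<exists>i. z = w ^ i"
    using root_of_unity_prime[OF p] by metis
  obtain a b where ab: "c x = w ^ a" "c y = w ^ b" using w(2) is_charD(3)[OF c] x y by meson
  have "\<not> p dvd a"
  proof
    assume "p dvd a"
    then have "w ^ a = w ^ 0" unfolding w(1) by (simp add: dvd_eq_mod_eq_0)
    then show False using ab x is_charD(2)[OF c] by simp
  qed
  have xp: "x [^] (i::nat) \<in> H" for i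
    using x H.one_closed H.m_closed by (induction i) auto
  from \<open>\<not> p dvd a\<close> have "coprime a p" using p by (metis coprime_commute prime_imp_coprime)
  moreover have "a \<noteq> 0" using \<open>\<not> p dvd a\<close> by (metis dvd_0_right)
  ultimately obtain k q where k: "a * k = p * q + 1" using bezout_nat[of a p] by auto
  have "a * (k * b) = p * (q * b) + b" using arg_cong[OF k, of "\<lambda>z. z * b"] by (simp add: algebra_simps)
  then have "w ^ (a * (k * b)) = w ^ b" unfolding w(1) by simp
  then have eq: "c (x [^] (k * b)) = c y"
    using ab char_nat_pow[OF H c p0 x(1)] by (simp add: power_mult)
  have xk: "x [^] (k * b) \<in> H"
    by (rule xp)
  have "c (y \<otimes> inv (x [^] (k * b))) = 1"
    using is_charD(1)[OF c y H.m_inv_closed[OF xk]] char_inv[OF H c p0 xk] eq char_nonzero[OF c p0 y] by simp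
  then have "y \<otimes> inv (x [^] (k * b)) \<in> K"
    using is_charD(2)[OF c H.m_closed[OF y H.m_inv_closed[OF xk]]] by simp
  then show ?thesis by blast
qed

text \<open>The powers of \<open>x\<close> below \<open>p\<close> represent the cosets of
  \<open>K\<close>. The lemma yields the order of P_1, whose character is built from commutators
  before its index is known.\<close>

lemma card_char:
  assumes H: "subgroup H G" and c: "is_char G p H K c" and p: "Factorial_Ring.prime p"
    and K: "subgroup K G" "K \<subseteq> H" and x: "x \<in> H" "x \<notin> K"
  shows "card H = p * card K"
proof -
  interpret H: subgroup H G by fact
  interpret K: subgroup K G by fact
  have p0: "p > 0" using p by (rule prime_gt_0_nat)
  have xp: "x [^] (i::nat) \<in> H" for i
    using x H.one_closed H.m_closed by (induction i) auto
  have cx: "c x ^ i = c x ^ j \<Longrightarrow> i = j" if "i < p" "j < p" "i \<le> j" for i j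
  proof (rule ccontr)
    assume eq: "c x ^ i = c x ^ j" and "i \<noteq> j"
    have "c x ^ j = c x ^ i * c x ^ (j - i)" using that by (simp flip: power_add)
    then have "c x ^ (j - i) = 1" using eq char_nonzero[OF c p0 x(1)] by simp
    moreover have "\<not> p dvd j - i" using that \<open>i \<noteq> j\<close> by (auto dest: dvd_imp_le)
    ultimately have "c x = 1" using power_eq_one_prime[OF p is_charD(3)[OF c x(1)]] by blast
    then show False using is_charD(2)[OF c x(1)] x by simp
  qed
  have "bij_betw (\<lambda>(u, i). u \<otimes> x [^] i) (K \<times> {..<p}) H"
    unfolding bij_betw_def
  proof (intro conjI inj_onI)
    fix a b assume *: "a \<in> K \<times> {..<p}" "b \<in> K \<times> {..<p}" "(\<lambda>(u, i). u \<otimes> x [^] i) a = (\<lambda>(u, i). u \<otimes> x [^] i) b"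
    obtain u i v j where uv: "a = (u, i)" "b = (v, j)" "u \<in> K" "v \<in> K" "i < p" "j < p"
      using * by auto
    have ci: "c (u \<otimes> x [^] i) = c x ^ i" if "u \<in> K" for u i
      using is_charD(1)[OF c _ xp, of u i] is_charD(2)[OF c, of u] that K(2)
        char_nat_pow[OF H c p0 x(1)] by auto
    have eq: "u \<otimes> x [^] i = v \<otimes> x [^] j" using * uv by simp
    then have "c x ^ i = c x ^ j" using ci[OF uv(3), of i] ci[OF uv(4), of j] by simp
    then have "i = j" using cx[of i j] cx[of j i] uv by (cases "i \<le> j") auto
    then show "a = b" using eq uv x by simp
  next
    show "(\<lambda>(u, i). u \<otimes> x [^] i) ` (K \<times> {..<p}) = H"
    proof (intro equalityI subsetI)
      fix y assume "y \<in> (\<lambda>(u, i). u \<otimes> x [^] i) ` (K \<times> {..<p})"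
      then show "y \<in> H" using K(2) xp by auto
    next
      fix y assume y: "y \<in> H"
      obtain j :: nat where j: "y \<otimes> inv (x [^] j) \<in> K" using char_gen[OF H c p x y] by blast
      have xpp: "x [^] p \<in> K"
        using is_charD(2)[OF c xp] char_nat_pow[OF H c p0 x(1)] is_charD(3)[OF c x(1)] by auto
      have div: "x [^] j = (x [^] p) [^] (j div p) \<otimes> x [^] (j mod p)"
        using x by (simp add: nat_pow_pow nat_pow_mult)
      have "(x [^] p) [^] k \<in> K" for k :: nat
        using xpp K.one_closed K.m_closed by (induction k) auto
      then have "(y \<otimes> inv (x [^] j)) \<otimes> (x [^] p) [^] (j div p) \<in> K"
        using j by blast
      moreover have "y = ((y \<otimes> inv (x [^] j)) \<otimes> (x [^] p) [^] (j div p)) \<otimes> x [^] (j mod p)"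
        using x y by (simp add: m_assoc flip: div)
      moreover have "j mod p < p" using p0 by simp
      ultimately show "y \<in> (\<lambda>(u, i). u \<otimes> x [^] i) ` (K \<times> {..<p})" by force
    qed
  qed
  then have "card (K \<times> {..<p}) = card H" by (rule bij_betw_same_card)
  then show ?thesis by (simp add: card_cartesian_product mult.commute)
qed

section \<open>The lower central series of an arbitrary group\<close>

lemma lcs_normal: "lcs G i \<lhd> G"
proof (induction i)
  case (Suc i)
  then show ?case using comm_subgroup_normal[OF _ normal_self] by (cases i) (simp_all add: normal_self)
qed (simp add: normal_self)

lemma lcs_Suc: "i \<ge> 1 \<Longrightarrow> lcs G (Suc i) = comm_subgroup G (lcs G i) (carrier G)"
  by (cases i) auto

lemma comm_in_lcs: "i \<ge> 1 \<Longrightarrow> x \<in> lcs G i \<Longrightarrow> g \<in> carrier G \<Longrightarrow> comm G x g \<in> lcs G (Suc i)"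
  by (simp add: lcs_Suc comm_in_comm_subgroup)

lemma lcs_carrier: "lcs G i \<subseteq> carrier G"
  using lcs_normal normal_imp_subgroup subgroup.subset by blast

lemma lcs_Suc_subset: "lcs G (Suc i) \<subseteq> lcs G i"
proof (cases "i \<ge> 1")
  case True
  then show ?thesis unfolding lcs_Suc[OF True]
    by (intro comm_subgroup_incl normal_imp_subgroup lcs_normal comm_mem_left)
next
  case False
  then have "i = 0" by simp
  then show ?thesis by simp
qed

lemma lcs_antimono: "i \<le> j \<Longrightarrow> lcs G j \<subseteq> lcs G i"
  by (rule lift_Suc_antimono_le[of "lcs G"]) (rule lcs_Suc_subset)

lemma lcs_stable: "i \<ge> 1 \<Longrightarrow> lcs G (Suc i) = lcs G i \<Longrightarrow> lcs G (i + k) = lcs G i"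
proof (induction k)
  case (Suc k)
  then show ?case using lcs_Suc[of i] lcs_Suc[of "i + k"] by simp
qed simp

end

section \<open>Orders of the lower central factors, and the subgroup P_1\<close>

locale maximal_class = group G for G (structure) +
  fixes p n :: nat
  assumes fin: "finite (carrier G)" and prime: "Factorial_Ring.prime p"
    and order: "order G = p ^ n" and nil: "nilpotent_class G (n - 1)" and n4: "4 \<le> n"
begin

lemma p0: "p > 0" using prime by (rule prime_gt_0_nat)

lemma p1: "p > 1" using prime by (rule prime_gt_1_nat)

lemma lcs_n: "lcs G n = {\<one>}"
  using nil n4 by (auto simp: nilpotent_class_def)

lemma lcs_nontrivial: "1 \<le> i \<Longrightarrow> i < n \<Longrightarrow> lcs G i \<noteq> {\<one>}"
proof -
  assume "1 \<le> i" "i < n"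
  then have "i - 1 < n - 1" "Suc (i - 1) = i" by auto
  then show ?thesis using nil unfolding nilpotent_class_def by metis
qed

lemma lcs_strict:
  assumes "1 \<le> i" "i < n"
  shows "lcs G (Suc i) \<subset> lcs G i"
proof -
  have "lcs G (Suc i) \<noteq> lcs G i"
    using lcs_stable[OF assms(1), of "n - i"] lcs_n lcs_nontrivial[OF assms] assms by auto
  then show ?thesis using lcs_Suc_subset by blast
qed

lemma lcs_beyond: "n \<le> i \<Longrightarrow> lcs G i = {\<one>}"
  using lcs_antimono[of n i] lcs_n subgroup.one_closed[OF normal_imp_subgroup[OF lcs_normal]] by blast

lemma subgroup_lcs: "subgroup (lcs G i) G"
  using lcs_normal normal_imp_subgroup by blast

lemma lcs_carrier' [simp]: "x \<in> lcs G i \<Longrightarrow> x \<in> carrier G"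
  using lcs_carrier by blast

text \<open>The exponents drop strictly from \<open>n\<close> to 0 in n - 1 steps, which leaves a
  slack of one. It is used up at the top, where the quotient is not cyclic, so every later drop is
  exactly one.\<close>

lemma card_lcs:
  assumes "2 \<le> i" "i \<le> n"
  shows "card (lcs G i) = p ^ (n - i)"
proof -
  have "\<forall>i. \<exists>e. card (lcs G i) = p ^ e"
  proof
    fix i
    have "card (lcs G i) dvd p ^ n"
      using lagrange[OF subgroup_lcs[of i]] order by (metis dvd_triv_right)
    then show "\<exists>e. card (lcs G i) = p ^ e"
      using divides_primepow_nat[OF prime] by blast
  qed
  then obtain e where e: "\<And>i. card (lcs G i) = p ^ e i" by metis
  have dec: "e (Suc i) < e i" if "1 \<le> i" "i < n" for i
  proof -
    have "p ^ e (Suc i) < p ^ e i"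
      unfolding e[symmetric] using lcs_strict[OF that] finite_subset[OF lcs_carrier fin]
      by (rule psubset_card_mono[rotated])
    then show ?thesis using p1 by simp
  qed
  have e1: "e 1 = n" using e[of 1] order p1 by (simp add: order_def)
  have e2: "e 2 \<le> n - 2"
  proof (rule ccontr)
    assume "\<not> e 2 \<le> n - 2"
    then have "e 2 = n - 1" using dec[of 1] e1 n4 by (simp add: numeral_2_eq_2)
    then have "card (carrier G) = p * card (lcs G 2)"
      using order e[of 2] n4 by (simp add: order_def flip: power_Suc)
    then obtain c where c: "is_char G p (carrier G) (lcs G 2) c"
      using char_exists_normal[OF lcs_normal prime fin] by blast
    obtain x where x: "x \<in> carrier G" "x \<notin> lcs G 2"
      using lcs_strict[of 1] n4 by (auto simp: numeral_2_eq_2)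
    have 3: "comm G v g \<in> lcs G 3" if "v \<in> lcs G 2" "g \<in> carrier G" for v g
      using comm_in_lcs[of 2 v g] that by (simp add: numeral_3_eq_3 numeral_2_eq_2)
    \<comment> \<open>A quotient of order \<open>p\<close> at the top would make \<open>G\<close>
      modulo \<open>lcs G 3\<close> cyclic over a central subgroup, hence abelian, and the series
      would stop at \<open>lcs G 2\<close>.\<close>
    have "comm G y z \<in> lcs G 3" if yz: "y \<in> carrier G" "z \<in> carrier G" for y z
      by (rule comm_mem_cyclic_quotient[OF lcs_normal subgroup_lcs 3 x(1) char_gen[OF subgroup_self c prime x] yz])
    then have "lcs G 2 \<subseteq> lcs G 3"
      using comm_subgroup_incl[OF subgroup_lcs, of "carrier G" "carrier G" 3] by (simp add: numeral_2_eq_2)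
    then show False using lcs_strict[of 2] n4 by (simp add: numeral_3_eq_3)
  qed
  have up: "e i \<le> n - i" using assms
  proof (induction i rule: dec_induct)
    case (step i)
    then show ?case using dec[of i] by simp
  qed (use e2 in simp)
  have "k < n \<Longrightarrow> e (n - k) \<ge> k" for k
  proof (induction k)
    case (Suc k)
    then have "Suc (n - Suc k) = n - k" by simp
    moreover have "1 \<le> n - Suc k" "n - Suc k < n" using Suc.prems by auto
    ultimately show ?case using Suc dec[of "n - Suc k"] by simp
  qed simp
  from this[of "n - i"] have "e i = n - i" using up assms by simp
  then show ?thesis using e by simp
qed

lemma lcs_char:
  assumes "2 \<le> i" "i < n"
  shows "\<exists>c. is_char G p (lcs G i) (lcs G (Suc i)) c"
proof (rule char_exists[OF subgroup_lcs lcs_normal lcs_Suc_subset prime fin])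
  have "n - i = Suc (n - Suc i)" using assms by simp
  then show "card (lcs G i) = p * card (lcs G (Suc i))"
    using assms by (simp add: card_lcs)
qed

lemma char_conj_invariant:
  assumes "is_char G p H K c" "K \<subseteq> H" "x \<in> H" "comm G x g \<in> K" "x \<in> carrier G" "g \<in> carrier G"
  shows "c (conjg G x g) = c x"
proof -
  have "c (conjg G x g) = c x * c (comm G x g)"
    using assms by (auto simp: conjg_eq_comm intro!: is_charD(1))
  moreover have "c (comm G x g) = 1" using assms is_charD(2)[OF assms(1)] by blast
  ultimately show ?thesis by simp
qed

text \<open>Modulo the next term [x, g] is central, so the conjugation in the expansion of [x, g h]
  disappears. One character of \<open>G\<close> obtained in this way has kernel P_1; others bound
  the action of \<open>lcs G 2\<close>.\<close>

lemma comm_char_mult: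
  assumes c: "is_char G p (lcs G k) (lcs G (Suc k)) c" and k: "k \<ge> 1"
    and x: "x \<in> carrier G" "\<And>g. g \<in> carrier G \<Longrightarrow> comm G x g \<in> lcs G k"
    and gh: "g \<in> carrier G" "h \<in> carrier G"
  shows "c (comm G x (g \<otimes> h)) = c (comm G x g) * c (comm G x h)"
proof -
  have "c (comm G x (g \<otimes> h)) = c (comm G x h) * c (conjg G (comm G x g) h)"
    using assms conjg_mem[OF lcs_normal] by (simp add: comm_mult_right is_charD(1)[OF c])
  also have "c (conjg G (comm G x g) h) = c (comm G x g)"
    using gh x comm_in_lcs[OF k x(2)[OF gh(1)] gh(2)]
    by (intro char_conj_invariant[OF c lcs_Suc_subset]) auto
  finally show ?thesis by simp
qed

text \<open>For \<open>x\<close> in P_2 outside P_3, [x, g] modulo P_4 is a character in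
  \<open>g\<close>. Its kernel centralizes all of P_2 / P_4, because P_2 is generated by
  \<open>x\<close> and P_3, and [P_3, G] lies in P_4.\<close>

lemma P1_char: "\<exists>c. is_char G p (carrier G) (P1 G) c"
proof -
  obtain c where c: "is_char G p (lcs G 3) (lcs G 4) c"
    using lcs_char[of 3] n4 by (auto simp: eval_nat_numeral)
  obtain c2 where c2: "is_char G p (lcs G 2) (lcs G 3) c2"
    using lcs_char[of 2] n4 by (auto simp: eval_nat_numeral)
  obtain x where x: "x \<in> lcs G 2" "x \<notin> lcs G 3"
    using lcs_strict[of 2] n4 by (auto simp: numeral_3_eq_3 numeral_2_eq_2)
  have x3: "comm G x g \<in> lcs G 3" if "g \<in> carrier G" for g
    using comm_in_lcs[of 2 x g] x that by (simp add: numeral_3_eq_3 numeral_2_eq_2)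
  have "is_char G p (carrier G) (P1 G) (\<lambda>g. c (comm G x g))"
    unfolding is_char_def
  proof (intro conjI ballI)
    fix g h assume "g \<in> carrier G" "h \<in> carrier G"
    then show "c (comm G x (g \<otimes> h)) = c (comm G x g) * c (comm G x h)"
      using c lcs_carrier'[OF x(1)] x3 by (intro comm_char_mult[where k = 3]) (simp_all add: eval_nat_numeral)
  next
    fix g assume g: "g \<in> carrier G"
    show "c (comm G x g) ^ p = 1" using is_charD(3)[OF c x3[OF g]] .
    have "c (comm G x g) = 1 \<longleftrightarrow> comm G x g \<in> lcs G 4" using is_charD(2)[OF c x3[OF g]] .
    also have "\<dots> \<longleftrightarrow> g \<in> P1 G"
    proof
      assume "g \<in> P1 G"
      then have "comm G g x \<in> lcs G 4" using x by (simp add: P1_def)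
      then show "comm G x g \<in> lcs G 4"
        using comm_mem_swap[OF subgroup_lcs g lcs_carrier'[OF x(1)]] by blast
    next
      assume xg: "comm G x g \<in> lcs G 4"
      have "comm G y g \<in> lcs G 4" if y: "y \<in> lcs G 2" for y
      proof -
        obtain j :: nat where j: "y \<otimes> inv (x [^] j) \<in> lcs G 3"
          using char_gen[OF subgroup_lcs c2 prime x y] by blast
        have "comm G v g \<in> lcs G 4" if "v \<in> lcs G 3" for v
          using comm_in_lcs[of 3 v g] that g by (simp add: eval_nat_numeral)
        from comm_mem_cosets[OF lcs_normal g subgroup_lcs lcs_carrier'[OF x(1)] xg this j lcs_carrier'[OF y]]
        show ?thesis .
      qed
      then have "comm G g y \<in> lcs G 4" if "y \<in> lcs G 2" for y
        using comm_mem_swap[OF subgroup_lcs lcs_carrier'[OF that] g] that by blast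
      then show "g \<in> P1 G" using g by (simp add: P1_def)
    qed
    finally show "c (comm G x g) = 1 \<longleftrightarrow> g \<in> P1 G" .
  qed
  then show ?thesis by blast
qed

lemma P1_carrier: "P1 G \<subseteq> carrier G" by (auto simp: P1_def)

lemma subgroup_P1: "subgroup (P1 G) G"
proof -
  have "P1 G = centralizer_mod (lcs G 4) (lcs G 2)"
    using comm_mem_swap[OF subgroup_lcs[of 4]] unfolding P1_def centralizer_mod_def
    by (meson lcs_carrier')
  then show ?thesis using subgroup_centralizer_mod[OF lcs_normal lcs_carrier] by simp
qed

lemma comm_in_kernel:
  assumes "is_char G p (carrier G) K c" "x \<in> carrier G" "y \<in> carrier G"
  shows "comm G x y \<in> K"
proof -
  note c = is_charD(1)[OF assms(1)] char_inv[OF subgroup_self assms(1) p0] char_nonzero[OF assms(1) p0]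
  have "c (comm G x y) = 1" using assms(2,3) c(3)[of x] c(3)[of y] by (simp add: comm_def c(1,2) field_simps)
  then show ?thesis using is_charD(2)[OF assms(1)] assms by simp
qed

lemma lcs_2_subset_P1: "lcs G 2 \<subseteq> P1 G"
proof -
  obtain c where "is_char G p (carrier G) (P1 G) c" using P1_char by blast
  then show ?thesis
    using comm_subgroup_incl[OF subgroup_P1, of "carrier G" "carrier G"] comm_in_kernel
    by (simp add: numeral_2_eq_2)
qed

lemma P1_normal: "P1 G \<lhd> G"
  unfolding normal_inv_iff
proof (intro conjI ballI subgroup_P1)
  fix x h assume xh: "x \<in> carrier G" "h \<in> P1 G"
  obtain c where c: "is_char G p (carrier G) (P1 G) c" using P1_char by blast
  have h: "h \<in> carrier G" using xh P1_carrier by blast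
  have "c (x \<otimes> h \<otimes> inv x) = c h"
    using xh h by (simp add: is_charD(1)[OF c] char_inv[OF subgroup_self c p0] char_nonzero[OF c p0])
  then show "x \<otimes> h \<otimes> inv x \<in> P1 G"
    using is_charD(2)[OF c, of "x \<otimes> h \<otimes> inv x"] is_charD(2)[OF c, of h] xh h by simp
qed

text \<open>If all of \<open>G\<close> centralized P_2 / P_4, then P_3 = [P_2, G] would lie in
  P_4.\<close>

lemma P1_proper: "P1 G \<noteq> carrier G"
proof
  assume *: "P1 G = carrier G"
  have "comm G x g \<in> lcs G 4" if "x \<in> lcs G 2" "g \<in> carrier G" for x g
  proof -
    have "g \<in> P1 G" using that * by simp
    then have "comm G g x \<in> lcs G 4" using that by (simp add: P1_def)
    then show ?thesis using comm_mem_swap[OF subgroup_lcs that(2) lcs_carrier'[OF that(1)]] by blast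
  qed
  then have "lcs G 3 \<subseteq> lcs G 4"
    using comm_subgroup_incl[OF subgroup_lcs, of "lcs G 2" "carrier G" 4] lcs_Suc[of 2]
    by (simp add: numeral_3_eq_3 numeral_2_eq_2)
  then show False using lcs_strict[of 3] n4 by (simp add: eval_nat_numeral)
qed

section \<open>The filtration starting with P_1\<close>

abbreviation "U \<equiv> Pser G"

lemma U_normal: "U i \<lhd> G" by (simp add: Pser_def P1_normal lcs_normal)

lemma U_subgroup: "subgroup (U i) G" using U_normal normal_imp_subgroup by blast

lemma U_carrier [simp]: "x \<in> U i \<Longrightarrow> x \<in> carrier G"
  using U_subgroup subgroup.subset by blast

lemma U_1: "U 1 = P1 G" "U (Suc 0) = P1 G" by (simp_all add: Pser_def)

lemma U_lcs: "2 \<le> i \<Longrightarrow> U i = lcs G i" by (simp add: Pser_def)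

text \<open>\<open>U 0\<close> and \<open>U 1\<close> are both P_1, so the filtration decreases from
  index 0 on, while orders and strictness are stated from index 1.\<close>

lemma U_Suc_subset: "U (Suc i) \<subseteq> U i"
  using lcs_2_subset_P1 lcs_Suc_subset[of i] by (auto simp: Pser_def numeral_2_eq_2 le_Suc_eq)

lemma U_antimono: "i \<le> j \<Longrightarrow> U j \<subseteq> U i"
  by (rule lift_Suc_antimono_le[of U]) (rule U_Suc_subset)

lemma U_mono: "x \<in> U j \<Longrightarrow> i \<le> j \<Longrightarrow> x \<in> U i" using U_antimono by blast

lemma comm_in_U: "1 \<le> i \<Longrightarrow> x \<in> U i \<Longrightarrow> g \<in> carrier G \<Longrightarrow> comm G x g \<in> U (Suc i)"
proof (cases "i = 1")
  case True
  assume "x \<in> U i" "g \<in> carrier G"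
  then show ?thesis using True comm_in_lcs[of 1 x g] U_carrier[of x i] by (simp add: Pser_def)
next
  case False
  assume "1 \<le> i" "x \<in> U i" "g \<in> carrier G"
  then show ?thesis using False comm_in_lcs[of i x g] by (simp add: Pser_def)
qed

lemma U_trivial: "n \<le> i \<Longrightarrow> U i = {\<one>}" using lcs_beyond n4 by (simp add: Pser_def)

lemma card_U:
  assumes "1 \<le> i" "i \<le> n"
  shows "card (U i) = p ^ (n - i)"
proof (cases "i = 1")
  case True
  obtain c where c: "is_char G p (carrier G) (P1 G) c" using P1_char by blast
  obtain x where "x \<in> carrier G" "x \<notin> P1 G" using P1_proper P1_carrier by blast
  then have "card (carrier G) = p * card (P1 G)"
    by (rule card_char[OF subgroup_self c prime subgroup_P1 P1_carrier])
  moreover have "card (carrier G) = p * p ^ (n - 1)" using order n4 by (simp add: order_def flip: power_Suc)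
  ultimately show ?thesis using True p0 by (simp add: U_1)
qed (use assms card_lcs in \<open>simp add: Pser_def\<close>)

lemma U_strict: "1 \<le> i \<Longrightarrow> i < n \<Longrightarrow> \<not> U i \<subseteq> U (Suc i)"
proof
  assume i: "1 \<le> i" "i < n" and "U i \<subseteq> U (Suc i)"
  then have "U i = U (Suc i)" using U_Suc_subset by blast
  then have "p ^ (n - i) = p ^ (n - Suc i)" using i card_U[of i] card_U[of "Suc i"] by simp
  then show False using i p1 by simp
qed

lemma U_char:
  assumes "1 \<le> i" "i < n"
  shows "\<exists>c. is_char G p (U i) (U (Suc i)) c"
proof (rule char_exists[OF U_subgroup U_normal U_Suc_subset prime fin])
  have "n - i = Suc (n - Suc i)" using assms by simp
  then show "card (U i) = p * card (U (Suc i))"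
    using assms by (simp add: card_U)
qed

lemma U_gen:
  assumes "1 \<le> i" "i < n" "z \<in> U i" "z \<notin> U (Suc i)" "v \<in> U i"
  shows "\<exists>j::nat. v \<otimes> inv (z [^] j) \<in> U (Suc i)"
  using U_char[OF assms(1,2)] char_gen[OF U_subgroup _ prime assms(3,4,5)] by blast

lemma G_gen:
  assumes "x \<in> carrier G" "x \<notin> U 1" "y \<in> carrier G"
  shows "\<exists>j::nat. y \<otimes> inv (x [^] j) \<in> U 1"
  using P1_char char_gen[OF subgroup_self _ prime] assms unfolding U_1 by blast

lemma pow_p_in_P1: "x \<in> carrier G \<Longrightarrow> x [^] p \<in> U 1"
proof -
  assume x: "x \<in> carrier G"
  obtain c where c: "is_char G p (carrier G) (P1 G) c" using P1_char by blast
  then show ?thesis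
    using char_nat_pow[OF subgroup_self c p0 x] is_charD(3)[OF c x] is_charD(2)[OF c, of "x [^] p"] x
    by (simp add: U_1)
qed

text \<open>Modulo \<open>U (i + 2)\<close>, commutation with \<open>x\<close> is a homomorphism
  from \<open>G\<close> to an abelian group; it kills all commutators and with them P_2.\<close>

lemma comm_U_P2:
  assumes "1 \<le> i" "x \<in> U i" "g \<in> U 2"
  shows "comm G x g \<in> U (i + 2)"
proof (cases "Suc i < n")
  case False
  have "comm G x g \<in> U (Suc i)" using assms comm_in_U by simp
  then show ?thesis using False U_trivial[of "Suc i"] U_trivial[of "i + 2"] by simp
next
  case True
  obtain c where c: "is_char G p (U (Suc i)) (U (Suc (Suc i))) c" using U_char[of "Suc i"] True by auto
  have xg: "comm G x g \<in> U (Suc i)" if "g \<in> carrier G" for g using that assms comm_in_U by simp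
  have "is_char G p (carrier G) {g \<in> carrier G. comm G x g \<in> U (i + 2)} (\<lambda>g. c (comm G x g))"
    unfolding is_char_def
  proof (intro conjI ballI)
    fix g h assume "g \<in> carrier G" "h \<in> carrier G"
    then show "c (comm G x (g \<otimes> h)) = c (comm G x g) * c (comm G x h)"
      using c xg assms by (intro comm_char_mult[where k = "Suc i"]) (auto simp: U_lcs)
  next
    fix g assume g: "g \<in> carrier G"
    show "c (comm G x g) ^ p = 1" using is_charD(3)[OF c xg[OF g]] .
    show "c (comm G x g) = 1 \<longleftrightarrow> g \<in> {g \<in> carrier G. comm G x g \<in> U (i + 2)}"
      using g is_charD(2)[OF c xg[OF g]] by simp
  qed
  from comm_in_kernel[OF this]
  have "comm G x (comm G a b) \<in> U (i + 2)" if "a \<in> carrier G" "b \<in> carrier G" for a b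
    using that by blast
  moreover have "subgroup (centralizer_mod (U (i + 2)) {x}) G"
    using assms by (intro subgroup_centralizer_mod U_normal) auto
  ultimately have "lcs G 2 \<subseteq> centralizer_mod (U (i + 2)) {x}"
    using comm_subgroup_incl[of "centralizer_mod (U (i + 2)) {x}" "carrier G" "carrier G"]
    by (auto simp: numeral_2_eq_2 centralizer_mod_def)
  then show ?thesis using assms by (auto simp: U_lcs centralizer_mod_def)
qed

text \<open>Otherwise \<open>x\<close> and P_1, which generate \<open>G\<close>, centralize
  \<open>z\<close> modulo \<open>U (k + 2)\<close>. As \<open>z\<close> generates \<open>U k\<close>
  modulo \<open>U (Suc k)\<close>, all of [U k, G] would then be too deep. So commutation with an
  element outside P_1 descends exactly one step wherever P_1 centralizes U k / U (k + 2).\<close>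

lemma comm_notin_U:
  assumes k: "1 \<le> k" "Suc k < n" and z: "z \<in> U k" "z \<notin> U (Suc k)" and x: "x \<in> carrier G" "x \<notin> U 1"
    and P1_centr: "\<And>v u. v \<in> U k \<Longrightarrow> u \<in> U 1 \<Longrightarrow> comm G v u \<in> U (k + 2)"
  shows "comm G z x \<notin> U (k + 2)"
proof
  assume zx: "comm G z x \<in> U (k + 2)"
  have zG: "z \<in> carrier G" using z by simp
  have 1: "comm G z g \<in> U (k + 2)" if g: "g \<in> carrier G" for g
  proof -
    obtain j :: nat where j: "g \<otimes> inv (x [^] j) \<in> U 1" using G_gen[OF x g] by blast
    have vz: "comm G v z \<in> U (k + 2)" if "v \<in> U 1" for v
      using comm_mem_swap[OF U_subgroup zG U_carrier[OF that] P1_centr[OF z(1) that]] .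
    have "comm G g z \<in> U (k + 2)"
      by (rule comm_mem_cosets[OF U_normal zG U_subgroup x(1) _ vz j g])
        (rule comm_mem_swap[OF U_subgroup zG x(1) zx])
    then show ?thesis by (rule comm_mem_swap[OF U_subgroup g zG])
  qed
  have 2: "comm G v g \<in> U (k + 2)" if v: "v \<in> U k" and g: "g \<in> carrier G" for v g
  proof -
    obtain j :: nat where j: "v \<otimes> inv (z [^] j) \<in> U (Suc k)" using U_gen[OF k(1) _ z v] k by auto
    have wg: "comm G w g \<in> U (k + 2)" if "w \<in> U (Suc k)" for w
      using comm_in_U[OF _ that g] by simp
    show ?thesis
      by (rule comm_mem_cosets[OF U_normal g U_subgroup zG 1[OF g] wg j U_carrier[OF v]])
  qed
  \<comment> \<open>For k = 1 the group \<open>U k\<close> is not a term of the lower central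
    series. There P_2 is reached through commutators of arbitrary elements, using that G / P_1 is
    cyclic.\<close>
  have "U (Suc k) \<subseteq> U (k + 2)"
  proof (cases "k = 1")
    case True
    have 3: "comm G v g \<in> U 3" if "v \<in> U 1" "g \<in> carrier G" for v g
      using 2[of v g] that True by (simp add: numeral_3_eq_3)
    have "comm G a b \<in> U 3" if ab: "a \<in> carrier G" "b \<in> carrier G" for a b
      by (rule comm_mem_cyclic_quotient[OF U_normal U_subgroup 3 x(1) G_gen[OF x] ab])
    then have "lcs G 2 \<subseteq> U 3"
      using comm_subgroup_incl[OF U_subgroup, of "carrier G" "carrier G" 3] by (simp add: numeral_2_eq_2)
    then show ?thesis using True by (simp add: U_lcs numeral_2_eq_2[symmetric] numeral_3_eq_3[symmetric])
  next
    case False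
    then have "U (Suc k) = comm_subgroup G (U k) (carrier G)" using k lcs_Suc[of k] by (simp add: U_lcs)
    then show ?thesis using comm_subgroup_incl[OF U_subgroup 2] by simp
  qed
  then show False using U_strict[of "Suc k"] k by simp
qed

end

section \<open>Sufficiency of the commutator condition\<close>

context curly_pairing
begin

text \<open>Both sides are the i-th power of \<open>\<tau> a s\<close>: since [a, s] is central, the
  conjugations occurring in the expansions change no pair. The lemma brings a second argument that
  is a power of \<open>s\<close> back to \<open>s\<close>.\<close>

lemma pair_pow_central:
  assumes a: "a \<in> carrier G" and s: "s \<in> carrier G"
    and central: "\<And>g. g \<in> carrier G \<Longrightarrow> comm G (comm G a s) g = \<one>"
  shows "\<tau> a (s [^] (i::nat)) = \<tau> (a [^] i) s"
proof (induction i)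
  case 0
  then show ?case using assms by (simp add: pair_comm)
next
  case (Suc i)
  have pow: "conjg G x (x [^] i) = x" "conjg G (x [^] i) x = x [^] i" if "x \<in> carrier G" for x
  proof -
    have "x [^] i \<otimes> x = x \<otimes> x [^] i" using nat_pow_Suc2[of x i] that by simp
    then have eq: "x \<otimes> x [^] i = x [^] i \<otimes> x" by simp
    show "conjg G x (x [^] i) = x" using that eq by (simp add: conjg_def m_assoc)
    show "conjg G (x [^] i) x = x [^] i" using that eq[symmetric] by (simp add: conjg_def m_assoc)
  qed
  have triv: "conjg G g (comm G a s) = g" if "g \<in> carrier G" for g
    using that central[OF that] a s comm_eq_one_sym[of "comm G a s" g] by (simp add: conjg_eq_comm)
  have "comm G (conjg G a s) (s [^] i) = comm G a (s [^] i)"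
    unfolding conjg_eq_comm[OF a s] using a s central by (simp add: comm_mult_left triv)
  then have "\<tau> (conjg G a s) (s [^] i) = \<tau> a (s [^] i)"
    using a s by (intro pair_cong_left) auto
  then have "\<tau> a (s [^] Suc i) = \<tau> a s \<otimes>\<^bsub>Q\<^esub> \<tau> (a [^] i) s"
    using a s Suc by (simp add: pair_right pow)
  moreover have "\<tau> a (conjg G s (a [^] i)) = \<tau> a s"
    using pair_comm_left[of a s "a [^] i"] a s central pow[OF a] by (simp add: pair_comm)
  moreover have "\<tau> (a [^] Suc i) s = \<tau> (a \<otimes> a [^] i) s" using a by (simp only: nat_pow_Suc2)
  ultimately show ?case
    using a s by (simp add: pair_left pow)
qed

end

context group
begin

lemma comm_pow_central:
  assumes x: "x \<in> carrier G" and y: "y \<in> carrier G"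
    and central: "\<And>g. g \<in> carrier G \<Longrightarrow> comm G (comm G x y) g = \<one>"
  shows "comm G x (y [^] (j::nat)) = comm G x y [^] j" "comm G (x [^] j) y = comm G x y [^] j"
proof -
  have triv: "conjg G (comm G x y) g = comm G x y" if "g \<in> carrier G" for g
    using that central x y by (simp add: conjg_eq_comm)
  show "comm G x (y [^] j) = comm G x y [^] j"
  proof (induction j)
    case (Suc j)
    have "comm G x (y [^] Suc j) = comm G x (y \<otimes> y [^] j)" using y by (simp only: nat_pow_Suc2)
    then show ?case using x y Suc by (simp add: comm_mult_right triv)
  qed (use x in simp)
  show "comm G (x [^] j) y = comm G x y [^] j"
  proof (induction j)
    case (Suc j)
    have "comm G (x [^] Suc j) y = comm G (x \<otimes> x [^] j) y" using x by (simp only: nat_pow_Suc2)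
    also have "\<dots> = comm G x y \<otimes> comm G x y [^] j" using x y Suc by (simp add: comm_mult_left triv)
    finally show ?case using x y by (simp only: nat_pow_Suc2 comm_closed)
  qed (use y in simp)
qed

end

context maximal_class
begin

lemma comm_last: "x \<in> U (n - 1) \<Longrightarrow> g \<in> carrier G \<Longrightarrow> comm G x g = \<one>"
  using comm_in_U[of "n - 1" x g] U_trivial[of n] n4 by simp

lemma comm_mem_last: "x \<in> U (n - 2) \<Longrightarrow> g \<in> carrier G \<Longrightarrow> comm G x g \<in> U (n - 1)"
  using comm_in_U[of "n - 2" x g] n4 by (simp add: numeral_2_eq_2 Suc_diff_Suc)

lemma U_last_pow:
  assumes "w \<in> U (n - 1)" "w \<noteq> \<one>" "z \<in> U (n - 1)"
  shows "\<exists>j::nat. z = w [^] j"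
proof -
  obtain j :: nat where "z \<otimes> inv (w [^] j) \<in> U (Suc (n - 1))"
  proof -
    have "1 \<le> n - 1" "n - 1 < n" "Suc (n - 1) = n" using n4 by auto
    then show thesis using U_gen[of "n - 1" w z] assms that U_trivial[of n] by auto
  qed
  then have "z \<otimes> inv (w [^] j) = \<one>" using n4 U_trivial[of n] by simp
  then have "z = w [^] j"
    using assms inv_equality[of z "inv (w [^] j)"] by simp
  then show ?thesis by blast
qed

theorem B0_trivial_if:
  assumes eq: "comm_subgroup G (U 1) (U 1) = comm_subgroup G (U 1) (U (n - 2))"
  shows "B0_trivial G"
proof (cases "\<forall>u\<in>U 1. \<forall>v\<in>U 1. comm G u v = \<one>")
  case True
  obtain s where s: "s \<in> carrier G" "s \<notin> U 1" using P1_proper P1_carrier by (auto simp: U_1)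
  interpret curly_pairing G "curly_square G" "\<lambda>x y. curly_class G [(x, y, True)]"
    by (rule curly_square_pairing)
  show ?thesis
  proof (rule B0_trivial_if_cyclic_quotient[OF s(1) U_normal triv_subgroup])
    fix u v assume "u \<in> U 1" "v \<in> U 1"
    then show "\<exists>a\<in>{\<one>}. curly_class G [(u, v, True)] = curly_class G [(a, s, True)]"
      using True s by (simp add: pair_comm)
  qed (use s G_gen subgroup.one_closed[OF U_subgroup] in auto)
next
  case False
  interpret curly_pairing G "curly_square G" "\<lambda>x y. curly_class G [(x, y, True)]"
    by (rule curly_square_pairing)
  let ?t = "\<lambda>x y. curly_class G [(x, y, True)]"
  have n21: "U (n - 2) \<subseteq> U 1" using n4 by (intro U_antimono) simp
  have last: "comm G h k \<in> U (n - 1)" if "h \<in> U 1" "k \<in> U (n - 2)" for h k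
    using that comm_mem_swap[OF U_subgroup _ _ comm_mem_last] by simp
  have Z: "comm G u v \<in> U (n - 1)" if "u \<in> U 1" "v \<in> U 1" for u v
    using comm_in_comm_subgroup[OF that] comm_subgroup_incl[OF U_subgroup last] eq by blast
  have central: "comm G (comm G u v) g = \<one>" if "u \<in> U 1" "v \<in> U 1" "g \<in> carrier G" for u v g
    using comm_last[OF Z[OF that(1,2)] that(3)] .
  have centralt: "comm G (comm G a y) g = \<one>" if "a \<in> U (n - 2)" "y \<in> carrier G" "g \<in> carrier G" for a y g
    using comm_last[OF comm_mem_last[OF that(1,2)] that(3)] .
  \<comment> \<open>If P_1 centralized P_(n-2), the assumed equality would make P_1 abelian.\<close>
  have "\<exists>t\<in>U (n - 2). \<exists>g\<in>U 1. comm G t g \<noteq> \<one>"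
  proof (rule ccontr)
    assume "\<not> ?thesis"
    then have *: "comm G h k \<in> {\<one>}" if "h \<in> U 1" "k \<in> U (n - 2)" for h k
      using that comm_eq_one_sym[of k h] by auto
    have "comm G u v = \<one>" if "u \<in> U 1" "v \<in> U 1" for u v
      using comm_in_comm_subgroup[OF that] comm_subgroup_incl[OF triv_subgroup *] eq by blast
    then show False using False by blast
  qed
  then obtain t g0 where t: "t \<in> U (n - 2)" and g0: "g0 \<in> U 1" "comm G t g0 \<noteq> \<one>" by blast
  have tG: "t \<in> carrier G" and t1: "t \<in> U 1" using t n21 by auto
  \<comment> \<open>\<open>U n\<close> is trivial, so this is the centralizer of \<open>t\<close>.
    For \<open>s\<close> outside it, [t, s] generates \<open>U (n - 1)\<close>, and all commutators
    of elements of P_1 are powers of it.\<close>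
  have "centralizer_mod (U n) {t} \<noteq> carrier G"
    using g0 U_trivial[of n] by (auto simp: centralizer_mod_def)
  moreover have "subgroup (centralizer_mod (U n) {t}) G"
    using tG by (intro subgroup_centralizer_mod U_normal) auto
  moreover have "U 1 \<noteq> carrier G" using P1_proper by (simp add: U_1)
  ultimately obtain s where s: "s \<in> carrier G" "s \<notin> U 1" "s \<notin> centralizer_mod (U n) {t}"
    using not_union_of_subgroups[OF U_subgroup] by blast
  then have ts: "comm G t s \<noteq> \<one>" "comm G t s \<in> U (n - 1)"
    using U_trivial[of n] comm_mem_last[OF t] by (auto simp: centralizer_mod_def)
  show ?thesis
  proof (rule B0_trivial_if_cyclic_quotient[OF s(1) U_normal U_subgroup n21])
    show "comm G (comm G a s) g = \<one>" if "a \<in> U (n - 2)" "g \<in> carrier G" for a g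
      using centralt[OF that(1) s(1) that(2)] .
    show "\<exists>j::nat. y \<otimes> inv (s [^] j) \<in> U 1" if "y \<in> carrier G" for y
      using G_gen[OF s(1,2) that] .
    fix u v assume uv: "u \<in> U 1" "v \<in> U 1"
    note uG = U_carrier[OF uv(1)] and vG = U_carrier[OF uv(2)]
    show "\<exists>a\<in>U (n - 2). ?t u v = ?t a s"
    proof (cases "comm G u v = \<one>")
      case True
      then show ?thesis
        using uG vG s by (intro bexI[of _ \<one>] subgroup.one_closed[OF U_subgroup]) (simp add: pair_comm)
    next
      case uv1: False
      \<comment> \<open>\<open>u\<close> and \<open>t\<close> need a common partner. Without such a
        \<open>g\<close>, multiplying \<open>v\<close> by any \<open>h\<close> of P_1 centralizing
        \<open>u\<close> shows that \<open>h\<close> centralizes \<open>t\<close>; writing g0 = h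
        v^j then gives [t, g0] = 1.\<close>
      have "\<exists>g\<in>U 1. comm G u g = comm G u v \<and> comm G t g \<noteq> \<one>"
      proof (rule ccontr)
        assume *: "\<not> ?thesis"
        then have tv: "comm G t v = \<one>" using uv by blast
        have h: "comm G t h = \<one>" if h: "h \<in> U 1" "comm G u h = \<one>" for h
        proof -
          have "comm G u (v \<otimes> h) = comm G u v"
            using h uG vG central[OF uv U_carrier[OF h(1)]] by (simp add: comm_mult_right conjg_eq_comm)
          then have "comm G t (v \<otimes> h) = \<one>"
            using * subgroup.m_closed[OF U_subgroup uv(2) h(1)] by blast
          then show ?thesis using h tv tG vG by (simp add: comm_mult_right)
        qed
        obtain j :: nat where j: "comm G u g0 = comm G u v [^] j"
          using U_last_pow[OF Z[OF uv] uv1 Z[OF uv(1) g0(1)]] by blast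
        have vj: "comm G u (v [^] j) = comm G u v [^] j" "comm G t (v [^] j) = \<one>"
          using comm_pow_central(1)[OF uG vG central[OF uv]] comm_pow_central(1)[OF tG vG centralt[OF t vG]] tv
          by simp_all
        let ?h = "g0 \<otimes> inv (v [^] j)"
        have vj1: "v [^] j \<in> U 1"
          using uv(2) by (induction j) (auto intro: subgroup.one_closed[OF U_subgroup] subgroup.m_closed[OF U_subgroup])
        have h1: "?h \<in> U 1" using g0 vj1 subgroup.m_closed[OF U_subgroup] subgroup.m_inv_closed[OF U_subgroup] by blast
        have hv: "g0 = ?h \<otimes> v [^] j" using g0 vG by (simp add: m_assoc)
        have "comm G u g0 = comm G u (v [^] j) \<otimes> conjg G (comm G u ?h) (v [^] j)"
          using uG vG g0 by (subst hv, subst comm_mult_right) auto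
        then have "conjg G (comm G u ?h) (v [^] j) = \<one>"
          using j vj uG vG g0 by simp
        then have "conjg G (conjg G (comm G u ?h) (v [^] j)) (inv (v [^] j)) = \<one>" using vG by simp
        then have "comm G u ?h = \<one>" using uG vG g0 by simp
        then have "comm G t ?h = \<one>" using h h1 by blast
        moreover have "comm G t g0 = comm G t (v [^] j) \<otimes> conjg G (comm G t ?h) (v [^] j)"
          using tG vG g0 by (subst hv, subst comm_mult_right) auto
        ultimately show False using g0 vj vG by simp
      qed
      then obtain g where g: "g \<in> U 1" "comm G u g = comm G u v" "comm G t g \<noteq> \<one>" by blast
      have gG: "g \<in> carrier G" using g by simp
      obtain j :: nat where j: "comm G u v = comm G t g [^] j"
        using U_last_pow[OF Z[OF t1 g(1)] g(3) Z[OF uv]] by blast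
      obtain i :: nat where i: "comm G t g = comm G t s [^] i"
        using U_last_pow[OF ts(2,1) Z[OF t1 g(1)]] by blast
      have tj: "t [^] k \<in> U (n - 2)" for k :: nat
        using t by (induction k) (auto intro: subgroup.one_closed[OF U_subgroup] subgroup.m_closed[OF U_subgroup])
      \<comment> \<open>The chain of pairs is (u, v), (u, g), (t^j, g), (t^j, s^i), (t^(j i), s).
        Each link but the last keeps one entry and the commutator; the last moves the exponent
        \<open>i\<close> to the first entry.\<close>
      have "?t u v = ?t u g" using uG vG gG g by (intro pair_cong_right) auto
      also have tjg: "comm G (t [^] j) g = comm G t g [^] j"
        by (rule comm_pow_central(2)[OF tG gG centralt[OF t gG]])
      then have "?t u g = ?t (t [^] j) g"
        using uG vG gG tG g j by (intro pair_cong_left) auto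
      also have "?t (t [^] j) g = ?t (t [^] j) (s [^] i)"
      proof (rule pair_cong_right)
        have "comm G (t [^] j) (s [^] i) = comm G (t [^] j) s [^] i"
          by (rule comm_pow_central(1)[OF _ s(1) centralt[OF tj s(1)]]) (use tG in auto)
        also have "comm G (t [^] j) s = comm G t s [^] j"
          by (rule comm_pow_central(2)[OF tG s(1) centralt[OF t s(1)]])
        finally show "comm G (t [^] j) g = comm G (t [^] j) (s [^] i)"
          using tjg i tG s by (simp add: nat_pow_pow mult.commute)
      qed (use tG gG s in auto)
      also have "\<dots> = ?t ((t [^] j) [^] i) s"
        by (rule pair_pow_central[OF _ s(1) centralt[OF tj s(1)]]) (use tG in auto)
      finally show ?thesis using tj[of "j * i"] tG by (auto simp: nat_pow_pow)
    qed
  qed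
qed

text \<open>[P_1, P_2] lies in P_4 by the definition of P_1, and P_1 / P_2 is cyclic, so its
  generator contributes nothing new. This gives the level \<open>m\<close> its lower bound
  4.\<close>

lemma comm_P1_U4:
  assumes "u \<in> U 1" "v \<in> U 1"
  shows "comm G u v \<in> U 4"
proof -
  have c: "comm G a w \<in> U 4" "comm G w a \<in> U 4" if "a \<in> U 1" "w \<in> U 2" for a w
  proof -
    show "comm G a w \<in> U 4" using that by (simp add: U_1 U_lcs P1_def)
    then show "comm G w a \<in> U 4" using that comm_mem_swap[OF U_subgroup] by simp
  qed
  obtain x where x: "x \<in> U 1" "x \<notin> U 2" using U_strict[of 1] n4 by (auto simp: numeral_2_eq_2)
  have gen: "\<exists>j::nat. y \<otimes> inv (x [^] j) \<in> U 2" if "y \<in> U 1" for y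
    using U_gen[of 1 x y] x that n4 by (simp add: numeral_2_eq_2)
  have 1: "comm G y x \<in> U 4" if y: "y \<in> U 1" for y
  proof -
    obtain j :: nat where j: "y \<otimes> inv (x [^] j) \<in> U 2" using gen[OF y] by blast
    have "comm G x x \<in> U 4" using x subgroup.one_closed[OF U_subgroup] by simp
    from comm_mem_cosets[OF U_normal U_carrier[OF x(1)] U_subgroup U_carrier[OF x(1)] this c(2)[OF x(1)] j]
    show ?thesis using y by simp
  qed
  obtain j :: nat where j: "u \<otimes> inv (x [^] j) \<in> U 2" using gen[OF assms(1)] by blast
  have "comm G x v \<in> U 4"
    using comm_mem_swap[OF U_subgroup _ _ 1[OF assms(2)]] x assms by simp
  from comm_mem_cosets[OF U_normal U_carrier[OF assms(2)] U_subgroup U_carrier[OF x(1)] this c(2)[OF assms(2)] j]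
  show ?thesis using assms by simp
qed

end

section \<open>The commutator form on the first term of the filtration\<close>

text \<open>The character \<open>c\<close> reads off a commutator of elements of P_1 modulo
  \<open>U (Suc m)\<close>. Maximality of \<open>m\<close> enters later, in the form of a pair on
  which \<open>b\<close> is not 1.\<close>

locale maximal_class_level = maximal_class +
  fixes m :: nat and c :: "'a \<Rightarrow> complex"
  assumes m: "4 \<le> m" "m < n" and comm_P1: "u \<in> U 1 \<Longrightarrow> v \<in> U 1 \<Longrightarrow> comm G u v \<in> U m"
    and c: "is_char G p (U m) (U (Suc m)) c"
begin

declare One_nat_def [simp del]

definition b :: "'a \<Rightarrow> 'a \<Rightarrow> complex" where "b u v = c (comm G u v)"

lemma U1_mult: "u \<in> U 1 \<Longrightarrow> v \<in> U 1 \<Longrightarrow> u \<otimes> v \<in> U 1"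
  and U1_inv: "u \<in> U 1 \<Longrightarrow> inv u \<in> U 1"
  and U1_one: "\<one> \<in> U 1"
  by (rule subgroup.m_closed[OF U_subgroup], assumption+)
    (rule subgroup.m_inv_closed[OF U_subgroup], assumption, rule subgroup.one_closed[OF U_subgroup])

lemma U1_pow: "u \<in> U 1 \<Longrightarrow> u [^] (j::nat) \<in> U 1"
  by (induction j) (auto intro: U1_mult U1_one)

lemma U1_conjg: "u \<in> U 1 \<Longrightarrow> g \<in> carrier G \<Longrightarrow> conjg G u g \<in> U 1"
  using conjg_mem[OF U_normal] .

lemma U1_comm: "u \<in> U 1 \<Longrightarrow> g \<in> carrier G \<Longrightarrow> comm G u g \<in> U 1"
  using comm_mem_left[OF U_normal] .

lemma c_conjg:
  assumes "x \<in> U m" "g \<in> carrier G"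
  shows "c (conjg G x g) = c x"
  using assms m comm_in_U[of m x g] by (intro char_conj_invariant[OF c U_Suc_subset]) auto

lemma b_nonzero: "u \<in> U 1 \<Longrightarrow> v \<in> U 1 \<Longrightarrow> b u v \<noteq> 0"
  unfolding b_def using char_nonzero[OF c p0 comm_P1] .

lemma b_power_p: "u \<in> U 1 \<Longrightarrow> v \<in> U 1 \<Longrightarrow> b u v ^ p = 1"
  unfolding b_def using is_charD(3)[OF c comm_P1] .

lemma b_eq_one_iff: "u \<in> U 1 \<Longrightarrow> v \<in> U 1 \<Longrightarrow> b u v = 1 \<longleftrightarrow> comm G u v \<in> U (Suc m)"
  unfolding b_def using is_charD(2)[OF c comm_P1] .

lemma b_mult_left:
  assumes "u \<in> U 1" "v \<in> U 1" "w \<in> U 1"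
  shows "b (u \<otimes> v) w = b u w * b v w"
proof -
  have "b (u \<otimes> v) w = c (conjg G (comm G u w) v) * c (comm G v w)"
    unfolding b_def using assms conjg_mem[OF U_normal comm_P1] comm_P1
    by (simp add: comm_mult_left is_charD(1)[OF c])
  then show ?thesis using assms comm_P1 by (simp add: c_conjg b_def)
qed

lemma b_antisym:
  assumes "u \<in> U 1" "v \<in> U 1"
  shows "b v u = inverse (b u v)"
  using char_inv[OF U_subgroup c p0 comm_P1[OF assms]] assms by (simp add: b_def inv_comm_eq)

lemma b_mult_right:
  assumes "u \<in> U 1" "v \<in> U 1" "w \<in> U 1"
  shows "b u (v \<otimes> w) = b u v * b u w"
  using assms b_mult_left[OF assms(2,3,1)] by (simp add: b_antisym[of _ u] U1_mult)

lemma b_self: "u \<in> U 1 \<Longrightarrow> b u u = 1"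
  using char_one[OF U_subgroup c p0] by (simp add: b_def)

lemma b_one: "u \<in> U 1 \<Longrightarrow> b \<one> u = 1" "u \<in> U 1 \<Longrightarrow> b u \<one> = 1"
  using char_one[OF U_subgroup c p0] by (simp_all add: b_def)

lemma b_Um:
  assumes "u \<in> U 1" "v \<in> U m"
  shows "b u v = 1" "b v u = 1"
proof -
  have v1: "v \<in> U 1" using U_mono[OF assms(2)] m by simp
  show 1: "b v u = 1" using comm_in_U[of m v u] assms v1 m by (simp add: b_eq_one_iff)
  show "b u v = 1" using b_antisym[OF v1 assms(1)] 1 by simp
qed

lemma b_conjg:
  assumes "u \<in> U 1" "v \<in> U 1" "g \<in> carrier G"
  shows "b (conjg G u g) (conjg G v g) = b u v"
  using assms comm_P1 by (simp add: b_def c_conjg flip: conjg_comm)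

text \<open>Conjugation by \<open>w\<close> multiplies \<open>u\<close> by [u, w], which lies in
  \<open>U m\<close> and hence in the radical. So the action of \<open>G\<close> on P_1 modulo the
  radical factors through G / P_1.\<close>

lemma b_conjg_P1:
  assumes "u \<in> U 1" "v \<in> U 1" "w \<in> U 1"
  shows "b (conjg G u w) v = b u v"
  using assms U1_comm b_Um(2)[OF assms(2) comm_P1[OF assms(1,3)]]
  by (simp add: conjg_eq_comm b_mult_left)

lemma b_pow_left: "u \<in> U 1 \<Longrightarrow> v \<in> U 1 \<Longrightarrow> b (u [^] (j::nat)) v = b u v ^ j"
  by (induction j) (simp_all add: b_one b_mult_left U1_pow)

lemma b_left_coset:
  assumes "u \<in> U 1" "x \<in> U 1" "v \<in> U 1" "b (u \<otimes> inv (x [^] (j::nat))) v = 1"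
  shows "b u v = b x v ^ j"
proof -
  have "u = (u \<otimes> inv (x [^] j)) \<otimes> x [^] j" using assms by (simp add: m_assoc)
  then have "b u v = b (u \<otimes> inv (x [^] j)) v * b (x [^] j) v"
    using assms U1_pow[OF assms(2)] by (metis U1_inv U1_mult b_mult_left)
  then show ?thesis using assms by (simp add: b_pow_left)
qed

lemma b_right_coset:
  assumes "u \<in> U 1" "x \<in> U 1" "v \<in> U 1" "b v (u \<otimes> inv (x [^] (j::nat))) = 1"
  shows "b v u = b v x ^ j"
proof -
  have "u \<otimes> inv (x [^] j) \<in> U 1" using assms U1_mult U1_inv U1_pow by blast
  from b_antisym[OF assms(3) this] have "b (u \<otimes> inv (x [^] j)) v = 1" using assms by simp
  from b_left_coset[OF assms(1,2,3) this] show ?thesis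
    using assms by (simp add: b_antisym[of _ v] power_inverse)
qed

section \<open>Iterated commutators with a fixed element\<close>

primrec iter_comm :: "'a \<Rightarrow> nat \<Rightarrow> 'a \<Rightarrow> 'a" where
  "iter_comm s 0 x = x"
| "iter_comm s (Suc i) x = comm G (iter_comm s i x) s"

lemma iter_comm_shift: "iter_comm s i (comm G x s) = iter_comm s (Suc i) x"
  by (induction i) simp_all

lemma iter_comm_U: "s \<in> carrier G \<Longrightarrow> 1 \<le> k \<Longrightarrow> x \<in> U k \<Longrightarrow> iter_comm s i x \<in> U (i + k)"
  by (induction i) (simp_all add: comm_in_U)

lemma iter_comm_U_Suc: "s \<in> carrier G \<Longrightarrow> x \<in> U 1 \<Longrightarrow> iter_comm s i x \<in> U (Suc i)"
  using iter_comm_U[of s 1 x i] unfolding Suc_eq_plus1 by simp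

lemma iter_comm_U1: "s \<in> carrier G \<Longrightarrow> x \<in> U 1 \<Longrightarrow> iter_comm s i x \<in> U 1"
  using iter_comm_U[of s 1 x i] U_mono[of _ "i + 1" 1] by simp

text \<open>Modulo the radical, conjugation by \<open>s\<close> is 1 + D with D u = [u, s]. This is
  the binomial expansion of (1 + D)^k, written multiplicatively.\<close>

lemma b_conjg_pow:
  assumes s: "s \<in> carrier G" and v: "v \<in> U 1"
  shows "x \<in> U 1 \<Longrightarrow> b (conjg G x (s [^] k)) v = (\<Prod>i\<le>k. b (iter_comm s i x) v ^ (k choose i))"
proof (induction k arbitrary: x)
  case 0
  then show ?case by simp
next
  case (Suc k)
  let ?B = "\<lambda>i. b (iter_comm s i x) v"
  have xs: "comm G x s \<in> U 1" using U1_comm Suc.prems s by blast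
  have "conjg G x (s [^] Suc k) = conjg G (conjg G x s) (s [^] k)"
    using s Suc.prems by (simp only: conjg_conjg U_carrier nat_pow_closed nat_pow_Suc2)
  also have "\<dots> = conjg G x (s [^] k) \<otimes> conjg G (comm G x s) (s [^] k)"
    using s Suc.prems by (simp add: conjg_eq_comm[of x s] conjg_mult_left)
  finally have "b (conjg G x (s [^] Suc k)) v
      = b (conjg G x (s [^] k)) v * b (conjg G (comm G x s) (s [^] k)) v"
    using s v Suc.prems xs U1_conjg by (simp add: b_mult_left)
  also have "\<dots> = (\<Prod>i\<le>k. ?B i ^ (k choose i)) * (\<Prod>i\<le>k. ?B (Suc i) ^ (k choose i))"
    using Suc.IH[OF Suc.prems] Suc.IH[OF xs] by (simp add: iter_comm_shift del: iter_comm.simps)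
  also have "(\<Prod>i\<le>k. ?B i ^ (k choose i)) = (\<Prod>i\<le>Suc k. ?B i ^ (k choose i))"
    by (simp add: binomial_eq_0)
  also have "\<dots> = ?B 0 * (\<Prod>i\<le>k. ?B (Suc i) ^ (k choose Suc i))"
    by (subst prod.atMost_Suc_shift) (simp del: iter_comm.simps(2))
  also have "\<dots> * (\<Prod>i\<le>k. ?B (Suc i) ^ (k choose i))
      = ?B 0 * (\<Prod>i\<le>k. ?B (Suc i) ^ (Suc k choose Suc i))"
    by (simp add: prod.distrib power_add mult_ac del: iter_comm.simps(2))
  also have "\<dots> = (\<Prod>i\<le>Suc k. ?B i ^ (Suc k choose i))"
    using prod.atMost_Suc_shift[of "\<lambda>i. ?B i ^ (Suc k choose i)" k]
    by (simp del: iter_comm.simps(2) binomial_Suc_Suc prod.atMost_Suc)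
  finally show ?case .
qed

text \<open>As s^p lies in P_1, (1 + D)^p acts as the identity; the intermediate binomial
  coefficients are divisible by \<open>p\<close> and drop out, because values of \<open>b\<close>
  are p-th roots of unity. What remains is D^p = 0.\<close>

lemma b_iter_comm_p:
  assumes s: "s \<in> carrier G" and x: "x \<in> U 1" and v: "v \<in> U 1"
  shows "b (iter_comm s p x) v = 1"
proof -
  let ?B = "\<lambda>i. b (iter_comm s i x) v ^ (p choose i)"
  have mid: "?B i = 1" if "0 < i" "i < p" for i
  proof -
    have "p dvd (p choose i)" using that p0 by (intro dvd_choose_prime prime) auto
    then obtain q where q: "p choose i = p * q" by auto
    show ?thesis using b_power_p[OF iter_comm_U1[OF s x] v] by (simp add: q power_mult)
  qed
  obtain q where q: "p = Suc q" using p0 by (cases p) auto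
  have "(\<Prod>i\<le>p. ?B i) = (\<Prod>i\<le>q. ?B i) * ?B p" using q by simp
  also have "(\<Prod>i\<le>q. ?B i) = (\<Prod>i\<in>{0}. ?B i)"
    using mid q by (intro prod.mono_neutral_right) (auto simp del: binomial_Suc_Suc)
  finally have "b (conjg G x (s [^] p)) v = b x v * b (iter_comm s p x) v"
    using b_conjg_pow[OF s v x, of p] by simp
  moreover have "b (conjg G x (s [^] p)) v = b x v"
    using b_conjg_P1[OF x v pow_p_in_P1[OF s]] .
  ultimately show ?thesis using b_nonzero[OF x v] by simp
qed

text \<open>Up to level \<open>m\<close> the inclusion of [P_1, P_1] in \<open>U m\<close> makes
  \<open>comm_notin_U\<close> applicable, so each commutation with \<open>s\<close> descends exactly
  one step. Hence the iterated commutators generate the successive factors of the filtration up to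
  \<open>U m\<close>.\<close>

lemma iter_comm_notin:
  assumes s: "s \<in> carrier G" "s \<notin> U 1" and x: "x \<in> U 1" "x \<notin> U 2"
  shows "i + 2 \<le> m \<Longrightarrow> iter_comm s i x \<notin> U (i + 2)"
proof (induction i)
  case 0
  then show ?case using x by (simp add: numeral_2_eq_2)
next
  case (Suc i)
  have "comm G (iter_comm s i x) s \<notin> U (Suc i + 2)"
  proof (rule comm_notin_U[OF _ _ _ _ s])
    show "iter_comm s i x \<in> U (Suc i)" using iter_comm_U_Suc[OF s(1) x(1)] .
    show "iter_comm s i x \<notin> U (Suc (Suc i))" using Suc by simp
    fix v u assume vu: "v \<in> U (Suc i)" "u \<in> U 1"
    have "comm G v u \<in> U m" by (rule comm_P1[OF U_mono[OF vu(1)] vu(2)]) simp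
    then show "comm G v u \<in> U (Suc i + 2)" by (rule U_mono) (use Suc.prems in simp)
  qed (use Suc.prems m in simp_all)
  then show ?case by simp
qed

lemma b_trivial_if:
  assumes s: "s \<in> carrier G" "s \<notin> U 1" and x: "x \<in> U 1" "x \<notin> U 2"
    and small: "\<And>w. w \<in> U 2 \<Longrightarrow> b w v = 1" and xv: "b x v = 1" and u: "u \<in> U 1" and v: "v \<in> U 1"
  shows "b u v = 1"
proof -
  obtain j :: nat where "u \<otimes> inv (x [^] j) \<in> U 2"
    using U_gen[of 1 x u] x u n4 by (auto simp: numeral_2_eq_2 One_nat_def)
  then show ?thesis using b_left_coset[OF u x(1) v, of j] small[of "u \<otimes> inv (x [^] j)"] xv by simp
qed

text \<open>For \<open>p = 2\<close> the form \<open>b\<close> would be determined by \<open>b (T 0) (T 1)\<close>. Expanding \<open>[T 0 \<otimes> T 0, s]\<close> and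
  \<open>[T 0, s \<otimes> s]\<close> modulo \<open>U 4\<close> would then put \<open>T 2\<close> into \<open>U 4\<close>.\<close>
lemma prime_odd:
  assumes nontriv: "u0 \<in> U 1" "v0 \<in> U 1" "b u0 v0 \<noteq> 1"
  shows "p \<noteq> 2"
proof
  assume p2: "p = 2"
  obtain s where s: "s \<in> carrier G" "s \<notin> U 1" using P1_proper P1_carrier by (auto simp: U_1)
  obtain x where x: "x \<in> U 1" "x \<notin> U 2" using U_strict[of 1] n4 by (auto simp: numeral_2_eq_2)
  define T where "T i = iter_comm s i x" for i
  have T1: "T i \<in> U 1" for i unfolding T_def using iter_comm_U1 s x by blast
  have TU: "T i \<in> U (Suc i)" for i using iter_comm_U_Suc[OF s(1) x(1)] by (simp add: T_def)
  have Tn: "T i \<notin> U (Suc (Suc i))" if "i + 2 \<le> m" for i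
    using iter_comm_notin[OF s x that] by (simp add: T_def)
  have T2: "b (T (Suc (Suc i))) v = 1" if "v \<in> U 1" for i v
  proof -
    have "T (Suc (Suc i)) = iter_comm s 2 (T i)" by (simp add: T_def numeral_2_eq_2)
    then show ?thesis using b_iter_comm_p[OF s(1) T1 that] p2 by simp
  qed
  \<comment> \<open>Downwards from \<open>U m\<close>: for 3 <= j < m the term \<open>U j\<close> is
    generated by \<open>T (j - 1)\<close> and \<open>U (Suc j)\<close>, and \<open>T (j - 1)\<close>
    is in the radical because D^2 = 0 when p = 2.\<close>
  have deep: "b h v = 1" if v: "v \<in> U 1" and h: "h \<in> U j" "3 \<le> j" "j \<le> m" for h v j
    using h(3,2,1)
  proof (induction j arbitrary: h rule: inc_induct)
    case base
    then show ?case using b_Um(2)[OF v] by simp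
  next
    case (step j)
    obtain i where i: "j = Suc (Suc (Suc i))" using step.prems less_eqE[of 3 j] by (auto simp: numeral_3_eq_3)
    obtain a :: nat where a: "h \<otimes> inv (T (Suc (Suc i)) [^] a) \<in> U (Suc j)"
    proof -
      have "1 \<le> j" "j < n" "T (Suc (Suc i)) \<in> U j" "T (Suc (Suc i)) \<notin> U (Suc j)"
        using step.hyps m TU[of "Suc (Suc i)"] Tn[of "Suc (Suc i)"] i by simp_all
      from U_gen[OF this step.prems(2)] show thesis by (elim exE) (rule that)
    qed
    have "b (h \<otimes> inv (T (Suc (Suc i)) [^] a)) v = 1" using step.IH[OF _ a] step.prems by simp
    then show ?case
      using b_left_coset[OF _ T1 v] T2[OF v] step.prems U_mono[of h j 1] by simp
  qed
  have two: "b w v = b (T 1) v ^ j" if "v \<in> U 1" "w \<in> U 2" "w \<otimes> inv (T 1 [^] j) \<in> U 3" for w v and j :: nat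
    using b_left_coset[OF _ T1 that(1), of w 1 j] that U_mono[of w 2 1] deep[OF that(1) that(3)] m by simp
  have gen2: "\<exists>j::nat. w \<otimes> inv (T 1 [^] j) \<in> U 3" if "w \<in> U 2" for w
  proof -
    have "1 + 2 \<le> m" using m by simp
    then have "T 1 \<in> U 2" "T 1 \<notin> U (Suc 2)" using TU[of 1] Tn[of 1] unfolding Suc_1 by blast+
    from U_gen[OF _ _ this that] show ?thesis using n4 unfolding numeral_3_eq_3 numeral_2_eq_2 by simp
  qed
  have T01: "b (T 0) (T 1) \<noteq> 1"
  proof
    assume *: "b (T 0) (T 1) = 1"
    then have 10: "b (T 1) (T 0) = 1" using b_antisym[OF T1 T1, of 0 1] by simp
    have small0: "b w (T 0) = 1" if "w \<in> U 2" for w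
      using gen2[OF that] two[OF T1 that] 10 by auto
    have all0: "b u (T 0) = 1" if "u \<in> U 1" for u
      using b_trivial_if[OF s x small0 _ that T1] b_self[OF x(1)] by (simp add: T_def)
    have small1: "b w (T 1) = 1" if "w \<in> U 2" for w
      using gen2[OF that] two[OF T1 that] b_self[OF T1] by auto
    have all1: "b u (T 1) = 1" if "u \<in> U 1" for u
      using b_trivial_if[OF s x small1 _ that T1] * by (simp add: T_def)
    have small: "b w v = 1" if "w \<in> U 2" "v \<in> U 1" for w v
      using gen2[OF that(1)] two[OF that(2,1)] all1[OF that(2)] b_antisym[OF that(2) T1, of 1] by auto
    have "b u0 v0 = 1"
      using b_trivial_if[OF s x small _ nontriv(1,2)] all0[OF nontriv(2)] b_antisym[OF nontriv(2) T1, of 0] nontriv(2)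
      by (simp add: T_def)
    then show False using nontriv by simp
  qed
  have sq: "z \<otimes> z \<in> U (Suc i)" if z: "z \<in> U i" and i: "1 \<le> i" "i < n" for z i
  proof -
    obtain d where d: "is_char G p (U i) (U (Suc i)) d" using U_char[OF i] by blast
    have "d (z \<otimes> z) = 1" using is_charD(1)[OF d z z] is_charD(3)[OF d z] p2 by (simp add: power2_eq_square)
    then show ?thesis using is_charD(2)[OF d] subgroup.m_closed[OF U_subgroup z z] by simp
  qed
  \<comment> \<open>Modulo \<open>U 3\<close> this square is a power of \<open>T 1\<close>. Pairing
    with \<open>T 0\<close> shows the exponent to be even, since \<open>b\<close> is alternating and
    \<open>b (T 1) (T 0)\<close> is not 1; so the square already lies in \<open>U 3\<close>.\<close>
  let ?x2 = "T 0 \<otimes> T 0"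
  have x2: "?x2 \<in> U 2" using sq[OF T1, of 0] n4 by (simp add: numeral_2_eq_2)
  obtain a :: nat where a: "?x2 \<otimes> inv (T 1 [^] a) \<in> U 3" using gen2[OF x2] by blast
  have "b (T 1) (T 0) ^ a = 1"
    using two[OF T1 x2 a] b_mult_left[OF T1 T1 T1, of 0 0 0] b_self[OF T1, of 0] by simp
  moreover have "b (T 1) (T 0) \<noteq> 1" using T01 b_antisym[OF T1 T1, of 0 1] by auto
  ultimately have "p dvd a"
    using power_eq_one_prime[OF prime b_power_p[OF T1[of 1] T1[of 0]], of a] by blast
  then have "even a" using p2 by simp
  then obtain a' where a': "a = 2 * a'" by auto
  have "T 1 \<in> U 2" using TU[of 1] unfolding Suc_1 .
  then have T11: "T 1 \<otimes> T 1 \<in> U 3"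
    using sq[of "T 1" 2] n4 unfolding numeral_3_eq_3 numeral_2_eq_2 by simp
  have "T 1 [^] a = (T 1 \<otimes> T 1) [^] a'"
    using T1[of 1] a' nat_pow_pow[of "T 1" 2 a'] by (simp add: numeral_2_eq_2)
  moreover have "(T 1 \<otimes> T 1) [^] a' \<in> U 3"
    using T11 by (induction a') (auto intro: subgroup.one_closed[OF U_subgroup] subgroup.m_closed[OF U_subgroup])
  ultimately have T1a: "T 1 [^] a \<in> U 3" by simp
  have x2_eq: "?x2 = (?x2 \<otimes> inv (T 1 [^] a)) \<otimes> T 1 [^] a" using T1[of 0] T1[of 1] by (simp add: m_assoc)
  have x23: "?x2 \<in> U 3" by (subst x2_eq) (rule subgroup.m_closed[OF U_subgroup a T1a])
  have T_carr: "T i \<in> carrier G" for i by (rule U_carrier[OF T1])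
  have TS: "comm G (T 0) s = T 1" "comm G (T 1) s = T 2" by (simp_all add: T_def One_nat_def numeral_2_eq_2)
  interpret U4: normal "U 4" G by (rule U_normal)
  let ?e = "comm G (T 1) (T 0)"
  have e4: "?e \<in> U 4" using comm_P1[OF T1 T1] U_mono m(1) by blast
  have "Suc 3 = 4" by simp
  then have "comm G ?x2 s \<in> U 4" using comm_in_U[OF _ x23 s(1)] by simp
  moreover have "comm G ?x2 s = conjg G (T 1) (T 0) \<otimes> T 1"
    using T_carr s TS by (simp add: comm_mult_left)
  ultimately have "T 1 \<otimes> ?e \<otimes> T 1 \<in> U 4" using T_carr by (simp add: conjg_eq_comm)
  moreover have "T 1 \<otimes> ?e \<otimes> T 1 = (T 1 \<otimes> T 1) \<otimes> conjg G ?e (T 1)"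
    using T_carr by (simp add: conjg_def m_assoc)
  moreover have "conjg G ?e (T 1) \<in> U 4" using conjg_mem[OF U_normal e4 T_carr] .
  ultimately have "(T 1 \<otimes> T 1) \<otimes> conjg G ?e (T 1) \<otimes> inv (conjg G ?e (T 1)) \<in> U 4"
    by (simp only: U4.m_closed U4.m_inv_closed)
  then have T114: "T 1 \<otimes> T 1 \<in> U 4" using T_carr e4 by (simp add: m_assoc)
  have "s \<otimes> s \<in> U 1" using pow_p_in_P1[OF s(1)] p2 s by (simp add: numeral_2_eq_2)
  then have "comm G (T 0) (s \<otimes> s) \<in> U 4" using comm_P1[OF T1] U_mono m(1) by blast
  moreover have "comm G (T 0) (s \<otimes> s) = (T 1 \<otimes> T 1) \<otimes> T 2"
    using T_carr s TS by (simp add: comm_mult_right conjg_eq_comm m_assoc)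
  ultimately have "inv (T 1 \<otimes> T 1) \<otimes> ((T 1 \<otimes> T 1) \<otimes> T 2) \<in> U 4" using T114 by simp
  then have "T 2 \<in> U 4" using T_carr by simp
  moreover have "Suc (Suc 2) = 4" by simp
  ultimately show False using Tn[of 2] m by simp
qed

end

context maximal_class
begin

text \<open>Give \<open>T i\<close> weight i + 1 and \<open>y\<close> weight j + 1; a bound on
  commutators by the sum of weights improves from level \<open>l\<close> to l + 1. With
  \<open>z\<close> the conjugate of \<open>y\<close> by s^-1, conjugating [T i, z] by
  \<open>s\<close> gives [T i T (i+1), y], while [T i, z] and [T i, y] agree modulo
  \<open>U (Suc l)\<close> by induction. This leaves [T (i+1), y] trivial there.\<close>

lemma iter_comm_deeper:
  assumes T: "\<And>i. T (Suc i) = comm G (T i) s" "\<And>i. T i \<in> U (Suc i)" and s: "s \<in> carrier G"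
    and l: "2 \<le> l" "l < n"
    and hyp: "\<And>i j y. y \<in> U (Suc j) \<Longrightarrow> l \<le> i + j + 2 \<Longrightarrow> comm G (T i) y \<in> U l"
  shows "y \<in> U (Suc j) \<Longrightarrow> Suc l \<le> i + j + 2 \<Longrightarrow> comm G (T i) y \<in> U (Suc l)"
proof (induction i arbitrary: j y)
  case 0
  have "comm G y (T 0) \<in> U (Suc (Suc j))" using comm_in_U[OF _ 0(1)] T(2)[of 0] by simp
  from comm_mem_swap[OF U_subgroup U_carrier[OF 0(1)] U_carrier[OF T(2)[of 0]] this]
  have "comm G (T 0) y \<in> U (Suc (Suc j))" .
  then show ?case by (rule U_mono) (use 0(2) in simp)
next
  case (Suc i)
  have "1 \<le> l" using l by simp
  then obtain d where d: "is_char G p (U l) (U (Suc l)) d" using U_char l(2) by blast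
  have carr: "T i \<in> carrier G" "T (Suc i) \<in> carrier G" "y \<in> carrier G" "s \<in> carrier G"
    using U_carrier[OF T(2)] U_carrier[OF Suc.prems(1)] s by simp_all
  define z where "z = conjg G y (inv s)"
  have z: "z \<in> U (Suc j)" "z \<in> carrier G" "conjg G z s = y"
    using conjg_mem[OF U_normal Suc.prems(1), of "inv s"] carr by (simp_all add: z_def)
  define e where "e = comm G z s"
  have e: "e \<in> U (Suc (Suc j))" using comm_in_U[OF _ z(1) s] by (simp add: e_def)
  have eG: "e \<in> carrier G" using U_carrier[OF e] .
  have y: "y = z \<otimes> e" using conjg_eq_comm[OF z(2) s] z(3) by (simp add: e_def)
  have inv: "d (conjg G x g) = d x" if "x \<in> U l" "g \<in> carrier G" for x g
    using that l comm_in_U[of l x g] by (intro char_conj_invariant[OF d U_Suc_subset]) simp_all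
  have Tz: "comm G (T i) z \<in> U l" using hyp[OF z(1)] Suc.prems(2) by simp
  have Ty: "comm G (T i) y \<in> U l" using hyp[OF Suc.prems(1)] Suc.prems(2) by simp
  have Te: "comm G (T i) e \<in> U (Suc l)" using Suc.IH[OF e] Suc.prems(2) by simp
  have TSy: "comm G (T (Suc i)) y \<in> U l" using hyp[OF Suc.prems(1)] Suc.prems(2) by simp
  have mem: "conjg G (comm G (T i) z) e \<in> U l" "conjg G (comm G (T i) y) (T (Suc i)) \<in> U l"
    using conjg_mem[OF U_normal] Tz Ty eG carr by simp_all
  have "comm G (T i) y = comm G (T i) e \<otimes> conjg G (comm G (T i) z) e"
    unfolding y using carr z eG by (simp add: comm_mult_right)
  then have 1: "d (comm G (T i) y) = d (comm G (T i) z)"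
    using is_charD(1)[OF d _ mem(1), of "comm G (T i) e"] is_charD(2)[OF d, of "comm G (T i) e"]
      Te U_mono[OF Te, of l] inv[OF Tz eG] by simp
  have "conjg G (comm G (T i) z) s = comm G (T i \<otimes> T (Suc i)) y"
    using carr z by (simp only: conjg_comm conjg_eq_comm[of "T i"] T(1))
  also have "\<dots> = conjg G (comm G (T i) y) (T (Suc i)) \<otimes> comm G (T (Suc i)) y"
    using carr by (simp add: comm_mult_left)
  finally have "d (comm G (T i) z) = d (comm G (T i) y) * d (comm G (T (Suc i)) y)"
    using inv[OF Tz s] is_charD(1)[OF d mem(2) TSy] inv[OF Ty carr(2)] by simp
  then have "d (comm G (T (Suc i)) y) = 1" using 1 char_nonzero[OF d p0 Ty] by simp
  then show ?case using is_charD(2)[OF d TSy] by simp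
qed

end

context maximal_class_level
begin

text \<open>A fragment of Blackburn's theorem on two-step centralizers. If the claim failed, \<open>b\<close> would pair
  \<open>T i\<close> nontrivially with \<open>T (m - 2 - i)\<close> for all \<open>i\<close>. As \<open>s [^] p\<close> lies in \<open>P\<^sub>1\<close>, the \<open>p\<close>-fold commutators with
  \<open>s\<close> lie in the radical of \<open>b\<close>, which forces \<open>m \<le> p + 1\<close>; one level deeper, the Jacobi-type relation
  \<open>D i = g i * g (Suc i)\<close> then makes \<open>p\<close> divide the number \<open>k < p\<close> with \<open>m = 2 * k + 1\<close>.\<close>
theorem comm_P1_penultimate:
  assumes mn: "Suc m < n" and u: "u \<in> U 1" and v: "v \<in> U (m - 1)"
  shows "b u v = 1"
proof (rule ccontr)
  assume uv: "b u v \<noteq> 1"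
  obtain s where s: "s \<in> carrier G" "s \<notin> U 1" using P1_proper P1_carrier by (auto simp: U_1)
  obtain x where x: "x \<in> U 1" "x \<notin> U 2" using U_strict[of 1] n4 by (auto simp: numeral_2_eq_2 One_nat_def)
  define T where "T i = iter_comm s i x" for i
  have T1: "T i \<in> U 1" for i unfolding T_def by (rule iter_comm_U1[OF s(1) x(1)])
  have TG: "T i \<in> carrier G" for i by (rule U_carrier[OF T1])
  have TU: "T i \<in> U (Suc i)" for i unfolding T_def by (rule iter_comm_U_Suc[OF s(1) x(1)])
  have Tn: "T i \<notin> U (i + 2)" if "i + 2 \<le> m" for i unfolding T_def by (rule iter_comm_notin[OF s x that])
  have TS: "T (Suc i) = comm G (T i) s" for i by (simp add: T_def)
  have v1: "v \<in> U 1" using U_mono[OF v] m by simp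
  have level1: "comm G (T i) y \<in> U (Suc m)" if "y \<in> U (Suc j)" "Suc m \<le> i + j + 2" for i j y
  proof (rule iter_comm_deeper[OF TS TU s(1) _ m(2) _ that])
    fix i j y assume "y \<in> U (Suc j)"
    then have "y \<in> U 1" by (rule U_mono) simp
    then show "comm G (T i) y \<in> U m" using comm_P1 T1 by blast
  qed (use m in simp)
  have level2: "comm G (T i) y \<in> U (Suc (Suc m))" if "y \<in> U (Suc j)" "Suc (Suc m) \<le> i + j + 2" for i j y
    by (rule iter_comm_deeper[OF TS TU s(1) _ mn level1 that]) (use m in simp_all)
  have bT: "b (T i) y = 1" if "y \<in> U (Suc j)" "Suc m \<le> i + j + 2" for i j y
  proof -
    have "y \<in> U 1" using U_mono[OF that(1)] by simp
    then show ?thesis using b_eq_one_iff[OF T1] level1[OF that] by blast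
  qed
  \<comment> \<open>The weights of the two entries add up to \<open>m\<close>, the largest sum on
    which \<open>b\<close> can be nontrivial.\<close>
  define \<beta> where "\<beta> i = b (T i) (T (m - 2 - i))" for i
  \<comment> \<open>By invariance of \<open>b\<close> under conjugation by \<open>s\<close>: the
    term with neither entry advanced cancels, and the one with both advanced has weight m +
    1.\<close>
  have \<beta>_step: "\<beta> i * \<beta> (Suc i) = 1" if i: "Suc i \<le> m - 2" for i
  proof -
    define j where "j = m - 2 - Suc i"
    have j: "m - 2 - i = Suc j" "m - 2 - Suc i = j" "i + j + 3 = m" using i m by (simp_all add: j_def)
    have "b (T i) (T j) = b (conjg G (T i) s) (conjg G (T j) s)"
      using b_conjg[OF T1 T1 s(1)] by simp
    also have "\<dots> = b (T i \<otimes> T (Suc i)) (T j \<otimes> T (Suc j))"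
      using TG s by (simp add: conjg_eq_comm TS)
    also have "\<dots> = b (T i) (T j) * b (T i) (T (Suc j)) * (b (T (Suc i)) (T j) * b (T (Suc i)) (T (Suc j)))"
      using T1 by (simp add: b_mult_left b_mult_right U1_mult)
    also have "b (T (Suc i)) (T (Suc j)) = 1" using bT[OF TU[of "Suc j"], of "Suc i"] j by simp
    finally show ?thesis unfolding \<beta>_def j using b_nonzero[OF T1 T1, of i j] by simp
  qed
  \<comment> \<open>Otherwise \<open>T (m - 2)\<close>, which generates \<open>U (m - 1)\<close>
    modulo \<open>U m\<close>, would lie in the radical, against the choice of \<open>u\<close> and
    \<open>v\<close>.\<close>
  have \<beta>0: "\<beta> 0 \<noteq> 1"
  proof
    assume *: "\<beta> 0 = 1"
    have Tm: "T (m - 2) \<in> U (m - 1)" "T (m - 2) \<notin> U (Suc (m - 1))"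
    proof -
      have "Suc (m - 2) = m - 1" "m - 2 + 2 = Suc (m - 1)" using m by simp_all
      moreover have "m - 2 + 2 \<le> m" using m by simp
      ultimately show "T (m - 2) \<in> U (m - 1)" "T (m - 2) \<notin> U (Suc (m - 1))"
        using TU[of "m - 2"] Tn[of "m - 2"] by (simp_all only: not_False_eq_True simp_thms)
    qed
    have small: "b w (T (m - 2)) = 1" if w: "w \<in> U 2" for w
    proof -
      have "w \<in> U (Suc 1)" using w unfolding Suc_1 .
      then have "b (T (m - 2)) w = 1" by (rule bT) (use m in simp)
      then show ?thesis using b_antisym[OF T1, of w] U_mono[OF w] by simp
    qed
    have bu: "b u (T (m - 2)) = 1"
      by (rule b_trivial_if[OF s x small _ u T1]) (use * in \<open>simp_all add: \<beta>_def T_def\<close>)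
    have "1 \<le> m - 1" "m - 1 < n" using m by simp_all
    from U_gen[OF this Tm v] obtain j :: nat where "v \<otimes> inv (T (m - 2) [^] j) \<in> U (Suc (m - 1))"
      by blast
    then have "v \<otimes> inv (T (m - 2) [^] j) \<in> U m" using m by simp
    then have "b u (v \<otimes> inv (T (m - 2) [^] j)) = 1" by (rule b_Um(1)[OF u])
    then have "b u v = 1" using b_right_coset[OF v1 T1 u] bu by simp
    then show False using uv by simp
  qed
  have \<beta>: "i \<le> m - 2 \<Longrightarrow> \<beta> i \<noteq> 1" for i
  proof (induction i)
    case (Suc i)
    then show ?case using \<beta>_step[of i] by auto
  qed (use \<beta>0 in simp)
  \<comment> \<open>For even \<open>m\<close> the middle value would pair an element with
    itself.\<close>
  have odd: "odd m"
  proof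
    assume "even m"
    then obtain k where k: "m = 2 * k" by blast
    have "m - 2 - (k - 1) = k - 1" using k m by simp
    then have "\<beta> (k - 1) = 1" using b_self[OF T1] by (simp add: \<beta>_def)
    then show False using \<beta>[of "k - 1"] k m by simp
  qed
  have mp: "m \<le> p + 1"
  proof (rule ccontr)
    assume "\<not> m \<le> p + 1"
    moreover have "T p = iter_comm s p x" by (simp add: T_def)
    ultimately show False
      using \<beta>[of p] b_iter_comm_p[OF s(1) x(1) T1, of "m - 2 - p"] by (simp add: \<beta>_def)
  qed
  have m5: "5 \<le> m" using odd m by (cases "m = 4") auto
  let ?N = "U (Suc (Suc m))"
  interpret N: normal ?N G by (rule U_normal)
  have comm_Um_U2: "comm G a y \<in> ?N" "comm G y a \<in> ?N" if "a \<in> U m" "y \<in> U 2" for a y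
  proof -
    show "comm G a y \<in> ?N" using comm_U_P2[OF _ that] m by simp
    then show "comm G y a \<in> ?N" using that comm_mem_swap[OF U_subgroup] by simp
  qed
  have NconjN: "conjg G a g \<in> ?N" if "a \<in> ?N" "g \<in> carrier G" for a g
    using conjg_mem[OF U_normal that] .
  have P1_centr: "comm G a w \<in> ?N" if a: "a \<in> U m" and w: "w \<in> U 1" for a w
  proof -
    \<comment> \<open>Since \<open>\<beta> 1\<close> is not 1, \<open>q\<close> generates
      \<open>U m\<close> modulo \<open>U (Suc m)\<close>, and both its entries lie in
      \<open>U 2\<close> as m >= 5. Conjugation by \<open>w\<close> changes the entries by elements
      of \<open>U m\<close>, and [U m, U 2] lies in \<open>U (m + 2)\<close>.\<close>
    define q where "q = comm G (T 1) (T (m - 3))"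
    have wG: "w \<in> carrier G" using w by simp
    have q: "q \<in> U m" unfolding q_def by (rule comm_P1[OF T1 T1])
    have qG: "q \<in> carrier G" using q by simp
    have "m - 2 - 1 = m - 3" by simp
    then have "c q \<noteq> 1" using \<beta>[of 1] m by (simp add: \<beta>_def b_def q_def)
    then have qn: "q \<notin> U (Suc m)" using is_charD(2)[OF c q] by simp
    have T2: "T 1 \<in> U 2" "T (m - 3) \<in> U 2"
    proof -
      show "T 1 \<in> U 2" using TU[of 1] unfolding Suc_1 .
      show "T (m - 3) \<in> U 2" by (rule U_mono[OF TU]) (use m5 in simp)
    qed
    have qw: "comm G q w \<in> ?N"
    proof -
      define f where "f = comm G (T 1) w"
      define g where "g = comm G (T (m - 3)) w"
      have fg: "f \<in> U m" "g \<in> U m" unfolding f_def g_def by (rule comm_P1[OF T1 w])+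
      have fg2: "f \<in> U 2" "g \<in> U 2" using U_mono[OF fg(1), of 2] U_mono[OF fg(2), of 2] m by simp_all
      have fgG: "f \<in> carrier G" "g \<in> carrier G" using fg by simp_all
      define y where "y = T (m - 3) \<otimes> g"
      have y2: "y \<in> U 2" unfolding y_def by (rule subgroup.m_closed[OF U_subgroup T2(2) fg2(2)])
      have yG: "y \<in> carrier G" using y2 by simp
      define k where "k = comm G (T 1) y"
      have kG: "k \<in> carrier G" using TG yG by (simp add: k_def)
      have k: "k = comm G (T 1) g \<otimes> (q \<otimes> comm G q g)"
        using TG fgG qG by (simp add: k_def y_def comm_mult_right q_def flip: conjg_eq_comm)
      have km: "k \<in> U m" unfolding k_def by (rule comm_P1[OF T1 U_mono[OF y2]]) simp
      have "conjg G q w = comm G (T 1 \<otimes> f) y"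
        using TG wG by (simp add: q_def conjg_comm f_def g_def y_def flip: conjg_eq_comm)
      also have "\<dots> = (k \<otimes> comm G k f) \<otimes> comm G f y"
        using TG fgG yG kG by (simp add: comm_mult_left k_def flip: conjg_eq_comm)
      finally have qwk: "conjg G q w = (k \<otimes> comm G k f) \<otimes> comm G f y" .
      have "comm G q w = inv q \<otimes> conjg G q w" using qG wG by (simp add: comm_def conjg_def m_assoc)
      also have "\<dots> = (inv q \<otimes> k) \<otimes> comm G k f \<otimes> comm G f y"
        unfolding qwk using qG kG fgG yG by (simp add: m_assoc)
      also have "inv q \<otimes> k = conjg G (comm G (T 1) g) q \<otimes> comm G q g"
        unfolding k using qG fgG TG by (simp add: conjg_def m_assoc)
      finally have eq: "comm G q w = conjg G (comm G (T 1) g) q \<otimes> comm G q g \<otimes> comm G k f \<otimes> comm G f y" .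
      show ?thesis unfolding eq
        using comm_Um_U2(2)[OF fg(2) T2(1)] comm_Um_U2(1)[OF q fg2(2)] comm_Um_U2(1)[OF km fg2(1)]
          comm_Um_U2(1)[OF fg(1) y2] NconjN qG
        by (intro N.m_closed) simp_all
    qed
    have "1 \<le> m" using m by simp
    from U_gen[OF this m(2) q qn a] obtain j :: nat where j: "a \<otimes> inv (q [^] j) \<in> U (Suc m)" by blast
    have "comm G z w \<in> ?N" if "z \<in> U (Suc m)" for z using comm_in_U[OF _ that wG] by simp
    from comm_mem_cosets[OF U_normal wG U_subgroup qG qw this j U_carrier[OF a]] show ?thesis .
  qed
  have "1 \<le> Suc m" by simp
  then obtain d where d: "is_char G p (U (Suc m)) ?N d" using U_char mn by blast
  have dN: "d z = 1" if "z \<in> ?N" for z using is_charD(2)[OF d U_mono[OF that]] that by simp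
  have d_conj: "d (conjg G z g) = d z" if "z \<in> U (Suc m)" "g \<in> carrier G" for z g
    using that comm_in_U[of "Suc m" z g] by (intro char_conj_invariant[OF d U_Suc_subset]) simp_all
  have d1: "d (z \<otimes> e) = d z" "d (e \<otimes> z) = d z" if "z \<in> U (Suc m)" "e \<in> ?N" for z e
    using is_charD(1)[OF d that(1) U_mono[OF that(2)]] is_charD(1)[OF d U_mono[OF that(2)] that(1)] dN[OF that(2)]
    by simp_all
  \<comment> \<open>\<open>h i\<close> lifts \<open>\<beta> i\<close> from a root of unity to an
    element of \<open>G\<close>; the relations for \<open>\<beta>\<close> are now studied one level
    deeper, with \<open>d\<close> in place of \<open>c\<close>.\<close>
  define h where "h i = comm G (T i) (T (m - 2 - i))" for i
  have h: "h i \<in> U m" for i unfolding h_def by (rule comm_P1[OF T1 T1])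
  have hG: "h i \<in> carrier G" for i by (rule U_carrier[OF h])
  have hs: "comm G (h i) s \<in> U (Suc m)" for i using comm_in_U[OF _ h s(1)] m by simp
  define D where "D i = d (comm G (h i) s)" for i
  define g where "g i = d (comm G (T i) (T (m - 1 - i)))" for i
  have gU: "comm G (T i) (T (m - 1 - i)) \<in> U (Suc m)" if "i \<le> m - 1" for i
    by (rule level1[OF TU]) (use that m in simp)
  \<comment> \<open>The Leibniz rule for [[T i, T j], s] modulo \<open>U (m + 2)\<close>, with one
    factor for each entry advanced. The corrections vanish because P_1 centralizes
    \<open>U m\<close> there and weights above m + 1 are trivial.\<close>
  have D_g: "D i = g i * g (Suc i)" if i: "i \<le> m - 2" for i
  proof -
    define j where "j = m - 2 - i"
    have j: "m - 1 - i = Suc j" "m - 1 - Suc i = j" "i + j + 2 = m" using i m by (simp_all add: j_def)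
    let ?x = "T i" and ?x' = "T (Suc i)" and ?y = "T j" and ?y' = "T (Suc j)"
    define A where "A = comm G ?x ?y'"
    define B where "B = comm G ?x' ?y"
    define e1 where "e1 = comm G (h i) ?y'"
    define e2 where "e2 = comm G ?x' ?y'"
    have A: "A \<in> U (Suc m)" unfolding A_def by (rule level1[OF TU]) (use j in simp)
    have B: "B \<in> U (Suc m)" unfolding B_def by (rule level1[OF TU]) (use j in simp)
    have e1: "e1 \<in> ?N" unfolding e1_def by (rule P1_centr[OF h T1])
    have e2: "e2 \<in> ?N" unfolding e2_def by (rule level2[OF TU]) (use j in simp)
    have e3: "comm G (h i) ?x' \<in> ?N" by (rule P1_centr[OF h T1])
    have carr: "A \<in> carrier G" "B \<in> carrier G" "e1 \<in> carrier G" "e2 \<in> carrier G"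
      using A B e1 e2 by simp_all
    have hi: "h i = comm G ?x ?y" by (simp add: h_def j_def)
    have 1: "comm G ?x (?y \<otimes> ?y') = A \<otimes> (h i \<otimes> e1)"
      using TG hG by (simp add: comm_mult_right A_def e1_def hi flip: conjg_eq_comm)
    have 2: "comm G ?x' (?y \<otimes> ?y') = e2 \<otimes> conjg G B ?y'"
      using TG by (simp add: comm_mult_right B_def e2_def)
    have 3: "conjg G (A \<otimes> (h i \<otimes> e1)) ?x' = conjg G A ?x' \<otimes> ((h i \<otimes> comm G (h i) ?x') \<otimes> conjg G e1 ?x')"
      using TG hG carr by (simp add: conjg_mult_left conjg_eq_comm[of "h i"])
    have "conjg G (h i) s = comm G (?x \<otimes> ?x') (?y \<otimes> ?y')"
      using TG s by (simp add: hi conjg_comm TS flip: conjg_eq_comm)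
    also have "\<dots> = conjg G A ?x' \<otimes> ((h i \<otimes> comm G (h i) ?x') \<otimes> conjg G e1 ?x') \<otimes> (e2 \<otimes> conjg G B ?y')"
      using TG hG carr by (simp only: comm_mult_left m_closed 1 2 3)
    finally have hc: "conjg G (h i) s = conjg G A ?x' \<otimes> ((h i \<otimes> comm G (h i) ?x') \<otimes> conjg G e1 ?x') \<otimes> (e2 \<otimes> conjg G B ?y')" .
    have "comm G (h i) s = inv (h i) \<otimes> conjg G (h i) s" using hG s by (simp add: comm_def conjg_def m_assoc)
    also have "\<dots> = inv (h i) \<otimes> (conjg G A ?x' \<otimes> ((h i \<otimes> comm G (h i) ?x') \<otimes> conjg G e1 ?x') \<otimes> (e2 \<otimes> conjg G B ?y'))"
      unfolding hc ..
    also have "\<dots> = conjg G (conjg G A ?x') (h i) \<otimes> (comm G (h i) ?x' \<otimes> (conjg G e1 ?x' \<otimes> (e2 \<otimes> conjg G B ?y')))"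
      using TG hG carr by (simp add: conjg_def[of _ "conjg G A ?x'" "h i"] m_assoc)
    finally have eq: "comm G (h i) s = conjg G (conjg G A ?x') (h i) \<otimes> (comm G (h i) ?x' \<otimes> (conjg G e1 ?x' \<otimes> (e2 \<otimes> conjg G B ?y')))" .
    have AU: "conjg G A ?x' \<in> U (Suc m)" "conjg G (conjg G A ?x') (h i) \<in> U (Suc m)"
      and BU: "conjg G B ?y' \<in> U (Suc m)"
      using conjg_mem[OF U_normal] A B TG hG by simp_all
    have e1': "conjg G e1 ?x' \<in> ?N" by (rule NconjN[OF e1 TG])
    note mc = subgroup.m_closed[OF U_subgroup]
    have NU: "z \<in> U (Suc m)" if "z \<in> ?N" for z using U_mono[OF that] by simp
    have m1: "e2 \<otimes> conjg G B ?y' \<in> U (Suc m)" by (rule mc[OF NU[OF e2] BU])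
    have m2: "conjg G e1 ?x' \<otimes> (e2 \<otimes> conjg G B ?y') \<in> U (Suc m)" by (rule mc[OF NU[OF e1'] m1])
    have m3: "comm G (h i) ?x' \<otimes> (conjg G e1 ?x' \<otimes> (e2 \<otimes> conjg G B ?y')) \<in> U (Suc m)" by (rule mc[OF NU[OF e3] m2])
    have "D i = d A * d B"
      unfolding D_def eq is_charD(1)[OF d AU(2) m3]
      by (simp add: d1(2)[OF m2 e3] d1(2)[OF m1 e1'] d1(2)[OF BU e2] d_conj A B AU TG hG)
    then show ?thesis unfolding g_def j A_def B_def .
  qed
  have D_step: "D i * D (Suc i) = 1" if i: "Suc i \<le> m - 2" for i
  proof -
    have "c (h i \<otimes> h (Suc i)) = 1"
      using \<beta>_step[OF i] is_charD(1)[OF c h h] by (simp add: \<beta>_def b_def h_def)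
    then have "h i \<otimes> h (Suc i) \<in> U (Suc m)"
      using is_charD(2)[OF c subgroup.m_closed[OF U_subgroup h h]] by simp
    then have "comm G (h i \<otimes> h (Suc i)) s \<in> ?N" using comm_in_U[of "Suc m"] s by simp
    then have "1 = d (comm G (h i \<otimes> h (Suc i)) s)" using dN by simp
    also have "\<dots> = d (conjg G (comm G (h i) s) (h (Suc i)) \<otimes> comm G (h (Suc i)) s)"
      using hG s by (simp add: comm_mult_left)
    also have "\<dots> = D i * D (Suc i)"
      using is_charD(1)[OF d conjg_mem[OF U_normal hs hG] hs] d_conj[OF hs hG] by (simp add: D_def)
    finally show ?thesis by simp
  qed
  have D0: "D 0 \<noteq> 1"
  proof
    assume "D 0 = 1"
    then have "comm G (h 0) s \<in> U (m + 2)" using is_charD(2)[OF d hs, of 0] by (simp add: D_def)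
    moreover have "h 0 \<notin> U (Suc m)"
      using \<beta>0 is_charD(2)[OF c h, of 0] by (simp add: \<beta>_def b_def h_def)
    moreover have "1 \<le> m" using m by simp
    ultimately show False using comm_notin_U[OF _ mn h _ s, of 0] P1_centr by simp
  qed
  have D: "i \<le> m - 2 \<Longrightarrow> D i \<noteq> 1" for i
  proof (induction i)
    case (Suc i)
    then show ?case using D_step[of i] by auto
  qed (use D0 in simp)
  have "g 0 = 1"
  proof -
    have "T (m - 1) \<in> U m" using TU[of "m - 1"] m by simp
    then have "comm G (T 0) (T (m - 1)) \<in> ?N"
      using comm_mem_swap[OF U_subgroup TG TG P1_centr[OF _ T1]] by blast
    then show ?thesis using dN by (simp add: g_def)
  qed
  \<comment> \<open>\<open>D\<close> alternates between a value and its inverse, so in the recursion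
    g (i+1) = D i / g i the factors accumulate instead of cancelling.\<close>
  have g_Suc: "i \<le> m - 2 \<Longrightarrow> g (Suc i) = D i ^ Suc i" for i
  proof (induction i)
    case 0
    then show ?case using D_g[of 0] \<open>g 0 = 1\<close> by simp
  next
    case (Suc i)
    have "D (Suc i) = D i ^ Suc i * g (Suc (Suc i))" using D_g[OF Suc.prems] Suc by simp
    moreover have "D i = inverse (D (Suc i))" using D_step[OF Suc.prems] by (metis inverse_unique mult.commute)
    moreover have "D (Suc i) \<noteq> 0" using D_step[OF Suc.prems] by auto
    ultimately show ?case by (simp add: field_simps)
  qed
  obtain k where k: "m = 2 * k + 1" using odd by (elim oddE)
  then have k2: "2 \<le> k" using m5 by simp
  \<comment> \<open>At the middle index the two entries of \<open>g k\<close> coincide, so the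
    accumulated power is 1.\<close>
  have "m - 1 - k = k" using k by simp
  then have "g k = 1" using T1[of k] char_one[OF U_subgroup d p0] TG by (simp add: g_def)
  moreover have "g k = D (k - 1) ^ k" using g_Suc[of "k - 1"] k k2 by simp
  ultimately have "D (k - 1) ^ k = 1" by simp
  moreover have "D (k - 1) ^ p = 1" unfolding D_def by (rule is_charD(3)[OF d hs])
  moreover have "\<not> p dvd k" using mp k k2 by (auto dest: dvd_imp_le)
  ultimately have "D (k - 1) = 1" using power_eq_one_prime[OF prime] by blast
  then show False using D[of "k - 1"] k by simp
qed

end

section \<open>Necessity of the commutator condition\<close>

locale maximal_class_extension = maximal_class_level +
  fixes s
  assumes s: "s \<in> carrier G" "s \<notin> U 1"
    and penult: "u \<in> U 1 \<Longrightarrow> v \<in> U (m - 1) \<Longrightarrow> b u v = 1"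
begin

lemma Um_U1: "z \<in> U m \<Longrightarrow> z \<in> U 1"
  using U_mono[of z m 1] m by simp

text \<open>An element of \<open>U k\<close> outside \<open>U (Suc k)\<close> cannot commute with
  \<open>x\<close>, since commutation with \<open>x\<close> descends only one step. For this P_1
  must centralize U k / U (k + 2): if k + 2 <= m because [P_1, P_1] lies in \<open>U m\<close>, and
  for k = m - 1 by \<open>penult\<close>.\<close>

lemma centralizer_small:
  assumes x: "x \<in> carrier G" "x \<notin> U 1" and z: "z \<in> U 1" and comm: "comm G z x = \<one>"
  shows "z \<in> U m"
proof -
  have "1 \<le> m" using m by simp
  then show ?thesis
  proof (induction m rule: dec_induct)
    case (step k)
    have "comm G v u \<in> U (k + 2)" if v: "v \<in> U k" and u: "u \<in> U 1" for v u
    proof -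
      have v1: "v \<in> U 1" using U_mono[OF v] step.hyps by simp
      show ?thesis
      proof (cases "k + 2 \<le> m")
        case True
        then show ?thesis using U_mono[OF comm_P1[OF v1 u]] by simp
      next
        case False
        then have k: "k = m - 1" "k + 2 = Suc m" using step.hyps by simp_all
        have "b v u = 1" using b_antisym[OF u v1] penult[OF u, of v] v k by simp
        then show ?thesis using b_eq_one_iff[OF v1 u] k by simp
      qed
    qed
    then show ?case
      using comm_notin_U[OF _ _ step.IH _ x] step.hyps m comm subgroup.one_closed[OF U_subgroup] by auto
  qed (rule z)
qed

text \<open>The P_1-component of \<open>y\<close> after a power of \<open>s\<close>. The least
  exponent is a normalization making \<open>f\<close> the identity on P_1; another admissible
  exponent would change \<open>f y\<close> only by a power of \<open>s\<close> in P_1, which lies in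
  \<open>U m\<close>.\<close>

definition f :: "'a \<Rightarrow> 'a" where
  "f y = inv (s [^] (LEAST j::nat. inv (s [^] j) \<otimes> y \<in> U 1)) \<otimes> y"

lemma f_ex:
  assumes y: "y \<in> carrier G"
  shows "\<exists>j::nat. f y = inv (s [^] j) \<otimes> y \<and> f y \<in> U 1"
proof -
  obtain j :: nat where j: "y \<otimes> inv (s [^] j) \<in> U 1" using G_gen[OF s y] by blast
  have "conjg G (y \<otimes> inv (s [^] j)) (s [^] j) \<in> U 1" by (rule U1_conjg[OF j]) (use s in simp)
  moreover have "conjg G (y \<otimes> inv (s [^] j)) (s [^] j) = inv (s [^] j) \<otimes> y"
    using s y by (simp add: conjg_def m_assoc)
  ultimately have "inv (s [^] j) \<otimes> y \<in> U 1" by simp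
  then have "f y \<in> U 1" unfolding f_def by (rule LeastI)
  then show ?thesis unfolding f_def by blast
qed

lemma f_U1: "y \<in> carrier G \<Longrightarrow> f y \<in> U 1" using f_ex by blast

lemma f_carrier [simp]: "y \<in> carrier G \<Longrightarrow> f y \<in> carrier G" using U_carrier[OF f_U1] .

lemma f_id:
  assumes "u \<in> U 1"
  shows "f u = u"
proof -
  have "(LEAST j::nat. inv (s [^] j) \<otimes> u \<in> U 1) = 0" using assms by (intro Least_eq_0) simp
  then show ?thesis using assms by (simp add: f_def)
qed

text \<open>Modulo the radical of \<open>b\<close>, the map \<open>f\<close> is a crossed homomorphism.\<close>
lemma b_f_mult:
  assumes x: "x \<in> carrier G" and y: "y \<in> carrier G" and v: "v \<in> U 1"
  shows "b (f (x \<otimes> y)) v = b (conjg G (f x) y) v * b (f y) v"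
proof -
  obtain i :: nat where i: "f x = inv (s [^] i) \<otimes> x" using f_ex[OF x] by blast
  obtain j :: nat where j: "f y = inv (s [^] j) \<otimes> y" using f_ex[OF y] by blast
  obtain k :: nat where k: "f (x \<otimes> y) = inv (s [^] k) \<otimes> (x \<otimes> y)" using f_ex[of "x \<otimes> y"] x y by blast
  have sG: "s [^] l \<in> carrier G" for l :: nat using s by simp
  have xy: "x = s [^] i \<otimes> f x" "y = s [^] j \<otimes> f y" using x y s by (simp_all add: i j)
  define w where "w = conjg G (f x) (s [^] j) \<otimes> f y"
  \<comment> \<open>The power of \<open>s\<close> by which the exponents fail to add up. It lies in
    P_1 and commutes with \<open>s\<close>, hence belongs to \<open>U m\<close>.\<close>
  define t where "t = inv (s [^] k) \<otimes> s [^] (i + j)"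
  have w1: "w \<in> U 1" unfolding w_def by (rule U1_mult[OF U1_conjg[OF f_U1[OF x] sG] f_U1[OF y]])
  have wG: "w \<in> carrier G" using w1 by simp
  have tG: "t \<in> carrier G" using s by (simp add: t_def)
  have "s [^] (i + j) \<otimes> w = (s [^] i \<otimes> f x) \<otimes> (s [^] j \<otimes> f y)"
    using x y s sG by (simp add: w_def conjg_def m_assoc flip: nat_pow_mult)
  then have "s [^] (i + j) \<otimes> w = x \<otimes> y" by (simp only: flip: xy)
  then have fxy: "f (x \<otimes> y) = t \<otimes> w" using k wG s by (simp add: t_def m_assoc)
  then have "t = f (x \<otimes> y) \<otimes> inv w" using tG wG by (simp add: m_assoc)
  then have t1: "t \<in> U 1" using U1_mult U1_inv f_U1 w1 x y by simp
  have "comm G t s = \<one>"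
  proof -
    have "s \<otimes> s [^] l = s [^] l \<otimes> s" for l :: nat using s nat_pow_Suc2[of s l] by simp
    then have "s [^] l \<in> centralizer_mod {\<one>} {s}" for l :: nat
      using s sG by (simp add: centralizer_mod_def comm_eq_one_iff)
    moreover have "{\<one>} \<lhd> G" using U_normal[of n] U_trivial[of n] by simp
    then have S: "subgroup (centralizer_mod {\<one>} {s}) G" using s by (intro subgroup_centralizer_mod) simp_all
    ultimately have "t \<in> centralizer_mod {\<one>} {s}"
      unfolding t_def by (intro subgroup.m_closed[OF S] subgroup.m_inv_closed[OF S])
    then show ?thesis using comm_eq_one_sym[of s t] s tG by (simp add: centralizer_mod_def)
  qed
  then have "t \<in> U m" by (rule centralizer_small[OF s t1])
  then have "b (f (x \<otimes> y)) v = b w v"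
    using fxy b_mult_left[OF t1 w1 v] b_Um(2)[OF v] by simp
  also have "\<dots> = b (conjg G (f x) (s [^] j)) v * b (f y) v"
    unfolding w_def using U1_conjg f_U1 x y sG v by (intro b_mult_left) simp_all
  \<comment> \<open>As y = s^j f(y) with \<open>f y\<close> in P_1, conjugation by \<open>y\<close>
    and by s^j agree for the form.\<close>
  also have "b (conjg G (f x) (s [^] j)) v = b (conjg G (conjg G (f x) (s [^] j)) (f y)) v"
    using U1_conjg f_U1 x y sG v by (simp add: b_conjg_P1)
  also have "conjg G (conjg G (f x) (s [^] j)) (f y) = conjg G (f x) y"
    using x y sG xy(2) by (simp add: conjg_conjg)
  finally show ?thesis .
qed

lemma b_conjg_f_mult:
  assumes x: "x \<in> carrier G" and y: "y \<in> carrier G" and z: "z \<in> carrier G" and v: "v \<in> U 1"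
  shows "b (conjg G (f (x \<otimes> y)) z) v = b (conjg G (f x) (y \<otimes> z)) v * b (conjg G (f y) z) v"
proof -
  let ?v = "conjg G v (inv z)"
  have v1: "?v \<in> U 1" using U1_conjg v z by simp
  have vG: "v \<in> carrier G" using v by simp
  have *: "b (conjg G u z) v = b u ?v" if "u \<in> U 1" for u
    using b_conjg[OF that v1 z] vG z by simp
  have "b (conjg G (f (x \<otimes> y)) z) v = b (conjg G (f x) y) ?v * b (f y) ?v"
    using x y f_U1 by (simp add: * b_f_mult v1)
  also have "\<dots> = b (conjg G (conjg G (f x) y) z) v * b (conjg G (f y) z) v"
    using x y f_U1 U1_conjg by (simp add: *)
  finally show ?thesis using x y z by (simp add: conjg_conjg)
qed

section \<open>The 2-cocycle and its central extension\<close>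

definition \<beta> :: "'a \<Rightarrow> 'a \<Rightarrow> complex" where "\<beta> x y = b (conjg G (f x) y) (f y)"

lemma \<beta>_nonzero: "x \<in> carrier G \<Longrightarrow> y \<in> carrier G \<Longrightarrow> \<beta> x y \<noteq> 0"
  unfolding \<beta>_def using b_nonzero U1_conjg f_U1 by blast

text \<open>With X the conjugate of \<open>f x\<close> by y z, both sides equal \<beta>(x, y)
  \<beta>(y, z) b(X, f z): the crossed homomorphism rule is used for f(x y) on the left and for f(y
  z) on the right.\<close>

lemma \<beta>_cocycle:
  assumes x: "x \<in> carrier G" and y: "y \<in> carrier G" and z: "z \<in> carrier G"
  shows "\<beta> x y * \<beta> (x \<otimes> y) z = \<beta> y z * \<beta> x (y \<otimes> z)"
proof -
  let ?X = "conjg G (f x) (y \<otimes> z)"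
  have X1: "?X \<in> U 1" using U1_conjg f_U1 x y z by simp
  have "\<beta> x (y \<otimes> z) = inverse (b (f (y \<otimes> z)) ?X)"
    unfolding \<beta>_def using b_antisym[OF f_U1 X1] y z by simp
  also have "\<dots> = inverse (b (conjg G (f y) z) ?X * b (f z) ?X)"
    using b_f_mult[OF y z X1] by simp
  also have "\<dots> = b ?X (conjg G (f y) z) * b ?X (f z)"
    using b_antisym[OF U1_conjg[OF f_U1[OF y] z] X1] b_antisym[OF f_U1[OF z] X1] by simp
  also have "b ?X (conjg G (f y) z) = \<beta> x y"
    unfolding \<beta>_def using b_conjg[OF U1_conjg[OF f_U1[OF x] y] f_U1[OF y] z] x y z
    by (simp add: conjg_conjg)
  finally have "\<beta> x (y \<otimes> z) = \<beta> x y * b ?X (f z)" .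
  moreover have "\<beta> (x \<otimes> y) z = b ?X (f z) * \<beta> y z"
    unfolding \<beta>_def using b_conjg_f_mult[OF x y z f_U1[OF z]] .
  ultimately show ?thesis by simp
qed

lemma \<beta>_one: "x \<in> carrier G \<Longrightarrow> \<beta> \<one> x = 1" "x \<in> carrier G \<Longrightarrow> \<beta> x \<one> = 1"
  using f_id[OF U1_one] f_U1 by (simp_all add: \<beta>_def b_one)

lemma \<beta>_Um_right: "x \<in> carrier G \<Longrightarrow> z \<in> U m \<Longrightarrow> \<beta> x z = 1"
  unfolding \<beta>_def using f_id[OF Um_U1] b_Um(1)[OF U1_conjg[OF f_U1]] by simp

lemma \<beta>_P1: "x \<in> U 1 \<Longrightarrow> y \<in> U 1 \<Longrightarrow> \<beta> x y = b x y"
  unfolding \<beta>_def by (simp add: f_id b_conjg_P1)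

text \<open>The 2-cocycle \<open>\<beta>\<close> is the cup product of \<open>f\<close> with itself along \<open>b\<close>. Commuting pairs of \<open>G\<close> lift to commuting
  pairs of the central extension \<open>E\<close>, whence \<open>E\<close> receives a homomorphism from the curly exterior square.\<close>
definition E :: "('a \<times> complex) monoid" where
  "E = \<lparr>carrier = carrier G \<times> (- {0}),
    monoid.mult = (\<lambda>(x, a) (y, d). (x \<otimes> y, a * d * \<beta> x y)), one = (\<one>, 1)\<rparr>"

lemma E_simps [simp]:
  "(x, a) \<in> carrier E \<longleftrightarrow> x \<in> carrier G \<and> a \<noteq> 0"
  "(x, a) \<otimes>\<^bsub>E\<^esub> (y, d) = (x \<otimes> y, a * d * \<beta> x y)"
  "\<one>\<^bsub>E\<^esub> = (\<one>, 1)"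
  by (simp_all add: E_def)

sublocale E: group E
proof (rule groupI)
  fix e1 e2 e3 assume "e1 \<in> carrier E" "e2 \<in> carrier E" "e3 \<in> carrier E"
  moreover obtain x a y d z g where "e1 = (x, a)" "e2 = (y, d)" "e3 = (z, g)" by (metis surj_pair)
  ultimately show "e1 \<otimes>\<^bsub>E\<^esub> e2 \<otimes>\<^bsub>E\<^esub> e3 = e1 \<otimes>\<^bsub>E\<^esub> (e2 \<otimes>\<^bsub>E\<^esub> e3)"
    using \<beta>_cocycle[of x y z] by (simp add: m_assoc)
next
  fix e assume e: "e \<in> carrier E"
  obtain x a where xa: "e = (x, a)" by (metis surj_pair)
  then have x: "x \<in> carrier G" "a \<noteq> 0" using e by simp_all
  have "(inv x, inverse (a * \<beta> (inv x) x)) \<otimes>\<^bsub>E\<^esub> e = \<one>\<^bsub>E\<^esub>"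
    using xa x \<beta>_nonzero[of "inv x" x] by (simp add: field_simps)
  moreover have "(inv x, inverse (a * \<beta> (inv x) x)) \<in> carrier E"
    using x \<beta>_nonzero[of "inv x" x] by simp
  ultimately show "\<exists>e'\<in>carrier E. e' \<otimes>\<^bsub>E\<^esub> e = \<one>\<^bsub>E\<^esub>" by blast
  show "\<one>\<^bsub>E\<^esub> \<otimes>\<^bsub>E\<^esub> e = e" using xa x by (simp add: \<beta>_one)
next
  fix e1 e2 assume "e1 \<in> carrier E" "e2 \<in> carrier E"
  moreover obtain x a y d where "e1 = (x, a)" "e2 = (y, d)" by (metis surj_pair)
  ultimately show "e1 \<otimes>\<^bsub>E\<^esub> e2 \<in> carrier E" using \<beta>_nonzero[of x y] by simp
qed simp

lemma fst_mult: "fst (e1 \<otimes>\<^bsub>E\<^esub> e2) = fst e1 \<otimes> fst e2"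
  by (cases e1, cases e2) simp

lemma fst_carrier: "e \<in> carrier E \<Longrightarrow> fst e \<in> carrier G"
  by (cases e) simp

lemma fst_inv:
  assumes "e \<in> carrier E"
  shows "fst (inv\<^bsub>E\<^esub> e) = inv (fst e)"
proof -
  have "fst (inv\<^bsub>E\<^esub> e) \<otimes> fst e = \<one>"
    using fst_mult[of "inv\<^bsub>E\<^esub> e" e] assms by simp
  then show ?thesis using inv_equality fst_carrier assms E.inv_closed by metis
qed

lemma fst_comm: "e1 \<in> carrier E \<Longrightarrow> e2 \<in> carrier E \<Longrightarrow> fst (comm E e1 e2) = comm G (fst e1) (fst e2)"
  by (simp add: comm_def fst_mult fst_inv)

lemma fst_conjg: "e1 \<in> carrier E \<Longrightarrow> e2 \<in> carrier E \<Longrightarrow> fst (conjg E e1 e2) = conjg G (fst e1) (fst e2)"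
  by (simp add: conjg_def fst_mult fst_inv)

lemma fst_pow: "fst (e [^]\<^bsub>E\<^esub> (j::nat)) = fst e [^] j"
  by (induction j) (simp_all add: fst_mult)

definition \<phi> :: "'a \<Rightarrow> 'a \<Rightarrow> 'a \<times> complex" where "\<phi> x y = comm E (x, 1) (y, 1)"

text \<open>Elements with first component \<one> are central, so a commutator does not depend on the
  chosen lifts. This lets \<open>\<phi>\<close> inherit the commutator identities of
  \<open>E\<close>.\<close>

lemma comm_E_eq:
  assumes "e1 \<in> carrier E" "e2 \<in> carrier E"
  shows "comm E e1 e2 = \<phi> (fst e1) (fst e2)"
proof -
  have central: "z \<otimes>\<^bsub>E\<^esub> e = e \<otimes>\<^bsub>E\<^esub> z" if "z = (\<one>, a)" "e \<in> carrier E" for z a e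
    using that by (cases e) (simp add: \<beta>_one)
  obtain x a y d where xy: "e1 = (x, a)" "e2 = (y, d)" by (metis surj_pair)
  then have c: "x \<in> carrier G" "y \<in> carrier G" "a \<noteq> 0" "d \<noteq> 0" using assms by simp_all
  define z1 :: "'a \<times> complex" where "z1 = (\<one>, a)"
  define z2 :: "'a \<times> complex" where "z2 = (\<one>, d)"
  have z: "z1 \<in> carrier E" "z2 \<in> carrier E" using c by (simp_all add: z1_def z2_def)
  have e: "e1 = (x, 1) \<otimes>\<^bsub>E\<^esub> z1" "e2 = (y, 1) \<otimes>\<^bsub>E\<^esub> z2"
    using c xy by (simp_all add: z1_def z2_def \<beta>_one)
  have c1: "comm E z1 e = \<one>\<^bsub>E\<^esub>" "comm E e z2 = \<one>\<^bsub>E\<^esub>" if "e \<in> carrier E" for e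
    using central[OF z1_def that] central[OF z2_def that] z that by (simp_all only: E.comm_eq_one_iff)
  have cE: "(x, 1) \<in> carrier E" "(y, 1) \<in> carrier E" using c by simp_all
  have conj: "conjg E e z1 = e" "conjg E e z2 = e" if "e \<in> carrier E" for e
    using E.comm_eq_one_sym[OF z(1) that c1(1)[OF that]] c1(2)[OF that] z that
    by (simp_all only: E.conjg_eq_comm E.r_one)
  have "comm E ((x, 1) \<otimes>\<^bsub>E\<^esub> z1) e2 = comm E (x, 1) e2"
    using E.comm_mult_left[OF cE(1) z(1) assms(2)] conj(1)[OF E.comm_closed[OF cE(1) assms(2)]] c1(1)[OF assms(2)]
      E.r_one[OF E.comm_closed[OF cE(1) assms(2)]] by (simp only:)
  also have "\<dots> = comm E (x, 1) (y, 1)"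
    using E.comm_mult_right[OF cE z(2)] conj(2)[OF E.comm_closed[OF cE]] c1(2)[OF cE(1)]
      E.l_one[OF E.comm_closed[OF cE]] by (simp only: e(2))
  finally have "comm E e1 e2 = comm E (x, 1) (y, 1)" unfolding e(1)[symmetric] .
  then show ?thesis unfolding \<phi>_def by (simp add: xy)
qed

text \<open>If \<open>x\<close> is outside P_1, then y = z x^j where \<open>z\<close> in P_1
  centralizes \<open>x\<close> and so lies in \<open>U m\<close>; the cocycle is 1 on (x, z) and (z,
  x), and powers of a lift commute with it. Inside P_1 the cocycle is \<open>b\<close>, which is 1
  on commuting elements.\<close>

lemma \<phi>_comm:
  assumes x: "x \<in> carrier G" and y: "y \<in> carrier G" and xy: "comm G x y = \<one>"
  shows "\<phi> x y = \<one>\<^bsub>E\<^esub>"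
proof -
  have c: "(z, 1) \<in> carrier E" if "z \<in> carrier G" for z using that by simp
  have outer: "\<phi> x y = \<one>\<^bsub>E\<^esub>" if x: "x \<in> carrier G" "x \<notin> U 1" and y: "y \<in> carrier G" and xy: "comm G x y = \<one>" for x y
  proof -
    obtain j :: nat where j: "y \<otimes> inv (x [^] j) \<in> U 1" using G_gen[OF x y] by blast
    define z where "z = y \<otimes> inv (x [^] j)"
    have z1: "z \<in> U 1" and zG: "z \<in> carrier G" using j by (simp_all add: z_def)
    have y_eq: "y = z \<otimes> x [^] j" using x y by (simp add: z_def m_assoc)
    have xxj: "comm G x (x [^] j) = \<one>"
      using x nat_pow_Suc2[of x j] by (simp add: comm_eq_one_iff)
    have "comm G x (z \<otimes> x [^] j) = \<one>" using xy y_eq by simp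
    then have "conjg G (comm G x z) (x [^] j) = \<one>" using x zG xxj by (simp add: comm_mult_right)
    then have "conjg G (conjg G (comm G x z) (x [^] j)) (inv (x [^] j)) = \<one>" using x by simp
    then have xz: "comm G x z = \<one>" using x zG by simp
    then have zx: "comm G z x = \<one>" using comm_eq_one_sym x zG by simp
    have zm: "z \<in> U m" by (rule centralizer_small[OF x z1 zx])
    have "conjg G z x = z" using conjg_eq_comm[OF zG x(1)] zx zG by simp
    then have "\<beta> z x = 1" using b_Um(2)[OF f_U1[OF x(1)] zm] by (simp add: \<beta>_def f_id[OF z1])
    then have "(x, 1) \<otimes>\<^bsub>E\<^esub> (z, 1) = (z, 1) \<otimes>\<^bsub>E\<^esub> (x, 1)"
      using \<beta>_Um_right[OF x(1) zm] xz comm_eq_one_iff[OF x(1) zG] by simp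
    then have 1: "comm E (x, 1) (z, 1) = \<one>\<^bsub>E\<^esub>" using E.comm_eq_one_iff[OF c c] x zG by blast
    let ?xj = "(x, 1) [^]\<^bsub>E\<^esub> j"
    have xjE: "?xj \<in> carrier E" using E.nat_pow_closed[OF c[OF x(1)]] .
    have "(x, 1) \<otimes>\<^bsub>E\<^esub> ?xj = ?xj \<otimes>\<^bsub>E\<^esub> (x, 1)"
      using E.nat_pow_Suc2[OF c[OF x(1)], of j] E.nat_pow_Suc[of "(x, 1)" j] by metis
    then have 2: "comm E (x, 1) ?xj = \<one>\<^bsub>E\<^esub>" using E.comm_eq_one_iff[OF c xjE] x by blast
    \<comment> \<open>The product is a lift of \<open>y\<close>, possibly not (y, 1);
      \<open>comm_E_eq\<close> makes the difference harmless.\<close>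
    have "comm E (x, 1) ((z, 1) \<otimes>\<^bsub>E\<^esub> ?xj) = \<one>\<^bsub>E\<^esub>"
      using E.comm_mult_right[OF c[OF x(1)] c[OF zG] xjE] 1 2 xjE
      by (simp del: E_simps)
    moreover have "fst ((z, 1) \<otimes>\<^bsub>E\<^esub> ?xj) = y" by (simp add: fst_mult fst_pow y_eq)
    ultimately show ?thesis
      using comm_E_eq[OF c[OF x(1)] E.m_closed[OF c[OF zG] xjE]] by simp
  qed
  show ?thesis
  proof (cases "x \<in> U 1")
    case False
    then show ?thesis using outer assms by blast
  next
    case x1: True
    show ?thesis
    proof (cases "y \<in> U 1")
      case True
      have "b x y = 1" using b_eq_one_iff[OF x1 True] xy subgroup.one_closed[OF U_subgroup] by simp
      moreover from this have "b y x = 1" using b_antisym[OF x1 True] by simp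
      ultimately have "(x, 1) \<otimes>\<^bsub>E\<^esub> (y, 1) = (y, 1) \<otimes>\<^bsub>E\<^esub> (x, 1)"
        using \<beta>_P1 x1 True xy comm_eq_one_iff[OF x y] by simp
      then show ?thesis unfolding \<phi>_def using E.comm_eq_one_iff[OF c[OF x] c[OF y]] by blast
    next
      case False
      then have "\<phi> y x = \<one>\<^bsub>E\<^esub>" using outer[OF y _ x] comm_eq_one_sym[OF x y xy] by blast
      then show ?thesis unfolding \<phi>_def using E.comm_eq_one_sym[OF c[OF y] c[OF x]] by blast
    qed
  qed
qed

lemma \<phi>_pairing: "curly_pairing G E \<phi>"
proof (intro curly_pairing.intro curly_pairing_axioms.intro)
  show "group G" "group E" by unfold_locales
next
  fix x y z assume xyz: "x \<in> carrier G" "y \<in> carrier G" "z \<in> carrier G"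
  have c: "(w, 1) \<in> carrier E" if "w \<in> carrier G" for w using that by simp
  note cx = c[OF xyz(1)] and cy = c[OF xyz(2)] and cz = c[OF xyz(3)]
  have "\<phi> (x \<otimes> y) z = comm E ((x, 1) \<otimes>\<^bsub>E\<^esub> (y, 1)) (z, 1)"
    using comm_E_eq[OF E.m_closed[OF cx cy] cz] by simp
  also have "\<dots> = comm E (conjg E (x, 1) (y, 1)) (conjg E (z, 1) (y, 1)) \<otimes>\<^bsub>E\<^esub> comm E (y, 1) (z, 1)"
    by (simp only: E.comm_mult_left[OF cx cy cz] E.conjg_comm[OF cx cz cy])
  also have "comm E (conjg E (x, 1) (y, 1)) (conjg E (z, 1) (y, 1)) = \<phi> (conjg G x y) (conjg G z y)"
    using comm_E_eq[OF E.conjg_closed[OF cx cy] E.conjg_closed[OF cz cy]] fst_conjg[OF cx cy] fst_conjg[OF cz cy]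
    by simp
  finally show "\<phi> (x \<otimes> y) z = \<phi> (conjg G x y) (conjg G z y) \<otimes>\<^bsub>E\<^esub> \<phi> y z" by (simp only: \<phi>_def)
  have "\<phi> x (y \<otimes> z) = comm E (x, 1) ((y, 1) \<otimes>\<^bsub>E\<^esub> (z, 1))"
    using comm_E_eq[OF cx E.m_closed[OF cy cz]] by simp
  also have "\<dots> = comm E (x, 1) (z, 1) \<otimes>\<^bsub>E\<^esub> comm E (conjg E (x, 1) (z, 1)) (conjg E (y, 1) (z, 1))"
    by (simp only: E.comm_mult_right[OF cx cy cz] E.conjg_comm[OF cx cy cz])
  also have "comm E (conjg E (x, 1) (z, 1)) (conjg E (y, 1) (z, 1)) = \<phi> (conjg G x z) (conjg G y z)"
    using comm_E_eq[OF E.conjg_closed[OF cx cz] E.conjg_closed[OF cy cz]] fst_conjg[OF cx cz] fst_conjg[OF cy cz]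
    by simp
  finally show "\<phi> x (y \<otimes> z) = \<phi> x z \<otimes>\<^bsub>E\<^esub> \<phi> (conjg G x z) (conjg G y z)" by (simp only: \<phi>_def)
next
  fix x y assume xy: "x \<in> carrier G" "y \<in> carrier G"
  then show "\<phi> x y \<in> carrier E" unfolding \<phi>_def by (intro E.comm_closed) simp_all
  show "comm G x y = \<one> \<Longrightarrow> \<phi> x y = \<one>\<^bsub>E\<^esub>" using \<phi>_comm[OF xy] .
qed

section \<open>Evaluation of words in the extension\<close>

definition eval_E :: "'a cword \<Rightarrow> 'a \<times> complex" where
  "eval_E w = foldr (\<lambda>(x, y, t) e. (if t then \<phi> x y else inv\<^bsub>E\<^esub> \<phi> x y) \<otimes>\<^bsub>E\<^esub> e) w \<one>\<^bsub>E\<^esub>"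

lemma \<phi>_closed: "x \<in> carrier G \<Longrightarrow> y \<in> carrier G \<Longrightarrow> \<phi> x y \<in> carrier E"
  using curly_pairing.pair_closed[OF \<phi>_pairing] .

lemma eval_E_cong: "curly_eq G u v \<Longrightarrow> eval_E u = eval_E v"
  by (rule curly_square_eval_cong[OF E.is_group \<phi>_closed eval_E_def \<phi>_pairing])

text \<open>\<open>h\<close> and its conjugates lie in the radical of \<open>b\<close>, so both
  cocycle values are 1 and the lifts satisfy the same commutator relation as \<open>h\<close> and
  \<open>g\<close>.\<close>

lemma \<phi>_penult:
  assumes h: "h \<in> U (m - 1)" and g: "g \<in> carrier G"
  shows "\<phi> h g = (comm G h g, 1)"
proof -
  have hG: "h \<in> carrier G" using h by simp
  have h1: "h \<in> U 1" using U_mono[OF h] m by simp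
  have q: "comm G h g \<in> U m" using comm_in_U[of "m - 1" h g] h g m by simp
  have "conjg G h g \<in> U (m - 1)" using conjg_mem[OF U_normal h g] .
  then have hg: "\<beta> h g = 1"
    unfolding \<beta>_def f_id[OF h1] using b_antisym[OF f_U1[OF g] U1_conjg[OF h1 g]] penult[OF f_U1[OF g]] by simp
  have gh: "\<beta> g h = 1"
    unfolding \<beta>_def f_id[OF h1] using penult[OF U1_conjg[OF f_U1[OF g] hG] h] .
  have "(h, 1) \<otimes>\<^bsub>E\<^esub> (g, 1) = (g, 1) \<otimes>\<^bsub>E\<^esub> (h, 1) \<otimes>\<^bsub>E\<^esub> (comm G h g, 1)"
    using hg gh \<beta>_Um_right[of "g \<otimes> h", OF _ q] hG g by (simp add: comm_calc)
  then show ?thesis unfolding \<phi>_def by (intro E.comm_unique) (use hG g in simp_all)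
qed

lemma eval_E_append:
  assumes "v \<in> cwords G" "w \<in> cwords G"
  shows "eval_E (v @ w) = eval_E v \<otimes>\<^bsub>E\<^esub> eval_E w" "curly_eval G (v @ w) = curly_eval G v \<otimes> curly_eval G w"
proof -
  have cl: "eval_E u \<in> carrier E" "curly_eval G u \<in> carrier G" if "u \<in> cwords G" for u
  proof -
    show "eval_E u \<in> carrier E"
      using that by (induction u) (auto simp: eval_E_def \<phi>_closed simp del: E_simps)
    show "curly_eval G u \<in> carrier G" using that by (induction u) auto
  qed
  show "eval_E (v @ w) = eval_E v \<otimes>\<^bsub>E\<^esub> eval_E w"
    using assms(1)
  proof (induction v)
    case Nil
    then show ?case using E.l_one[OF cl(1)[OF assms(2)]] by (simp only: append_Nil) (simp add: eval_E_def del: E_simps)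
  next
    case (Cons l v)
    obtain x y t where l: "l = (x, y, t)" by (metis surj_pair)
    have xy: "x \<in> carrier G" "y \<in> carrier G" "v \<in> cwords G" using Cons.prems l by simp_all
    define e where "e = (if t then \<phi> x y else inv\<^bsub>E\<^esub> \<phi> x y)"
    have e: "e \<in> carrier E" using \<phi>_closed[OF xy(1,2)] by (simp add: e_def del: E_simps)
    have "eval_E (l # u) = e \<otimes>\<^bsub>E\<^esub> eval_E u" for u by (simp add: eval_E_def l e_def del: E_simps)
    then show ?case
      using Cons.IH[OF xy(3)] E.m_assoc[OF e cl(1)[OF xy(3)] cl(1)[OF assms(2)]] by simp
  qed
  show "curly_eval G (v @ w) = curly_eval G v \<otimes> curly_eval G w"
    using assms(1) by (induction v) (auto simp: cl assms(2) m_assoc)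
qed

text \<open>The words use only letters with one entry in \<open>U (m - 1)\<close>, hence in the radical of \<open>b\<close>, so that \<open>E\<close> sees no
  correction term.\<close>
lemma ex_word:
  assumes "z \<in> U m"
  shows "\<exists>w\<in>cwords G. curly_eval G w = z \<and> eval_E w = (z, 1)"
proof -
  have Um: "U m = comm_subgroup G (U (m - 1)) (carrier G)"
    using lcs_Suc[of "m - 1"] m by (simp add: U_lcs)
  have letter: "comm G h g \<in> U m" if "h \<in> U (m - 1)" "g \<in> carrier G" for h g
    using comm_in_U[of "m - 1" h g] that m by simp
  have mult: "(q, 1) \<otimes>\<^bsub>E\<^esub> (r, 1) = (q \<otimes> r, 1)" if "q \<in> U m" "r \<in> U m" for q r
    using that \<beta>_Um_right by simp
  have "z \<in> generate G {comm G h g |h g. h \<in> U (m - 1) \<and> g \<in> carrier G}"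
    using assms unfolding Um comm_subgroup_def .
  then have "z \<in> U m \<and> (\<exists>w\<in>cwords G. curly_eval G w = z \<and> eval_E w = (z, 1))"
  proof (induction rule: generate.induct)
    case one
    show ?case using subgroup.one_closed[OF U_subgroup] by (intro conjI bexI[of _ "[]"]) (simp_all add: eval_E_def)
  next
    case (incl q)
    then obtain h g where hg: "h \<in> U (m - 1)" "g \<in> carrier G" "q = comm G h g" by blast
    then show ?case
      using letter[OF hg(1,2)] by (intro conjI bexI[of _ "[(h, g, True)]"]) (simp_all add: eval_E_def \<phi>_penult \<beta>_one)
  next
    case (inv q)
    then obtain h g where hg: "h \<in> U (m - 1)" "g \<in> carrier G" "q = comm G h g" by blast
    have q: "q \<in> U m" "inv q \<in> U m" "q \<in> carrier G"
      using letter[OF hg(1,2)] subgroup.m_inv_closed[OF U_subgroup] hg by simp_all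
    have "(inv q, 1) \<otimes>\<^bsub>E\<^esub> (q, 1) = \<one>\<^bsub>E\<^esub>" unfolding mult[OF q(2,1)] using q(3) by simp
    then have "inv\<^bsub>E\<^esub> (q, 1) = (inv q, 1)" by (rule E.inv_equality) (use q in simp_all)
    then show ?case
      using q hg by (intro conjI bexI[of _ "[(h, g, False)]"]) (simp_all add: eval_E_def \<phi>_penult \<beta>_one)
  next
    case (eng q r)
    then obtain v w where vw: "v \<in> cwords G" "curly_eval G v = q" "eval_E v = (q, 1)"
      "w \<in> cwords G" "curly_eval G w = r" "eval_E w = (r, 1)" and qr: "q \<in> U m" "r \<in> U m" by blast
    have "curly_eval G (v @ w) = q \<otimes> r" "eval_E (v @ w) = (q \<otimes> r, 1)" "v @ w \<in> cwords G"
      using eval_E_append[OF vw(1,4)] vw mult[OF qr] by simp_all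
    then show ?case using subgroup.m_closed[OF U_subgroup qr] by blast
  qed
  then show ?thesis by blast
qed

theorem not_B0_trivial:
  assumes x: "x \<in> U 1" and y: "y \<in> U 1" and xy: "b x y \<noteq> 1"
  shows "\<not> B0_trivial G"
proof
  assume B0: "B0_trivial G"
  have xG: "x \<in> carrier G" and yG: "y \<in> carrier G" using x y by simp_all
  define q where "q = comm G x y"
  have q: "q \<in> U m" unfolding q_def by (rule comm_P1[OF x y])
  have qG: "q \<in> carrier G" and qi: "inv q \<in> U m" using q subgroup.m_inv_closed[OF U_subgroup q] by simp_all
  obtain w where w: "w \<in> cwords G" "curly_eval G w = inv q" "eval_E w = (inv q, 1)"
    using ex_word[OF qi] by blast
  have "curly_eq G ((x, y, True) # w) []"
    using B0 w xG yG qG unfolding B0_trivial_def by (auto simp: q_def)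
  from eval_E_cong[OF this] have 1: "\<phi> x y \<otimes>\<^bsub>E\<^esub> (inv q, 1) = (\<one>, 1)"
    using w(3) by (simp add: eval_E_def)
  obtain k where k: "\<phi> x y = (q, k)"
    using fst_comm[of "(x, 1)" "(y, 1)"] xG yG by (cases "\<phi> x y") (simp add: \<phi>_def q_def)
  \<comment> \<open>In \<open>E\<close> the second component of this commutator is \<beta>(x, y) /
    \<beta>(y, x), the square of \<open>b x y\<close>; triviality of the word forces it to be
    1.\<close>
  have "k = 1" using 1 k \<beta>_Um_right[OF qG qi] by simp
  then have "comm E (x, 1) (y, 1) = (q, 1)" using k by (simp add: \<phi>_def)
  then have "(x, 1) \<otimes>\<^bsub>E\<^esub> (y, 1) = (y, 1) \<otimes>\<^bsub>E\<^esub> (x, 1) \<otimes>\<^bsub>E\<^esub> (q, 1)"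
    using E.mult_swap_comm[of "(x, 1)" "(y, 1)"] xG yG by (simp del: E_simps(2))
  then have "\<beta> x y = \<beta> y x" using \<beta>_Um_right[of "y \<otimes> x", OF _ q] xG yG by simp
  then have "b x y = inverse (b x y)" using \<beta>_P1 x y b_antisym[OF x y] by simp
  then have "b x y ^ 2 = 1" using b_nonzero[OF x y] by (simp add: power2_eq_square field_simps)
  moreover have "\<not> p dvd 2" using prime_odd[OF x y xy] p1 by (auto dest: dvd_imp_le)
  ultimately show False using power_eq_one_prime[OF prime b_power_p[OF x y]] xy by blast
qed

end

section \<open>Choice of the level when the commutator condition fails\<close>

context maximal_class
begin

declare One_nat_def [simp del]

theorem B0_trivial_only_if:
  assumes B0: "B0_trivial G"
  shows "comm_subgroup G (U 1) (U 1) = comm_subgroup G (U 1) (U (n - 2))"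
proof (rule ccontr)
  let ?C = "comm_subgroup G (U 1) (U (n - 2))"
  assume neq: "comm_subgroup G (U 1) (U 1) \<noteq> ?C"
  have n21: "U (n - 2) \<subseteq> U 1" using n4 by (intro U_antimono) simp
  have C: "subgroup ?C G"
    using comm_subgroup_normal[OF U_normal U_normal] normal_imp_subgroup by blast
  have "?C \<subseteq> comm_subgroup G (U 1) (U 1)"
    unfolding comm_subgroup_def by (rule mono_generate) (use n21 in blast)
  then obtain u0 v0 where uv0: "u0 \<in> U 1" "v0 \<in> U 1" "comm G u0 v0 \<notin> ?C"
    using comm_subgroup_incl[OF C, of "U 1" "U 1"] neq by blast
  then have uv1: "comm G u0 v0 \<noteq> \<one>" using subgroup.one_closed[OF C] by auto
  let ?P = "\<lambda>k. \<forall>u\<in>U 1. \<forall>v\<in>U 1. comm G u v \<in> U k"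
  \<comment> \<open>\<open>?P 4\<close> always holds and \<open>?P n\<close> fails for
    \<open>u0\<close> and \<open>v0\<close>, so the property is lost at some level in
    between.\<close>
  have "\<exists>m\<ge>4. m < n \<and> ?P m \<and> \<not> ?P (Suc m)"
  proof (rule ccontr)
    assume *: "\<not> ?thesis"
    have "?P n" using n4
    proof (induction n rule: dec_induct)
      case base
      then show ?case using comm_P1_U4 by blast
    next
      case (step k)
      then show ?case using * by blast
    qed
    then have "comm G u0 v0 \<in> U n" using uv0 by blast
    then show False using uv1 U_trivial[of n] by simp
  qed
  then obtain m where m: "4 \<le> m" "m < n" and P: "?P m" "\<not> ?P (Suc m)" by blast
  have "1 \<le> m" using m by simp
  then obtain c where c: "is_char G p (U m) (U (Suc m)) c" using U_char m(2) by blast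
  interpret maximal_class_level G p n m c
    by (intro maximal_class_level.intro maximal_class_axioms maximal_class_level_axioms.intro)
      (use m P c in blast)+
  obtain s where s: "s \<in> carrier G" "s \<notin> U 1" using P1_proper P1_carrier by (auto simp: U_1)
  have "b u v = 1" if u: "u \<in> U 1" and v: "v \<in> U (m - 1)" for u v
  proof (cases "Suc m < n")
    case True
    then show ?thesis using comm_P1_penultimate u v by blast
  next
    case False
    then have mn: "m = n - 1" "m - 1 = n - 2" using m by simp_all
    \<comment> \<open>Here \<open>U m\<close> has order \<open>p\<close>, so a nontrivial commutator
      of P_1 with P_(n-2) would generate it and put [u0, v0] into \<open>?C\<close>.\<close>
    have "comm G u v = \<one>"
    proof (rule ccontr)
      assume uv: "comm G u v \<noteq> \<one>"
      have v2: "v \<in> U (n - 2)" using v mn by simp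
      have "comm G u v \<in> U (n - 1)" "comm G u0 v0 \<in> U (n - 1)" using P(1) u v2 n21 uv0 mn(1) by auto
      then obtain j :: nat where j: "comm G u0 v0 = comm G u v [^] j" using U_last_pow uv by blast
      have "comm G u v \<in> ?C" by (rule comm_in_comm_subgroup[OF u v2])
      then have "comm G u v [^] j \<in> ?C"
        by (induction j) (auto intro: subgroup.one_closed[OF C] subgroup.m_closed[OF C])
      then show False using uv0 j by simp
    qed
    then show ?thesis using char_one[OF U_subgroup c p0] by (simp add: b_def)
  qed
  then interpret maximal_class_extension G p n m c s
    by (intro maximal_class_extension.intro maximal_class_level_axioms maximal_class_extension_axioms.intro s)
  obtain x y where xy: "x \<in> U 1" "y \<in> U 1" "comm G x y \<notin> U (Suc m)" using P(2) by blast
  then have "b x y \<noteq> 1" using b_eq_one_iff by blast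
  then show False using not_B0_trivial[OF xy(1,2)] B0 by blast
qed

end

theorem theorem1:
  fixes G :: "('a, 'b) monoid_scheme" and p n :: nat
  assumes "maximal_class_pgroup G p n" and "n \<ge> 4"
  shows "B0_trivial G \<longleftrightarrow>
           comm_subgroup G (Pser G 1) (Pser G 1) = comm_subgroup G (Pser G 1) (Pser G (n - 2))"
proof -
  interpret maximal_class G p n
    using assms unfolding maximal_class_pgroup_def
    by (intro maximal_class.intro maximal_class_axioms.intro) blast+
  show ?thesis using B0_trivial_if B0_trivial_only_if by blast
qed

end
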